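(* Let $m>2$, let $U\subset\mathbb R^{2m}$ be open, and let $\omega\in\Omega^m(U)$ be a closed form of linear type $\mathrm{Re}\big((dx^1+i\,dx^2)\wedge\dots\wedge(dx^{2m-1}+i\,dx^{2m})\big)$ (at every point of $U$). Then, up to sign, there is a unique almost-complex structure $J$ on $U$ such that the following equality holds for all $p\in U$ and $v,w\in T_pU$: $$\iota_{J(w)}\iota_v\omega=\iota_w\iota_{J(v)}\omega .$$ Furthermore, $(U,\omega)$ is flat if and only if $J$ is integrable.
   Context: Linear type: $\omega_p$ has the linear type of a constant real form $\eta\in\Lambda^m(\mathbb R^{2m})^*$ if there is a linear isomorphism $L:T_pU\to\mathbb R^{2m}$ with $L^*\eta=\omega_p$. Here $\Omega^m(U)$ denotes smooth real $m$-forms on $U$ and $\iota$ denotes contraction. An almost-complex structure is a smooth section $J$ of $\mathrm{End}(TU)$ with $J^2=-\mathrm{id}$; it is integrable if it is induced by a complex manifold structure on $U$. Flat: $(U,\omega)$ is flat if for every $p\in U$ there is a chart $\phi:U'\to T_pU$ on an open neighbourhood $U'\subset U$ of $p$ (a diffeomorphism onto an open subset) with $\phi(p)=0$ and $\phi^*\omega_p=\omega|_{U'}$, where $\omega_p$ is regarded as a constant-coefficient form on the vector space $T_pU$.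
   Formalization: A global smooth J, unique up to one sign, can fail to exist or be unique; J is taken as a smooth field of pairs {J,-J}, integrable if its local representatives are; a global J is asserted for m odd or simply connected components, unique up to sign on each component. *)

theory Defs
  imports "HOL-Analysis.Analysis"
begin

section \<open>Smooth maps\<close>

text \<open>Derivatives are taken with respect to full neighbourhoods, so these notions are meant for
  open sets \<open>S\<close>.\<close>

primrec Ck_on :: "nat \<Rightarrow> 'a::real_normed_vector set \<Rightarrow> ('a \<Rightarrow> 'b::real_normed_vector) \<Rightarrow> bool" where
  "Ck_on 0 S f \<longleftrightarrow> continuous_on S f"
| "Ck_on (Suc k) S f \<longleftrightarrow>
     (\<forall>x\<in>S. f differentiable (at x)) \<and> (\<forall>v. Ck_on k S (\<lambda>x. frechet_derivative f (at x) v))"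

definition smooth_on :: "'a::real_normed_vector set \<Rightarrow> ('a \<Rightarrow> 'b::real_normed_vector) \<Rightarrow> bool" where
  "smooth_on S f \<longleftrightarrow> (\<forall>k. Ck_on k S f)"

definition chart_on :: "'a::real_normed_vector set \<Rightarrow> ('a \<Rightarrow> 'b::real_normed_vector) \<Rightarrow> bool" where
  "chart_on V \<phi> \<longleftrightarrow> open V \<and> open (\<phi> ` V) \<and> inj_on \<phi> V \<and>
     smooth_on V \<phi> \<and> smooth_on (\<phi> ` V) (inv_into V \<phi>)"

section \<open>Differential forms\<close>

text \<open>A \<open>k\<close>-form on a vector space is a function of the list of its \<open>k\<close> arguments. Requiring the
  value \<open>0\<close> on lists of any other length makes equality of forms equality of functions.\<close>

definition alternating_form :: "nat \<Rightarrow> ('a::real_vector list \<Rightarrow> real) \<Rightarrow> bool" where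
  "alternating_form k \<alpha> \<longleftrightarrow>
     (\<forall>vs. length vs \<noteq> k \<longrightarrow> \<alpha> vs = 0) \<and>
     (\<forall>vs i. length vs = k \<longrightarrow> i < k \<longrightarrow> linear (\<lambda>v. \<alpha> (vs[i := v]))) \<and>
     (\<forall>vs i j. length vs = k \<longrightarrow> i < j \<longrightarrow> j < k \<longrightarrow> vs ! i = vs ! j \<longrightarrow> \<alpha> vs = 0)"

definition contract :: "'a \<Rightarrow> ('a list \<Rightarrow> real) \<Rightarrow> 'a list \<Rightarrow> real" where
  "contract v \<alpha> vs = \<alpha> (v # vs)"

definition pullback :: "('a \<Rightarrow> 'b) \<Rightarrow> ('b list \<Rightarrow> real) \<Rightarrow> 'a list \<Rightarrow> real" where
  "pullback L \<beta> vs = \<beta> (map L vs)"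

definition smooth_form ::
  "nat \<Rightarrow> 'a::real_normed_vector set \<Rightarrow> ('a \<Rightarrow> 'a list \<Rightarrow> real) \<Rightarrow> bool" where
  "smooth_form k U \<omega> \<longleftrightarrow>
     (\<forall>p\<in>U. alternating_form k (\<omega> p)) \<and> (\<forall>vs. smooth_on U (\<lambda>p. \<omega> p vs))"

text \<open>The usual formula for the exterior derivative, evaluated on constant vector fields.\<close>

definition ext_deriv ::
  "('a::real_normed_vector \<Rightarrow> 'a list \<Rightarrow> real) \<Rightarrow> 'a \<Rightarrow> 'a list \<Rightarrow> real" where
  "ext_deriv \<omega> p vs =
     (\<Sum>i<length vs.
        (-1) ^ i * frechet_derivative (\<lambda>q. \<omega> q (take i vs @ drop (Suc i) vs)) (at p) (vs ! i))"

definition closed_form ::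
  "'a::real_normed_vector set \<Rightarrow> ('a \<Rightarrow> 'a list \<Rightarrow> real) \<Rightarrow> bool" where
  "closed_form U \<omega> \<longleftrightarrow> (\<forall>p\<in>U. \<forall>vs. ext_deriv \<omega> p vs = 0)"

definition has_linear_type ::
  "('a::real_vector list \<Rightarrow> real) \<Rightarrow> ('b::real_vector list \<Rightarrow> real) \<Rightarrow> bool" where
  "has_linear_type \<alpha> \<eta> \<longleftrightarrow> (\<exists>L. linear L \<and> bij L \<and> pullback L \<eta> = \<alpha>)"

text \<open>The wedge product of a list of covectors, with the convention
  \<open>(\<theta>\<^sub>1 \<and> \<dots> \<and> \<theta>\<^sub>k)(v\<^sub>1, \<dots>, v\<^sub>k) = det (\<theta>\<^sub>i(v\<^sub>j))\<close>.\<close>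

definition wedge_covectors :: "('a \<Rightarrow> 'b::comm_ring_1) list \<Rightarrow> 'a list \<Rightarrow> 'b" where
  "wedge_covectors \<theta>s vs =
     (if length vs = length \<theta>s then
        \<Sum>\<pi> | \<pi> permutes {..<length \<theta>s}. of_int (sign \<pi>) * (\<Prod>i<length \<theta>s. (\<theta>s ! i) (vs ! \<pi> i))
      else 0)"

text \<open>With \<open>m = CARD('m)\<close>, the index type \<open>'m bit0\<close> consists of the residues modulo \<open>2m\<close>, so that
  \<open>real ^ 'm bit0\<close> is \<open>2m\<close>-dimensional; the coordinate \<open>x\<^sup>k\<close> is \<open>x $ of_nat k\<close> for
  \<open>k = 1, \<dots>, 2m\<close> (where \<open>2m\<close> and \<open>0\<close> denote the same index).\<close>

definition dz :: "nat \<Rightarrow> real ^ 'm::finite bit0 \<Rightarrow> complex" where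
  "dz j v = Complex (v $ of_nat (2 * j - 1)) (v $ of_nat (2 * j))"

definition re_complex_volume :: "(real ^ 'm::finite bit0) list \<Rightarrow> real" where
  "re_complex_volume vs = Re (wedge_covectors (map dz [1..<Suc CARD('m)]) vs)"

definition flat_form ::
  "'a::real_normed_vector set \<Rightarrow> ('a \<Rightarrow> 'a list \<Rightarrow> real) \<Rightarrow> bool" where
  "flat_form U \<omega> \<longleftrightarrow>
     (\<forall>p\<in>U. \<exists>V (\<phi> :: 'a \<Rightarrow> 'a). p \<in> V \<and> V \<subseteq> U \<and> chart_on V \<phi> \<and> \<phi> p = 0 \<and>
        (\<forall>q\<in>V. pullback (frechet_derivative \<phi> (at q)) (\<omega> p) = \<omega> q))"

section \<open>Almost-complex structures\<close>

definition almost_complex_structure ::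
  "'a::real_normed_vector set \<Rightarrow> ('a \<Rightarrow> 'a \<Rightarrow>\<^sub>L 'a) \<Rightarrow> bool" where
  "almost_complex_structure U J \<longleftrightarrow>
     smooth_on U J \<and> (\<forall>p\<in>U. J p o\<^sub>L J p = - id_blinfun)"

definition contraction_symmetric :: "('a::real_normed_vector list \<Rightarrow> real) \<Rightarrow> ('a \<Rightarrow>\<^sub>L 'a) \<Rightarrow> bool" where
  "contraction_symmetric \<alpha> A \<longleftrightarrow>
     (\<forall>v w. contract (blinfun_apply A w) (contract v \<alpha>) = contract w (contract (blinfun_apply A v) \<alpha>))"

definition adapted_acs ::
  "'a::real_normed_vector set \<Rightarrow> ('a \<Rightarrow> 'a list \<Rightarrow> real) \<Rightarrow> ('a \<Rightarrow> 'a \<Rightarrow>\<^sub>L 'a) \<Rightarrow> bool" where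
  "adapted_acs U \<omega> J \<longleftrightarrow>
     almost_complex_structure U J \<and> (\<forall>p\<in>U. contraction_symmetric (\<omega> p) (J p))"

definition holomorphic_map_on ::
  "(complex ^ 'm::finite) set \<Rightarrow> (complex ^ 'm \<Rightarrow> complex ^ 'm) \<Rightarrow> bool" where
  "holomorphic_map_on S f \<longleftrightarrow>
     (\<forall>z\<in>S. \<exists>D. (f has_derivative D) (at z) \<and> (\<forall>v. D (\<i> *s v) = \<i> *s D v))"

text \<open>A complex atlas on \<open>U\<close>, compatible with the smooth structure of \<open>U\<close>.\<close>

definition complex_atlas ::
  "(real ^ 'm::finite bit0) set \<Rightarrow> ((real ^ 'm bit0) set \<times> (real ^ 'm bit0 \<Rightarrow> complex ^ 'm)) set \<Rightarrow> bool"
where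
  "complex_atlas U \<A> \<longleftrightarrow>
     (\<Union>(V, \<phi>)\<in>\<A>. V) = U \<and>
     (\<forall>(V, \<phi>)\<in>\<A>. chart_on V \<phi>) \<and>
     (\<forall>(V, \<phi>)\<in>\<A>. \<forall>(W, \<psi>)\<in>\<A>. holomorphic_map_on (\<phi> ` (V \<inter> W)) (\<psi> \<circ> inv_into V \<phi>))"

definition integrable_acs ::
  "(real ^ 'm::finite bit0) set \<Rightarrow> (real ^ 'm bit0 \<Rightarrow> (real ^ 'm bit0) \<Rightarrow>\<^sub>L (real ^ 'm bit0)) \<Rightarrow> bool" where
  "integrable_acs U J \<longleftrightarrow>
     (\<exists>\<A>. complex_atlas U \<A> \<and>
        (\<forall>(V, \<phi>)\<in>\<A>. \<forall>p\<in>V. \<forall>v.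
           frechet_derivative \<phi> (at p) (blinfun_apply (J p) v) = \<i> *s frechet_derivative \<phi> (at p) v))"

text \<open>Almost-complex structures up to sign: fields of pairs \<open>{J, - J}\<close>, where \<open>J\<close> can be chosen
  smoothly near every point. The monodromy of such a field may exchange \<open>J\<close> and \<open>- J\<close>, so a smooth
  choice of \<open>J\<close> on all of \<open>U\<close> need not exist. For even \<open>m\<close> this does happen for the fields in
  question: for \<open>m = 4\<close>, the form \<open>Re (dz\<^sub>1 \<and> \<dots> \<and> dz\<^sub>4)\<close> descends to the quotient of complex
  4-space by \<open>(z\<^sub>1, \<dots>, z\<^sub>4) \<mapsto> (cnj z\<^sub>1 + 1, cnj z\<^sub>2, cnj z\<^sub>3, cnj z\<^sub>4)\<close>, which is diffeomorphic to
  an open subset of real 8-space, while \<open>J\<close> does not descend.\<close>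

definition represents_on ::
  "'a::real_normed_vector set \<Rightarrow> ('a \<Rightarrow> 'a \<Rightarrow>\<^sub>L 'a) \<Rightarrow> ('a \<Rightarrow> ('a \<Rightarrow>\<^sub>L 'a) set) \<Rightarrow> bool" where
  "represents_on V J P \<longleftrightarrow>
     open V \<and> almost_complex_structure V J \<and> (\<forall>q\<in>V. P q = {J q, - J q})"

definition acs_up_to_sign ::
  "'a::real_normed_vector set \<Rightarrow> ('a \<Rightarrow> ('a \<Rightarrow>\<^sub>L 'a) set) \<Rightarrow> bool" where
  "acs_up_to_sign U P \<longleftrightarrow> (\<forall>p\<in>U. \<exists>V J. p \<in> V \<and> V \<subseteq> U \<and> represents_on V J P)"

definition adapted_up_to_sign ::
  "'a::real_normed_vector set \<Rightarrow> ('a \<Rightarrow> 'a list \<Rightarrow> real) \<Rightarrow> ('a \<Rightarrow> ('a \<Rightarrow>\<^sub>L 'a) set) \<Rightarrow> bool" where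
  "adapted_up_to_sign U \<omega> P \<longleftrightarrow>
     acs_up_to_sign U P \<and> (\<forall>p\<in>U. \<forall>A\<in>P p. contraction_symmetric (\<omega> p) A)"

definition integrable_up_to_sign ::
  "(real ^ 'm::finite bit0) set \<Rightarrow>
   (real ^ 'm bit0 \<Rightarrow> ((real ^ 'm bit0) \<Rightarrow>\<^sub>L (real ^ 'm bit0)) set) \<Rightarrow> bool" where
  "integrable_up_to_sign U P \<longleftrightarrow>
     (\<forall>V J. V \<subseteq> U \<longrightarrow> represents_on V J P \<longrightarrow> integrable_acs V J)"

end

(* Proof idea. At each point, omega is the real part of a complex volume form; since m > 2, an
   endomorphism A with omega(Av, w, ...) = omega(v, Aw, ...) sends v into the complex line of v, so
   it is a complex scalar, and A^2 = -1 leaves only J and -J. J is locally smooth as the solution of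
   a linear system of constant rank. A global choice of sign is made by orientation (m odd: antilinear
   isomorphisms reverse it) or by lifting along the double cover {J, -J} (simply connected case).

   If omega is flat, a flat chart carries J to a constant structure, which gives complex charts.
   Conversely, in a complex chart omega = Re (F dz_1 ... dz_m); the m-form F dz has type (m, 0), so
   closedness of its real part forces F to be holomorphic, and replacing one coordinate by a
   primitive of F yields coordinates in which omega is constant. *)

theory Submission
  imports Defs "HOL-Computational_Algebra.Polynomial"
begin

text \<open>The hypothesis gives an isomorphism with the model at each point separately, without
  continuity from point to point. Everything smooth must therefore be recovered from the
  coefficients of \<omega>. For J the equation J^2 = -1 is quadratic, and it is traded for linear
  ones: trace 0 removes the multiples of the identity, and pairing with J at the base point fixes
  the scale. The solution is J/t for a nonzero function t, which is the same for J and -J, and a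
  square root rescales it to square -1. For the density F, evaluating \<omega> with e and with J e
  in the first slot gives the real and imaginary parts of F times a known smooth function.

  In the global constructions only continuity of the sign is at stake: continuous adapted structures
  that agree at a point agree near it, so a continuous choice inherits the smoothness of the local
  ones.

  The primitive is taken along straight segments in one coordinate, so the Jacobian matrix of the
  new coordinates is the identity outside one row and its determinant is F.\<close>

abbreviation fderiv :: "('a::real_normed_vector \<Rightarrow> 'b::real_normed_vector) \<Rightarrow> 'a \<Rightarrow> 'a \<Rightarrow> 'b" where
  "fderiv f x \<equiv> frechet_derivative f (at x)"

section \<open>Calculus of smooth maps\<close>

lemma Ck_on_SucD:
  assumes "Ck_on (Suc k) S f" "x \<in> S"
  shows "(f has_derivative fderiv f x) (at x)"
  using assms by (simp add: frechet_derivative_works)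

text \<open>The choice operator picks from the same predicate on both sides, so the equality holds
  also where no derivative exists.\<close>

lemma frechet_derivative_cong_open:
  assumes "open S" "x \<in> S" "\<And>y. y \<in> S \<Longrightarrow> f y = g y"
  shows "fderiv f x = fderiv g x"
proof -
  have "(f has_derivative D) (at x) \<longleftrightarrow> (g has_derivative D) (at x)" for D
    using assms has_derivative_transform_within_open[of f D x UNIV S g]
      has_derivative_transform_within_open[of g D x UNIV S f] by auto
  then show ?thesis by (simp add: frechet_derivative_def)
qed

lemma Ck_on_cong:
  assumes "open S" "Ck_on k S f" "\<And>x. x \<in> S \<Longrightarrow> f x = g x"
  shows "Ck_on k S g"
  using assms(2,3)
proof (induction k arbitrary: f g)
  case 0
  then show ?case by (simp cong: continuous_on_cong)
next
  case (Suc k)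
  have "(g has_derivative fderiv f x) (at x)" if "x \<in> S" for x
    using Suc.prems \<open>open S\<close> that Ck_on_SucD[OF Suc.prems(1)]
    by (intro has_derivative_transform_within_open[of f _ x UNIV S g]) auto
  moreover have "Ck_on k S (\<lambda>x. fderiv g x v)" for v
  proof (rule Suc.IH)
    show "Ck_on k S (\<lambda>x. fderiv f x v)" using Suc.prems(1) by simp
    show "fderiv f x v = fderiv g x v" if "x \<in> S" for x
      using frechet_derivative_cong_open[OF \<open>open S\<close> that, of f g] Suc.prems(2) by metis
  qed
  ultimately show ?case by (auto simp: differentiable_def)
qed

text \<open>Lets the derivative be given by a formula, since the recursion in \<open>Ck_on\<close>
  mentions the chosen \<open>frechet_derivative\<close>.\<close>

lemma Ck_on_Suc_I:
  assumes "open S" "\<And>x. x \<in> S \<Longrightarrow> (f has_derivative f' x) (at x)"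
    and "\<And>v. Ck_on k S (\<lambda>x. f' x v)"
  shows "Ck_on (Suc k) S f"
proof -
  have "fderiv f x = f' x" if "x \<in> S" for x
    using frechet_derivative_at[OF assms(2)[OF that]] by simp
  then have "Ck_on k S (\<lambda>x. fderiv f x v)" for v
    by (intro Ck_on_cong[OF assms(1) assms(3)[of v]]) simp
  then show ?thesis
    using assms(2) by (auto simp: differentiable_def)
qed

lemma Ck_on_imp_continuous_on:
  assumes "Ck_on k S f"
  shows "continuous_on S f"
proof (cases k)
  case 0
  then show ?thesis using assms by simp
next
  case (Suc l)
  have "continuous (at x) f" if "x \<in> S" for x
    using has_derivative_continuous[OF Ck_on_SucD[OF assms[unfolded Suc] that]] .
  then show ?thesis by (simp add: continuous_at_imp_continuous_on)
qed

lemma Ck_on_Suc_imp: "Ck_on (Suc k) S f \<Longrightarrow> Ck_on k S f"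
proof (induction k arbitrary: f)
  case 0
  then show ?case using Ck_on_imp_continuous_on[of "Suc 0"] by simp
next
  case (Suc k)
  have "Ck_on k S (\<lambda>x. fderiv f x v)" for v
    by (rule Suc.IH) (use Suc.prems[unfolded Ck_on.simps(2)[of "Suc k"]] in blast)
  then show ?case using Suc.prems by simp
qed

lemma Ck_on_subset: "Ck_on k S f \<Longrightarrow> T \<subseteq> S \<Longrightarrow> Ck_on k T f"
  by (induction k arbitrary: f) (auto intro: continuous_on_subset)

lemma Ck_on_local:
  assumes "\<And>p. p \<in> S \<Longrightarrow> \<exists>V. open V \<and> p \<in> V \<and> Ck_on k V f"
  shows "Ck_on k S f"
  using assms
proof (induction k arbitrary: f)
  case 0
  have "continuous (at p) f" if "p \<in> S" for p
    using 0[OF that] continuous_on_eq_continuous_at by auto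
  then show ?case by (simp add: continuous_at_imp_continuous_on)
next
  case (Suc k)
  have "f differentiable at p" if "p \<in> S" for p
    using Suc.prems[OF that] by auto
  moreover have "Ck_on k S (\<lambda>x. fderiv f x v)" for v
    by (rule Suc.IH) (use Suc.prems in force)
  ultimately show ?case by simp
qed

lemma Ck_on_const: "open S \<Longrightarrow> Ck_on k S (\<lambda>x. c)"
proof (induction k arbitrary: c)
  case (Suc k)
  show ?case
    by (rule Ck_on_Suc_I[OF Suc.prems, where f'="\<lambda>x v. 0"])
       (auto intro: Suc)
qed simp

lemma Ck_on_bounded_linear:
  assumes "bounded_linear h" "open S"
  shows "Ck_on k S h"
proof (cases k)
  case 0
  then show ?thesis using assms by (simp add: linear_continuous_on)
next
  case (Suc l)
  show ?thesis unfolding Suc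
    by (rule Ck_on_Suc_I[OF assms(2), where f'="\<lambda>x v. h v"])
       (auto intro: Ck_on_const assms bounded_linear_imp_has_derivative)
qed

lemma Ck_on_bounded_linear_compose:
  assumes h: "bounded_linear h" and S: "open S" and "Ck_on k S f"
  shows "Ck_on k S (\<lambda>x. h (f x))"
  using assms(3)
proof (induction k arbitrary: f)
  case 0
  then show ?case using h
    by (simp add: bounded_linear.continuous_on)
next
  case (Suc k)
  show ?case
  proof (rule Ck_on_Suc_I[OF S, where f'="\<lambda>x v. h (fderiv f x v)"])
    show "((\<lambda>x. h (f x)) has_derivative (\<lambda>v. h (fderiv f x v))) (at x)" if "x \<in> S" for x
      by (rule bounded_linear.has_derivative[OF h Ck_on_SucD[OF Suc.prems that]])
  qed (use Suc in auto)
qed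

lemma Ck_on_add:
  assumes S: "open S" and "Ck_on k S f" "Ck_on k S g"
  shows "Ck_on k S (\<lambda>x. f x + g x)"
  using assms(2,3)
proof (induction k arbitrary: f g)
  case 0
  then show ?case by (simp add: continuous_on_add)
next
  case (Suc k)
  show ?case
    by (rule Ck_on_Suc_I[OF S has_derivative_add])
      (use Suc in \<open>auto intro: Ck_on_SucD\<close>)
qed

lemma Ck_on_bilinear:
  assumes B: "bounded_bilinear B" and S: "open S" and "Ck_on k S f" "Ck_on k S g"
  shows "Ck_on k S (\<lambda>x. B (f x) (g x))"
  using assms(3,4)
proof (induction k arbitrary: f g)
  case 0
  then show ?case using B by (simp add: bounded_bilinear.continuous_on)
next
  case (Suc k)
  show ?case
  proof (rule Ck_on_Suc_I[OF S bounded_bilinear.FDERIV[OF B]])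
    show "Ck_on k S (\<lambda>x. B (f x) (fderiv g x v) + B (fderiv f x v) (g x))" for v
      using Suc.prems by (intro Ck_on_add[OF S] Suc.IH) (auto intro: Ck_on_Suc_imp)
  qed (use Suc.prems in \<open>auto intro: Ck_on_SucD\<close>)
qed

lemmas Ck_on_mult = Ck_on_bilinear[OF bounded_bilinear_mult]
lemmas Ck_on_scaleR = Ck_on_bilinear[OF bounded_bilinear_scaleR]

lemma Ck_on_uminus: "open S \<Longrightarrow> Ck_on k S f \<Longrightarrow> Ck_on k S (\<lambda>x. - f x)"
  by (rule Ck_on_bounded_linear_compose[OF bounded_linear_minus[OF bounded_linear_ident]])

lemma Ck_on_diff:
  assumes "open S" "Ck_on k S f" "Ck_on k S g"
  shows "Ck_on k S (\<lambda>x. f x - g x)"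
  using Ck_on_add[OF assms(1,2) Ck_on_uminus[OF assms(1,3)]] by simp

lemma Ck_on_sum:
  assumes "open S" "\<And>i. i \<in> I \<Longrightarrow> Ck_on k S (f i)"
  shows "Ck_on k S (\<lambda>x. \<Sum>i\<in>I. f i x)"
  using assms(2)
  by (induction I rule: infinite_finite_induct) (auto intro: Ck_on_const Ck_on_add assms(1))

lemma Ck_on_prod:
  fixes f :: "'i \<Rightarrow> 'a::real_normed_vector \<Rightarrow> 'b::real_normed_field"
  assumes "open S" "\<And>i. i \<in> I \<Longrightarrow> Ck_on k S (f i)"
  shows "Ck_on k S (\<lambda>x. \<Prod>i\<in>I. f i x)"
  using assms(2)
  by (induction I rule: infinite_finite_induct) (auto intro: Ck_on_const Ck_on_mult assms(1))

lemma Ck_on_inverse: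
  fixes f :: "'a::real_normed_vector \<Rightarrow> 'b::real_normed_field"
  assumes S: "open S" and "Ck_on k S f" and nz: "\<And>x. x \<in> S \<Longrightarrow> f x \<noteq> 0"
  shows "Ck_on k S (\<lambda>x. inverse (f x))"
  using assms(2)
proof (induction k)
  case 0
  then show ?case using nz by (auto intro: continuous_on_inverse)
next
  case (Suc k)
  show ?case
  proof (rule Ck_on_Suc_I[OF S Deriv.has_derivative_inverse])
    show "Ck_on k S (\<lambda>x. - (inverse (f x) * fderiv f x v * inverse (f x)))" for v
      using Suc.prems Suc.IH[OF Ck_on_Suc_imp[OF Suc.prems]] by (intro Ck_on_uminus Ck_on_mult S) auto
  qed (use Suc.prems nz in \<open>auto intro: Ck_on_SucD\<close>)
qed

lemma Ck_on_divide:
  fixes f :: "'a::real_normed_vector \<Rightarrow> 'b::real_normed_field"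
  assumes "open S" "Ck_on k S f" "Ck_on k S g" "\<And>x. x \<in> S \<Longrightarrow> g x \<noteq> 0"
  shows "Ck_on k S (\<lambda>x. f x / g x)"
  unfolding divide_inverse by (intro Ck_on_mult Ck_on_inverse assms)

lemma Ck_on_sqrt:
  fixes f :: "'a::real_normed_vector \<Rightarrow> real"
  assumes S: "open S" and "Ck_on k S f" and pos: "\<And>x. x \<in> S \<Longrightarrow> f x > 0"
  shows "Ck_on k S (\<lambda>x. sqrt (f x))"
  using assms(2)
proof (induction k)
  case 0
  then show ?case by (auto intro: continuous_intros)
next
  case (Suc k)
  show ?case
  proof (rule Ck_on_Suc_I[OF S])
    fix x assume "x \<in> S"
    have "(sqrt has_derivative (*) (inverse (sqrt (f x)) / 2)) (at (f x))"
      using DERIV_real_sqrt[OF pos[OF \<open>x \<in> S\<close>]] by (simp add: has_field_derivative_def)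
    from has_derivative_compose[OF Ck_on_SucD[OF Suc.prems \<open>x \<in> S\<close>] this]
    show "((\<lambda>x. sqrt (f x)) has_derivative
        (\<lambda>v. inverse (sqrt (f x)) / 2 * fderiv f x v)) (at x)"
      by simp
  next
    have nz: "sqrt (f x) \<noteq> 0" if "x \<in> S" for x
      using pos[OF that] by simp
    have IH: "Ck_on k S (\<lambda>x. sqrt (f x))" using Suc by (blast intro: Ck_on_Suc_imp)
    show "Ck_on k S (\<lambda>x. inverse (sqrt (f x)) / 2 * fderiv f x v)" for v
      using Suc.prems
      by (intro Ck_on_mult Ck_on_divide Ck_on_inverse Ck_on_const S IH nz) auto
  qed
qed

lemma linear_sum_Basis:
  fixes h :: "'a::euclidean_space \<Rightarrow> 'b::real_vector"
  assumes "linear h"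
  shows "h v = (\<Sum>b\<in>Basis. (v \<bullet> b) *\<^sub>R h b)"
  by (metis (no_types, lifting) assms euclidean_representation linear_sum linear_scale sum.cong)

text \<open>\<open>Ck_on\<close> speaks of derivatives in fixed directions, whereas the chain rule
  differentiates f in the direction \<open>fderiv g x v\<close>, which varies with x. Expanding that
  direction in the basis restores fixed directions, to which the induction hypothesis
  applies.\<close>

lemma Ck_on_compose:
  fixes g :: "'a::real_normed_vector \<Rightarrow> 'b::euclidean_space"
  assumes S: "open S" and "Ck_on k T f" "Ck_on k S g" "g ` S \<subseteq> T"
  shows "Ck_on k S (\<lambda>x. f (g x))"
  using assms(2,3)
proof (induction k arbitrary: f)
  case 0
  then show ?case using assms(4) continuous_on_compose2 by fastforce
next
  case (Suc k)
  have f: "(f has_derivative fderiv f (g x)) (at (g x))" if "x \<in> S" for x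
    using that Suc.prems assms(4) by (intro Ck_on_SucD) auto
  show ?case
  proof (rule Ck_on_Suc_I[OF S])
    show "((\<lambda>x. f (g x)) has_derivative
       (\<lambda>v. fderiv f (g x) (fderiv g x v))) (at x)" if "x \<in> S" for x
      using has_derivative_compose[OF Ck_on_SucD[OF Suc.prems(2) that] f[OF that]] .
    have lin: "linear (fderiv f (g x))" if "x \<in> S" for x
      using has_derivative_linear[OF f[OF that]] .
    fix v
    have "Ck_on k S (\<lambda>x. \<Sum>b\<in>Basis. (fderiv g x v \<bullet> b) *\<^sub>R fderiv f (g x) b)"
      using Suc.prems
      by (intro Ck_on_sum Ck_on_scaleR S Suc.IH
           Ck_on_bounded_linear_compose[OF bounded_linear_inner_left S]) (auto intro: Ck_on_Suc_imp)
    then show "Ck_on k S (\<lambda>x. fderiv f (g x) (fderiv g x v))"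
      by (rule Ck_on_cong[OF S]) (simp add: linear_sum_Basis[OF lin, symmetric])
  qed
qed

section \<open>Smooth vectors, bounded linear maps, determinants and linear systems\<close>

lemma bounded_linear_axis: "bounded_linear (axis j :: 'a::real_normed_vector \<Rightarrow> 'a ^ 'n)"
proof
  show "axis j (x + y) = (axis j x + axis j y :: 'a ^ 'n)" for x y
    by (simp add: vec_eq_iff axis_def)
  show "axis j (r *\<^sub>R x) = (r *\<^sub>R axis j x :: 'a ^ 'n)" for r x
    by (simp add: vec_eq_iff axis_def)
  show "\<exists>K. \<forall>x. norm (axis j x :: 'a ^ 'n) \<le> norm x * K"
    by (rule exI[of _ 1]) (simp add: norm_vec_def L2_set_def axis_def if_distrib[of norm] if_distrib[of "\<lambda>x. x\<^sup>2"] cong: if_cong)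
qed

lemma vec_lambda_sum_axis:
  fixes x :: "'n::finite \<Rightarrow> 'a::comm_monoid_add"
  shows "(\<chi> j. x j) = (\<Sum>j\<in>UNIV. axis j (x j))"
  by (simp add: vec_eq_iff axis_def)

lemma Ck_on_vec_lambda:
  fixes f :: "'n::finite \<Rightarrow> 'a::real_normed_vector \<Rightarrow> 'b::real_normed_vector"
  assumes "open S" "\<And>j. Ck_on k S (f j)"
  shows "Ck_on k S (\<lambda>x. \<chi> j. f j x)"
  unfolding vec_lambda_sum_axis
  by (intro Ck_on_sum assms(1) Ck_on_bounded_linear_compose[OF bounded_linear_axis assms(1)] assms(2))

lemma Ck_on_vec_nth: "open S \<Longrightarrow> Ck_on k S f \<Longrightarrow> Ck_on k S (\<lambda>x. f x $ i)"
  by (rule Ck_on_bounded_linear_compose[OF bounded_linear_vec_nth])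

lemma blinfun_sum_Basis:
  fixes A :: "'a::euclidean_space \<Rightarrow>\<^sub>L 'b::real_normed_vector"
  shows "A = (\<Sum>b\<in>Basis. blinfun_scaleR_left (A b) o\<^sub>L blinfun_inner_left b)"
proof (rule blinfun_eqI)
  fix v
  have "linear (blinfun_apply A)" by (simp add: blinfun.bounded_linear_right bounded_linear.linear)
  from linear_sum_Basis[OF this, of v]
  show "A v = (\<Sum>b\<in>Basis. blinfun_scaleR_left (A b) o\<^sub>L blinfun_inner_left b) v"
    by (simp add: blinfun.sum_left inner_commute)
qed

lemma Ck_on_blinfunI:
  fixes A :: "'c::real_normed_vector \<Rightarrow> 'a::euclidean_space \<Rightarrow>\<^sub>L 'b::real_normed_vector"
  assumes "open S" "\<And>b. b \<in> Basis \<Longrightarrow> Ck_on k S (\<lambda>x. A x b)"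
  shows "Ck_on k S A"
proof -
  have "Ck_on k S (\<lambda>x. \<Sum>b\<in>Basis. blinfun_scaleR_left (A x b) o\<^sub>L blinfun_inner_left b)"
    by (intro Ck_on_sum assms 
        Ck_on_bounded_linear_compose[OF bounded_linear_compose[OF
          bounded_bilinear.bounded_linear_left[OF bounded_bilinear_blinfun_compose]
          bounded_linear_blinfun_scaleR_left]])
  then show ?thesis
    by (rule Ck_on_cong[OF assms(1)]) (rule blinfun_sum_Basis[symmetric])
qed

lemma Ck_on_blinfun_apply: "open S \<Longrightarrow> Ck_on k S A \<Longrightarrow> Ck_on k S (\<lambda>x. blinfun_apply (A x) v)"
  by (rule Ck_on_bounded_linear_compose[OF blinfun.bounded_linear_left])

lemma Ck_on_det:
  fixes A :: "'a::real_normed_vector \<Rightarrow> 'b::real_normed_field ^ 'n::finite ^ 'n"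
  assumes "open S" "\<And>i j. Ck_on k S (\<lambda>x. A x $ i $ j)"
  shows "Ck_on k S (\<lambda>x. det (A x))"
  unfolding det_def by (intro Ck_on_sum Ck_on_mult Ck_on_prod Ck_on_const assms)

text \<open>By Cramer's rule.\<close>

lemma Ck_on_solve:
  fixes A :: "'a::real_normed_vector \<Rightarrow> real ^ 'n ^ 'n"
  assumes S: "open S" and "\<And>i j. Ck_on k S (\<lambda>x. A x $ i $ j)" "\<And>i. Ck_on k S (\<lambda>x. r x $ i)"
    and "\<And>x. x \<in> S \<Longrightarrow> det (A x) \<noteq> 0" "\<And>x. x \<in> S \<Longrightarrow> A x *v y x = r x"
  shows "Ck_on k S y"
proof -
  define c where "c = (\<lambda>i x. det (\<chi> a b. if b = i then r x $ a else A x $ a $ b) / det (A x))"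
  have "Ck_on k S (c i)" for i
    unfolding c_def
  proof (intro Ck_on_divide Ck_on_det S)
    show "Ck_on k S (\<lambda>x. (\<chi> a b. if b = i then r x $ a else A x $ a $ b) $ a $ b)" for a b
      using assms(2,3) by (cases "b = i") auto
  qed (use assms in auto)
  then have "Ck_on k S (\<lambda>x. \<chi> i. c i x)"
    by (intro Ck_on_vec_lambda S)
  moreover have "(\<chi> i. c i x) = y x" if "x \<in> S" for x
  proof -
    have "det (\<chi> a b. if b = i then r x $ a else A x $ a $ b) = y x $ i * det (A x)" for i
      using cramer_lemma[of i "A x" "y x"] unfolding assms(5)[OF that] .
    then show ?thesis using assms(4)[OF that] by (simp add: vec_eq_iff c_def)
  qed
  ultimately show ?thesis by (rule Ck_on_cong[OF S])
qed

section \<open>Smooth maps and the symmetry of their second derivatives\<close>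

lemma smooth_onI: "(\<And>k. Ck_on k S f) \<Longrightarrow> smooth_on S f"
  by (simp add: smooth_on_def)

lemma smooth_onD: "smooth_on S f \<Longrightarrow> Ck_on k S f"
  by (simp add: smooth_on_def)

lemma smooth_on_imp_continuous_on: "smooth_on S f \<Longrightarrow> continuous_on S f"
  using smooth_onD[of S f 0] by simp

lemma smooth_on_has_derivative:
  "smooth_on S f \<Longrightarrow> x \<in> S \<Longrightarrow> (f has_derivative fderiv f x) (at x)"
  using Ck_on_SucD smooth_onD by blast

lemma smooth_on_frechet_derivative:
  "smooth_on S f \<Longrightarrow> smooth_on S (\<lambda>x. fderiv f x v)"
  unfolding smooth_on_def using Ck_on.simps(2) by blast

lemma smooth_on_subset: "smooth_on S f \<Longrightarrow> T \<subseteq> S \<Longrightarrow> smooth_on T f"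
  by (auto simp: smooth_on_def intro: Ck_on_subset)

lemma smooth_on_cong: "open S \<Longrightarrow> smooth_on S f \<Longrightarrow> (\<And>x. x \<in> S \<Longrightarrow> f x = g x) \<Longrightarrow> smooth_on S g"
  by (auto simp: smooth_on_def intro: Ck_on_cong)

lemma smooth_on_local:
  assumes "\<And>p. p \<in> S \<Longrightarrow> \<exists>V. open V \<and> p \<in> V \<and> smooth_on V f"
  shows "smooth_on S f"
  by (rule smooth_onI, rule Ck_on_local) (use assms in \<open>auto simp: smooth_on_def\<close>)

lemma continuous_on_blinfun_derivative:
  fixes f :: "'a::euclidean_space \<Rightarrow> 'b::real_normed_vector"
  assumes f: "smooth_on S f"
  shows "continuous_on S (\<lambda>x. Blinfun (fderiv f x))"
proof (rule continuous_on_blinfun_componentwise)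
  fix i :: 'a
  have "Blinfun (fderiv f x) i = fderiv f x i" if "x \<in> S" for x
    using smooth_on_has_derivative[OF f that]
    by (simp add: bounded_linear_Blinfun_apply has_derivative_bounded_linear)
  then show "continuous_on S (\<lambda>x. blinfun_apply (Blinfun (fderiv f x)) i)"
    using smooth_on_imp_continuous_on[OF smooth_on_frechet_derivative[OF f, of i]]
    by (simp cong: continuous_on_cong)
qed

text \<open>The mean value theorem, first in s and then in t, turns the second difference quotient
  into a value of the mixed derivative at a nearby point. The quotient is symmetric in v and w, and
  this is where the symmetry of second derivatives comes from.\<close>

lemma second_difference_estimate:
  fixes f :: "'a::real_normed_vector \<Rightarrow> real"
  assumes S: "open S" "p \<in> S" and f: "smooth_on S f" and "e > 0"
  shows "\<exists>d>0. \<forall>h. 0 < h \<longrightarrow> h < d \<longrightarrow>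
     \<bar>(f (p + h *\<^sub>R v + h *\<^sub>R w) - f (p + h *\<^sub>R v) - f (p + h *\<^sub>R w) + f p) / h\<^sup>2
       - fderiv (\<lambda>q. fderiv f q v) p w\<bar> < e"
proof -
  define g where "g = (\<lambda>q. fderiv f q v)"
  define g' where "g' = (\<lambda>q. fderiv g q w)"
  have g: "smooth_on S g" unfolding g_def by (rule smooth_on_frechet_derivative[OF f])
  have "continuous_on S g'"
    unfolding g'_def by (intro smooth_on_imp_continuous_on smooth_on_frechet_derivative g)
  then obtain r where r: "r > 0" "ball p r \<subseteq> S" "\<And>q. q \<in> ball p r \<Longrightarrow> \<bar>g' q - g' p\<bar> < e"
  proof -
    obtain r1 where "r1 > 0" "\<And>q. q \<in> S \<Longrightarrow> dist q p < r1 \<Longrightarrow> \<bar>g' q - g' p\<bar> < e"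
      using \<open>continuous_on S g'\<close> S \<open>e > 0\<close> unfolding continuous_on_iff dist_real_def by metis
    moreover obtain r2 where "r2 > 0" "ball p r2 \<subseteq> S" using S open_contains_ball by blast
    ultimately show thesis
      by (intro that[of "min r1 r2"]) (auto simp: dist_commute subset_iff)
  qed
  \<comment> \<open>Small enough that the parallelogram with sides below d v and d w stays in the
    ball; the summand 1 keeps the denominator positive when v and w vanish.\<close>
  define d where "d = r / (norm v + norm w + 1)"
  have "d > 0" using r(1) unfolding d_def by (simp add: add_nonneg_pos)
  have inb: "p + s *\<^sub>R v + t *\<^sub>R w \<in> ball p r" if "0 \<le> s" "0 \<le> t" "s < d" "t < d" for s t
  proof -
    have "norm (s *\<^sub>R v + t *\<^sub>R w) \<le> s * norm v + t * norm w"
      using that norm_triangle_le[of "s *\<^sub>R v" "t *\<^sub>R w"] by simp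
    also have "\<dots> \<le> d * norm v + d * norm w"
      using that by (intro add_mono mult_right_mono) auto
    also have "\<dots> < d * (norm v + norm w + 1)" using \<open>d > 0\<close> by (simp add: algebra_simps)
    also have "\<dots> = r" unfolding d_def by (simp add: add_nonneg_eq_0_iff)
    finally have "dist (p + (s *\<^sub>R v + t *\<^sub>R w)) p < r"
      by (simp add: dist_norm)
    then show ?thesis by (simp add: add.assoc dist_commute)
  qed
  show ?thesis
  proof (intro exI[of _ d] conjI allI impI \<open>d > 0\<close>)
    fix h :: real assume h: "0 < h" "h < d"
    \<comment> \<open>The difference in direction w with the full increment h; its derivative in s
      is a difference of values of g, ready for the second mean value step.\<close>
    define \<phi> where "\<phi> = (\<lambda>s. f (p + s *\<^sub>R v + h *\<^sub>R w) - f (p + s *\<^sub>R v))"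
    have fd: "((\<lambda>s. f (p + s *\<^sub>R v + t *\<^sub>R w)) has_real_derivative g (p + s *\<^sub>R v + t *\<^sub>R w)) (at s)"
      if "0 \<le> s" "s \<le> h" "0 \<le> t" "t \<le> h" for s t
    proof -
      have D: "(f has_derivative fderiv f (p + s *\<^sub>R v + t *\<^sub>R w)) (at (p + s *\<^sub>R v + t *\<^sub>R w))"
        using inb[of s t] that h r(2) by (intro smooth_on_has_derivative[OF f]) auto
      have "((\<lambda>s. p + s *\<^sub>R v + t *\<^sub>R w) has_derivative (\<lambda>s. s *\<^sub>R v)) (at s)"
        by (auto intro!: derivative_eq_intros)
      from has_derivative_compose[OF this D] show ?thesis
        unfolding has_field_derivative_def g_def
        by (simp add: linear_scale[OF has_derivative_linear[OF D]] mult.commute[of _ "frechet_derivative _ _ _"])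
    qed
    have gd: "((\<lambda>t. g (p + s *\<^sub>R v + t *\<^sub>R w)) has_real_derivative g' (p + s *\<^sub>R v + t *\<^sub>R w)) (at t)"
      if "0 \<le> s" "s \<le> h" "0 \<le> t" "t \<le> h" for s t
    proof -
      have D: "(g has_derivative fderiv g (p + s *\<^sub>R v + t *\<^sub>R w)) (at (p + s *\<^sub>R v + t *\<^sub>R w))"
        using inb[of s t] that h r(2) by (intro smooth_on_has_derivative[OF g]) auto
      have "((\<lambda>t. p + s *\<^sub>R v + t *\<^sub>R w) has_derivative (\<lambda>t. t *\<^sub>R w)) (at t)"
        by (auto intro!: derivative_eq_intros)
      from has_derivative_compose[OF this D] show ?thesis
        unfolding has_field_derivative_def g'_def
        by (simp add: linear_scale[OF has_derivative_linear[OF D]] mult.commute[of _ "frechet_derivative _ _ _"])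
    qed
    have "(\<phi> has_real_derivative (g (p + s *\<^sub>R v + h *\<^sub>R w) - g (p + s *\<^sub>R v))) (at s)"
      if "0 \<le> s" "s \<le> h" for s
      unfolding \<phi>_def using fd[of s h] fd[of s 0] that h by (auto intro!: derivative_intros)
    from MVT2[OF h(1), of \<phi>, OF this] obtain s where
      s: "0 < s" "s < h" "\<phi> h - \<phi> 0 = (h - 0) * (g (p + s *\<^sub>R v + h *\<^sub>R w) - g (p + s *\<^sub>R v))"
      by auto
    from MVT2[OF h(1), of "\<lambda>t. g (p + s *\<^sub>R v + t *\<^sub>R w)", OF gd] s obtain t where
      t: "0 < t" "t < h" "g (p + s *\<^sub>R v + h *\<^sub>R w) - g (p + s *\<^sub>R v) = h * g' (p + s *\<^sub>R v + t *\<^sub>R w)"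
      by force
    have "(f (p + h *\<^sub>R v + h *\<^sub>R w) - f (p + h *\<^sub>R v) - f (p + h *\<^sub>R w) + f p) / h\<^sup>2 = g' (p + s *\<^sub>R v + t *\<^sub>R w)"
    proof -
      have "f (p + h *\<^sub>R v + h *\<^sub>R w) - f (p + h *\<^sub>R v) - f (p + h *\<^sub>R w) + f p
        = h\<^sup>2 * g' (p + s *\<^sub>R v + t *\<^sub>R w)"
        using s(3) t(3) by (simp add: \<phi>_def power2_eq_square)
      then show ?thesis using h(1) by simp
    qed
    moreover have "\<bar>g' (p + s *\<^sub>R v + t *\<^sub>R w) - g' p\<bar> < e"
      using s t h by (intro r(3) inb) auto
    ultimately show "\<bar>(f (p + h *\<^sub>R v + h *\<^sub>R w) - f (p + h *\<^sub>R v) - f (p + h *\<^sub>R w) + f p) / h\<^sup>2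
       - fderiv (\<lambda>q. fderiv f q v) p w\<bar> < e"
      by (simp add: g'_def g_def)
  qed
qed

lemma symmetric_second_derivative_real:
  fixes f :: "'a::real_normed_vector \<Rightarrow> real"
  assumes S: "open S" "p \<in> S" and f: "smooth_on S f"
  shows "fderiv (\<lambda>q. fderiv f q v) p w
       = fderiv (\<lambda>q. fderiv f q w) p v" (is "?a = ?b")
proof (rule ccontr)
  assume "?a \<noteq> ?b"
  define e where "e = \<bar>?a - ?b\<bar> / 2"
  have "e > 0" using \<open>?a \<noteq> ?b\<close> by (simp add: e_def)
  obtain d1 where d1: "d1 > 0" "\<And>h. 0 < h \<Longrightarrow> h < d1 \<Longrightarrow>
     \<bar>(f (p + h *\<^sub>R v + h *\<^sub>R w) - f (p + h *\<^sub>R v) - f (p + h *\<^sub>R w) + f p) / h\<^sup>2 - ?a\<bar> < e"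
    using second_difference_estimate[OF S f \<open>e > 0\<close>, of v w] by blast
  obtain d2 where d2: "d2 > 0" "\<And>h. 0 < h \<Longrightarrow> h < d2 \<Longrightarrow>
     \<bar>(f (p + h *\<^sub>R w + h *\<^sub>R v) - f (p + h *\<^sub>R w) - f (p + h *\<^sub>R v) + f p) / h\<^sup>2 - ?b\<bar> < e"
    using second_difference_estimate[OF S f \<open>e > 0\<close>, of w v] by blast
  define h where "h = min d1 d2 / 2"
  define \<Delta> where "\<Delta> = (f (p + h *\<^sub>R v + h *\<^sub>R w) - f (p + h *\<^sub>R v) - f (p + h *\<^sub>R w) + f p) / h\<^sup>2"
  have h: "0 < h" "h < d1" "h < d2" using d1(1) d2(1) by (auto simp: h_def)
  have "\<bar>\<Delta> - ?a\<bar> < e" using d1(2)[OF h(1,2)] by (simp add: \<Delta>_def)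
  moreover have "\<bar>\<Delta> - ?b\<bar> < e"
  proof -
    have "f (p + h *\<^sub>R w + h *\<^sub>R v) - f (p + h *\<^sub>R w) - f (p + h *\<^sub>R v) + f p
      = f (p + h *\<^sub>R v + h *\<^sub>R w) - f (p + h *\<^sub>R v) - f (p + h *\<^sub>R w) + f p"
      by (simp add: algebra_simps)
    then show ?thesis using d2(2)[OF h(1,3)] unfolding \<Delta>_def by (simp only:)
  qed
  moreover have "\<bar>a - b\<bar> < 2 * e" if "\<bar>c - a\<bar> < e" "\<bar>c - b\<bar> < e" for a b c :: real
    using that by arith
  ultimately have "\<bar>?a - ?b\<bar> < 2 * e" by blast
  then show False by (simp add: e_def)
qed

lemma frechet_derivative_bounded_linear_compose:
  assumes "bounded_linear h" "f differentiable at x"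
  shows "fderiv (\<lambda>y. h (f y)) x v = h (fderiv f x v)"
proof -
  have "((\<lambda>y. h (f y)) has_derivative (\<lambda>v. h (fderiv f x v))) (at x)"
    using assms(2) unfolding frechet_derivative_works by (rule bounded_linear.has_derivative[OF assms(1)])
  from frechet_derivative_at[OF this, symmetric] show ?thesis by simp
qed

lemma symmetric_second_derivative:
  fixes f :: "'a::real_normed_vector \<Rightarrow> 'b::euclidean_space"
  assumes S: "open S" "p \<in> S" and f: "smooth_on S f"
  shows "fderiv (\<lambda>q. fderiv f q v) p w
       = fderiv (\<lambda>q. fderiv f q w) p v"
proof (rule euclidean_eqI)
  fix b :: 'b assume "b \<in> Basis"
  have fb: "smooth_on S (\<lambda>x. f x \<bullet> b)"
    using f by (auto simp: smooth_on_def intro!: Ck_on_bounded_linear_compose[OF bounded_linear_inner_left S(1)])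
  have 1: "fderiv (\<lambda>x. f x \<bullet> b) q v = fderiv f q v \<bullet> b" if "q \<in> S" for q v
    using smooth_on_has_derivative[OF f that]
    by (intro frechet_derivative_bounded_linear_compose[OF bounded_linear_inner_left]) (auto simp: differentiable_def)
  have 2: "fderiv (\<lambda>q. fderiv (\<lambda>x. f x \<bullet> b) q v) p w
     = fderiv (\<lambda>q. fderiv f q v) p w \<bullet> b" for v w
  proof -
    have "fderiv (\<lambda>q. fderiv (\<lambda>x. f x \<bullet> b) q v) p w
       = fderiv (\<lambda>q. fderiv f q v \<bullet> b) p w"
      using frechet_derivative_cong_open[OF S, of "\<lambda>q. fderiv (\<lambda>x. f x \<bullet> b) q v"] 1 by metis
    also have "\<dots> = fderiv (\<lambda>q. fderiv f q v) p w \<bullet> b"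
      using smooth_on_has_derivative[OF smooth_on_frechet_derivative[OF f] S(2), of v]
      by (intro frechet_derivative_bounded_linear_compose[OF bounded_linear_inner_left]) (auto simp: differentiable_def)
    finally show ?thesis .
  qed
  show "fderiv (\<lambda>q. fderiv f q v) p w \<bullet> b
       = fderiv (\<lambda>q. fderiv f q w) p v \<bullet> b"
    using symmetric_second_derivative_real[OF S fb, of v w] by (simp add: 2)
qed

section \<open>Multilinear maps and exterior derivatives\<close>

text \<open>Weaker than \<open>alternating_form\<close> and with values in any real vector space, so
  that it covers the complex-valued \<open>det_form\<close> and forms whose first arguments are
  already filled in.\<close>

definition multilinear_form :: "nat \<Rightarrow> ('a::real_vector list \<Rightarrow> 'b::real_vector) \<Rightarrow> bool" where
  "multilinear_form k M \<longleftrightarrow> (\<forall>vs i. length vs = k \<longrightarrow> i < k \<longrightarrow> linear (\<lambda>v. M (vs[i := v])))"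

lemma multilinear_formD: "multilinear_form k M \<Longrightarrow> length vs = k \<Longrightarrow> i < k \<Longrightarrow> linear (\<lambda>v. M (vs[i := v]))"
  by (simp add: multilinear_form_def)

lemma alternating_form_multilinear: "alternating_form k \<alpha> \<Longrightarrow> multilinear_form k \<alpha>"
  by (simp add: alternating_form_def multilinear_form_def)

lemma multilinear_form_linear_head:
  assumes "multilinear_form (Suc k) M" "length vs = k"
  shows "linear (\<lambda>v. M (v # vs))"
  using multilinear_formD[OF assms(1), of "undefined # vs" 0] assms(2) by simp

lemma multilinear_form_tail:
  assumes "multilinear_form (Suc k) M"
  shows "multilinear_form k (\<lambda>vs. M (v # vs))"
  unfolding multilinear_form_def
proof (intro allI impI)
  fix vs :: "'a list" and i assume "length vs = k" "i < k"
  then show "linear (\<lambda>w. M (v # vs[i := w]))"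
    using multilinear_formD[OF assms, of "v # vs" "Suc i"] by simp
qed

lemma multilinear_form_zero_on_Basis:
  fixes M :: "'a::euclidean_space list \<Rightarrow> 'b::real_vector"
  assumes "multilinear_form k M" "length vs = k"
    and "\<And>us. length us = k \<Longrightarrow> set us \<subseteq> Basis \<Longrightarrow> M us = 0"
  shows "M vs = 0"
  using assms
proof (induction vs arbitrary: k M)
  case Nil
  then show ?case by simp
next
  case (Cons v vs)
  from Cons.prems(2) obtain l where l: "k = Suc l" "length vs = l" by auto
  have "M (b # vs) = 0" if "b \<in> Basis" for b
  proof (rule Cons.IH)
    show "multilinear_form l (\<lambda>vs. M (b # vs))"
      using multilinear_form_tail Cons.prems(1) l by blast
  qed (use that l Cons.prems(3) in auto)
  then show ?case
    using linear_sum_Basis[OF multilinear_form_linear_head[of l M vs], of v] Cons.prems(1) l by simp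
qed

text \<open>Both the coefficients and the arguments vary with q. Expanding the head in the basis
  leaves a form with a fixed first argument, which is again multilinear in the tail.\<close>

lemma Ck_on_multilinear:
  fixes M :: "'c::real_normed_vector \<Rightarrow> 'a::euclidean_space list \<Rightarrow> 'b::real_normed_vector"
  assumes S: "open S" and "\<And>q. q \<in> S \<Longrightarrow> multilinear_form (length fs) (M q)"
    and "\<And>vs. Ck_on k S (\<lambda>q. M q vs)" and "\<And>f. f \<in> set fs \<Longrightarrow> Ck_on k S f"
  shows "Ck_on k S (\<lambda>q. M q (map (\<lambda>f. f q) fs))"
  using assms(2-4)
proof (induction fs arbitrary: M)
  case Nil
  then show ?case by simp
next
  case (Cons f fs)
  have lin: "linear (\<lambda>v. M q (v # map (\<lambda>f. f q) fs))" if "q \<in> S" for q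
    using Cons.prems(1)[OF that] by (intro multilinear_form_linear_head[of "length fs"]) auto
  have "Ck_on k S (\<lambda>q. \<Sum>b\<in>Basis. (f q \<bullet> b) *\<^sub>R M q (b # map (\<lambda>f. f q) fs))"
  proof (intro Ck_on_sum Ck_on_scaleR S Ck_on_bounded_linear_compose[OF bounded_linear_inner_left S])
    show "Ck_on k S f" using Cons.prems by simp
    show "Ck_on k S (\<lambda>q. M q (b # map (\<lambda>f. f q) fs))" for b
    proof (rule Cons.IH[of "\<lambda>q vs. M q (b # vs)"])
      show "multilinear_form (length fs) (\<lambda>vs. M q (b # vs))" if "q \<in> S" for q
        using multilinear_form_tail[of "length fs" "M q"] Cons.prems(1)[OF that] by simp
      show "Ck_on k S g" if "g \<in> set fs" for g using Cons.prems(3) that by simp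
    qed (rule Cons.prems(2))
  qed
  then show ?case
    by (rule Ck_on_cong[OF S]) (simp add: linear_sum_Basis[OF lin, symmetric])
qed

lemma has_derivative_multilinear:
  fixes M :: "'a::euclidean_space list \<Rightarrow> 'b::real_normed_vector"
  assumes "multilinear_form (length fs) M"
    and "\<And>f. f \<in> set fs \<Longrightarrow> f differentiable at x"
  shows "((\<lambda>q. M (map (\<lambda>f. f q) fs)) has_derivative
     (\<lambda>v. \<Sum>i<length fs. M ((map (\<lambda>f. f x) fs)[i := fderiv (fs ! i) x v]))) (at x)"
  using assms
proof (induction fs arbitrary: M)
  case Nil
  then show ?case by simp
next
  case (Cons f fs)
  let ?xs = "\<lambda>q. map (\<lambda>f. f q) fs"
  have lin: "linear (\<lambda>v. M (v # ?xs q))" for q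
    using Cons.prems(1) by (intro multilinear_form_linear_head[of "length fs"]) auto
  have IH: "((\<lambda>q. M (b # ?xs q)) has_derivative
     (\<lambda>v. \<Sum>i<length fs. M (b # (?xs x)[i := fderiv (fs ! i) x v]))) (at x)" for b
    using Cons.prems by (intro Cons.IH[of "\<lambda>vs. M (b # vs)"] multilinear_form_tail) auto
  have "((\<lambda>q. \<Sum>b\<in>Basis. (f q \<bullet> b) *\<^sub>R M (b # ?xs q)) has_derivative
     (\<lambda>v. \<Sum>b\<in>Basis. (f x \<bullet> b) *\<^sub>R (\<Sum>i<length fs. M (b # (?xs x)[i := fderiv (fs ! i) x v]))
        + (fderiv f x v \<bullet> b) *\<^sub>R M (b # ?xs x))) (at x)"
    using Cons.prems(2)[of f] IH
    by (intro has_derivative_sum has_derivative_scaleR has_derivative_inner_left)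
      (auto simp flip: frechet_derivative_works)
  moreover have "(\<Sum>b\<in>Basis. (f x \<bullet> b) *\<^sub>R (\<Sum>i<length fs. M (b # (?xs x)[i := fderiv (fs ! i) x v]))
        + (fderiv f x v \<bullet> b) *\<^sub>R M (b # ?xs x))
     = (\<Sum>i<length (f # fs). M ((map (\<lambda>f. f x) (f # fs))[i := fderiv ((f # fs) ! i) x v]))" for v
  proof -
    have lin': "linear (\<lambda>w. M (w # (?xs x)[i := u]))" for i u
      using Cons.prems(1) by (intro multilinear_form_linear_head[of "length fs"]) auto
    have "(\<Sum>b\<in>Basis. (f x \<bullet> b) *\<^sub>R (\<Sum>i<length fs. M (b # (?xs x)[i := fderiv (fs ! i) x v])))
       = (\<Sum>i<length fs. M (f x # (?xs x)[i := fderiv (fs ! i) x v]))"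
      by (subst linear_sum_Basis[OF lin', of "f x"]) (simp add: scaleR_sum_right sum.swap[of _ Basis])
    then show ?thesis
      by (simp add: sum.lessThan_Suc_shift sum.distrib linear_sum_Basis[OF lin, symmetric] add.commute del: sum.lessThan_Suc)
  qed
  ultimately show ?case
    by (simp add: linear_sum_Basis[OF lin, symmetric])
qed

section \<open>Alternating forms on lists with a deleted entry\<close>

lemma alternating_form_swap_adjacent:
  assumes \<alpha>: "alternating_form k \<alpha>"
  shows "\<alpha> (xs @ a # b # ys) = - \<alpha> (xs @ b # a # ys)"
proof (cases "length (xs @ a # b # ys) = k")
  case False
  then show ?thesis using \<alpha> by (simp add: alternating_form_def)
next
  case True
  define G where "G = (\<lambda>a b. \<alpha> (xs @ a # b # ys))"
  have 1: "linear (\<lambda>a. G a b)" for b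
    using multilinear_formD[OF alternating_form_multilinear[OF \<alpha>], of "xs @ a # b # ys" "length xs"] True
    by (simp add: G_def)
  have 2: "linear (\<lambda>b. G a b)" for a
    using multilinear_formD[OF alternating_form_multilinear[OF \<alpha>], of "xs @ a # b # ys" "Suc (length xs)"] True
    by (simp add: G_def list_update_append)
  have 3: "G c c = 0" for c
  proof -
    have "length (xs @ c # c # ys) = k \<Longrightarrow> length xs < Suc (length xs) \<Longrightarrow> Suc (length xs) < k \<Longrightarrow>
       (xs @ c # c # ys) ! length xs = (xs @ c # c # ys) ! Suc (length xs) \<Longrightarrow> \<alpha> (xs @ c # c # ys) = 0"
      using \<alpha> unfolding alternating_form_def by blast
    then show ?thesis using True by (simp add: G_def nth_append)
  qed
  have "G (a + b) (a + b) = (G a a + G a b) + (G b a + G b b)"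
    by (simp only: linear_add[OF 1] linear_add[OF 2] ac_simps)
  then have "G a b + G b a = 0" by (simp add: 3)
  then show ?thesis by (simp add: G_def)
qed

lemma alternating_form_move:
  assumes \<alpha>: "alternating_form k \<alpha>"
  shows "\<alpha> (xs @ b # ys @ zs) = (- 1) ^ length ys * \<alpha> (xs @ ys @ b # zs)"
proof (induction ys arbitrary: xs)
  case (Cons y ys)
  have "\<alpha> (xs @ b # y # ys @ zs) = - \<alpha> ((xs @ [y]) @ b # ys @ zs)"
    using alternating_form_swap_adjacent[OF \<alpha>, of xs b y "ys @ zs"] by simp
  then show ?case using Cons[of "xs @ [y]"] by simp
qed simp

text \<open>The argument list of the i-th term of \<open>ext_deriv\<close>.\<close>

definition delete_nth :: "nat \<Rightarrow> 'a list \<Rightarrow> 'a list" where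
  "delete_nth i vs = take i vs @ drop (Suc i) vs"

lemma length_delete_nth: "i < length vs \<Longrightarrow> length (delete_nth i vs) = length vs - 1"
  by (simp add: delete_nth_def)

lemma map_delete_nth: "map f (delete_nth i vs) = delete_nth i (map f vs)"
  by (simp add: delete_nth_def take_map drop_map)

lemma nth_delete_nth:
  "i < length vs \<Longrightarrow> j < length vs - 1 \<Longrightarrow> delete_nth i vs ! j = vs ! (if j < i then j else Suc j)"
  by (auto simp: delete_nth_def nth_append min_def)

text \<open>Pairs the term that deletes i and differentiates in slot j with the term that deletes j
  and differentiates in slot i; after the deletion of j, the old index i is i - 1. The two lists
  have the same entries, and b has to travel past the i - j - 1 entries between the two places.
  Together with the signs of the deletions this leaves one minus sign.\<close>

lemma alternating_form_delete_update:
  assumes \<alpha>: "alternating_form k \<alpha>" and "j < i" "i < length ws"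
  shows "(- 1) ^ i * \<alpha> ((delete_nth i ws)[j := b]) = - ((- 1) ^ j * \<alpha> ((delete_nth j ws)[i - 1 := b]))"
proof -
  define A B C where "A = take j ws" and "B = take (i - j - 1) (drop (Suc j) ws)" and "C = drop (Suc i) ws"
  have ws: "ws = A @ [ws ! j] @ B @ [ws ! i] @ C"
  proof -
    have "drop (Suc j) ws = B @ drop (i - j - 1) (drop (Suc j) ws)" by (simp only: B_def append_take_drop_id)
    also have "drop (i - j - 1) (drop (Suc j) ws) = drop i ws" using assms(2) by simp
    also have "\<dots> = ws ! i # C" using assms(3) by (simp add: C_def Cons_nth_drop_Suc)
    finally show ?thesis
      using id_take_nth_drop[of j ws] assms by (simp add: A_def)
  qed
  have lens: "length A = j" "length B = i - j - 1" using assms by (auto simp: A_def B_def)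
  have i: "i = Suc (length A + length B)" using assms(2) lens by simp
  have "delete_nth (Suc (length A + length B)) (A @ x # B @ y # C) = A @ x # B @ C" for x y
    by (simp add: delete_nth_def)
  from this[of "ws ! j" "ws ! i"] have "delete_nth i ws = A @ [ws ! j] @ B @ C"
    unfolding i[symmetric] using ws by simp
  then have 1: "(delete_nth i ws)[j := b] = A @ b # B @ C"
    using lens by (simp add: list_update_append)
  have "delete_nth (length A) (A @ x # D) = A @ D" for x D
    by (simp add: delete_nth_def)
  from this[of "ws ! j" "B @ [ws ! i] @ C"] have "delete_nth j ws = A @ B @ [ws ! i] @ C"
    unfolding lens using ws by simp
  then have 2: "(delete_nth j ws)[i - 1 := b] = A @ B @ b # C"
    using list_update_length[of "A @ B" "ws ! i" C b] i by simp
  have "i = j + length B + 1" using lens assms(2) by simp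
  then have "(- 1) ^ i * (- 1) ^ length B = (- 1 :: real) * (- 1) ^ j"
    by (simp add: power_add flip: power_mult_distrib)
  then show ?thesis
    unfolding 1 2 alternating_form_move[OF \<alpha>, of A b B C] by (simp flip: mult.assoc)
qed

section \<open>Rules for exterior derivatives\<close>

lemma ext_deriv_delete_nth:
  "ext_deriv \<omega> p vs = (\<Sum>i<length vs. (- 1) ^ i * fderiv (\<lambda>q. \<omega> q (delete_nth i vs)) p (vs ! i))"
  by (simp add: ext_deriv_def delete_nth_def)

text \<open>A pullback of a constant form is closed, because the second derivatives are symmetric: the
  terms of the exterior derivative cancel in pairs.\<close>

lemma ext_deriv_pullback_const:
  fixes \<phi> :: "'a::real_normed_vector \<Rightarrow> 'b::euclidean_space"
  assumes V: "open V" "p \<in> V" and \<phi>: "smooth_on V \<phi>" and \<alpha>: "alternating_form k \<alpha>"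
  shows "ext_deriv (\<lambda>q. pullback (fderiv \<phi> q) \<alpha>) p vs = 0"
proof (cases "length vs = Suc k")
  case False
  \<comment> \<open>A form vanishes on lists of the wrong length, so every term is the derivative of
    the zero function.\<close>
  have "(\<lambda>q. pullback (fderiv \<phi> q) \<alpha> (delete_nth i vs)) = (\<lambda>q. 0)" if "i < length vs" for i
    using \<alpha> False that length_delete_nth[OF that] by (auto simp: pullback_def alternating_form_def)
  then show ?thesis by (simp add: ext_deriv_delete_nth)
next
  case True
  define D where "D = (\<lambda>q. fderiv \<phi> q)"
  define B where "B = (\<lambda>v w. fderiv (\<lambda>q. D q w) p v)"
  define ws where "ws = map (D p) vs"
  define g where "g = (\<lambda>(i, j). (- 1) ^ i * \<alpha> ((delete_nth i ws)[j := B (vs ! i) (delete_nth i vs ! j)]))"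
  \<comment> \<open>In (i, j) the entry i is deleted and j is a position in the shortened list, so
    that j stands for the original index j or j + 1 according to whether j < i. The involution
    exchanges the two original indices.\<close>
  define \<tau> where "\<tau> = (\<lambda>(i, j :: nat). if j < i then (j, i - 1) else (j + 1, i))"
  define P where "P = {..<Suc k} \<times> {..<k}"
  have D: "((\<lambda>q. D q w) has_derivative B' w) (at p)" if "B' = (\<lambda>w v. B v w)" for w B'
    unfolding that B_def D_def
    by (rule smooth_on_has_derivative[OF smooth_on_frechet_derivative[OF \<phi>] V(2)])
  have "fderiv (\<lambda>q. pullback (D q) \<alpha> (delete_nth i vs)) p (vs ! i)
     = (\<Sum>j<k. \<alpha> ((delete_nth i ws)[j := B (vs ! i) (delete_nth i vs ! j)]))" if "i < Suc k" for i
  proof -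
    let ?fs = "map (\<lambda>w q. D q w) (delete_nth i vs)"
    have len: "length (delete_nth i vs) = k" using that True by (simp add: length_delete_nth)
    have "((\<lambda>q. \<alpha> (map (\<lambda>f. f q) ?fs)) has_derivative
       (\<lambda>v. \<Sum>j<length ?fs. \<alpha> ((map (\<lambda>f. f p) ?fs)[j := fderiv (?fs ! j) p v]))) (at p)"
      using alternating_form_multilinear[OF \<alpha>] D
      by (intro has_derivative_multilinear) (auto simp: len differentiable_def)
    from frechet_derivative_at[OF this, symmetric] show ?thesis
      by (simp add: pullback_def o_def len ws_def map_delete_nth[symmetric] B_def)
  qed
  then have "ext_deriv (\<lambda>q. pullback (D q) \<alpha>) p vs = sum g P"
    by (simp add: ext_deriv_delete_nth True g_def P_def sum.cartesian_product[symmetric] sum_distrib_left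
        del: sum.lessThan_Suc)
  also have "\<dots> = 0"
  proof -
    have len: "length ws = Suc k" using True by (simp add: ws_def)
    have sym: "B v w = B w v" for v w
      unfolding B_def D_def by (rule symmetric_second_derivative[OF V \<phi>])
    have half: "g (i, j) = - g (j, i - 1)" if "j < i" "i < Suc k" for i j
    proof -
      have "delete_nth i vs ! j = vs ! j" "delete_nth j vs ! (i - 1) = vs ! i"
        using that True by (auto simp: nth_delete_nth)
      then show ?thesis
        using alternating_form_delete_update[OF \<alpha> that(1), of ws] that(2) len by (simp add: g_def sym)
    qed
    have \<tau>: "g (\<tau> x) = - g x" if "x \<in> P" for x
    proof (cases x)
      case (Pair i j)
      show ?thesis
      proof (cases "j < i")
        case True
        then show ?thesis using half[of j i] that Pair by (simp add: \<tau>_def P_def)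
      next
        case False
        then show ?thesis using half[of i "j + 1"] that Pair by (simp add: \<tau>_def P_def)
      qed
    qed
    have "sum g P = (\<Sum>x\<in>P. g (\<tau> x))"
      by (rule sum.reindex_bij_witness[where i=\<tau> and j=\<tau>]) (auto simp: \<tau>_def P_def)
    also have "\<dots> = - sum g P" by (simp add: \<tau> sum_negf)
    finally show ?thesis by simp
  qed
  finally show ?thesis by (simp add: D_def)
qed

text \<open>The Leibniz rule: the sum on the right is the wedge of the differential of g with
  \<beta>, written out by deletions.\<close>

lemma ext_deriv_scale:
  assumes g: "g differentiable at p"
    and \<beta>: "\<And>us. (\<lambda>q. \<beta> q us) differentiable at p"
  shows "ext_deriv (\<lambda>q vs. g q * \<beta> q vs) p vs
    = (\<Sum>i<length vs. (- 1) ^ i * fderiv g p (vs ! i) * \<beta> p (delete_nth i vs))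
      + g p * ext_deriv \<beta> p vs"
proof -
  have "fderiv (\<lambda>q. g q * \<beta> q us) p v
     = fderiv g p v * \<beta> p us + g p * fderiv (\<lambda>q. \<beta> q us) p v" for us v
  proof -
    have "((\<lambda>q. g q * \<beta> q us) has_derivative
      (\<lambda>v. g p * fderiv (\<lambda>q. \<beta> q us) p v + fderiv g p v * \<beta> p us)) (at p)"
      using g \<beta> unfolding frechet_derivative_works by (intro has_derivative_mult)
    from frechet_derivative_at[OF this, symmetric] show ?thesis by simp
  qed
  then show ?thesis
    by (simp add: ext_deriv_delete_nth sum.distrib sum_distrib_left algebra_simps)
qed

lemma ext_deriv_diff:
  assumes "\<And>us. (\<lambda>q. \<alpha> q us) differentiable at p" "\<And>us. (\<lambda>q. \<beta> q us) differentiable at p"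
  shows "ext_deriv (\<lambda>q vs. \<alpha> q vs - \<beta> q vs) p vs = ext_deriv \<alpha> p vs - ext_deriv \<beta> p vs"
proof -
  have "fderiv (\<lambda>q. \<alpha> q us - \<beta> q us) p v
     = fderiv (\<lambda>q. \<alpha> q us) p v - fderiv (\<lambda>q. \<beta> q us) p v" for us v
    using frechet_derivative_at[OF has_derivative_diff[OF assms[unfolded frechet_derivative_works]]] by metis
  then show ?thesis
    by (simp add: ext_deriv_delete_nth sum_subtractf right_diff_distrib)
qed

lemma ext_deriv_cong_open:
  assumes "open V" "p \<in> V" "\<And>q us. q \<in> V \<Longrightarrow> \<alpha> q us = \<beta> q us"
  shows "ext_deriv \<alpha> p vs = ext_deriv \<beta> p vs"
proof -
  have "fderiv (\<lambda>q. \<alpha> q us) p = fderiv (\<lambda>q. \<beta> q us) p" for us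
    using assms by (intro frechet_derivative_cong_open) auto
  then show ?thesis by (simp add: ext_deriv_def)
qed

section \<open>The complex determinant form\<close>

text \<open>An arbitrary numbering of the index type, which translates list positions into matrix
  rows. Another choice can change the sign of \<open>det_form\<close>; \<open>complex_coords\<close>
  uses the same numbering, so the sign cancels in \<open>re_complex_volume_eq\<close>.\<close>

definition row_pos :: "'m::finite \<Rightarrow> nat" where
  "row_pos = (SOME f. bij_betw f UNIV {..<CARD('m)})"

lemma bij_row_pos: "bij_betw (row_pos :: 'm::finite \<Rightarrow> nat) UNIV {..<CARD('m)}"
proof -
  have "\<exists>f :: 'm \<Rightarrow> nat. bij_betw f UNIV {..<CARD('m)}"
    using ex_bij_betw_finite_nat[of "UNIV :: 'm set"] by (simp add: atLeast0LessThan)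
  then show ?thesis unfolding row_pos_def by (rule someI_ex)
qed

lemma inj_row_pos: "inj row_pos"
  using bij_row_pos by (rule bij_betw_imp_inj_on)

lemma row_pos_less: "row_pos (i :: 'm::finite) < CARD('m)"
  using bij_row_pos bij_betwE by blast

lemma row_pos_surj:
  assumes "n < CARD('m::finite)"
  obtains i :: "'m::finite" where "row_pos i = n"
  using bij_row_pos assms unfolding bij_betw_def by (metis (no_types, lifting) imageE lessThan_iff)

text \<open>The standard complex volume form, up to the sign of the numbering, with the arguments as
  rows.\<close>

definition det_form :: "(complex ^ 'm::finite) list \<Rightarrow> complex" where
  "det_form zs = (if length zs = CARD('m) then det (\<chi> i. zs ! row_pos i) else 0)"

lemma det_form_update:
  fixes zs :: "(complex ^ 'm::finite) list"
  assumes "length zs = CARD('m)" "row_pos k = n"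
  shows "det_form (zs[n := z]) = det (\<chi> i. if i = k then z else zs ! row_pos i)"
proof -
  have "zs[n := z] ! row_pos i = (if i = k then z else zs ! row_pos i)" for i
  proof (cases "i = k")
    case False
    then have "row_pos i \<noteq> n" using assms(2) inj_row_pos by (auto simp: inj_def)
    then show ?thesis using False by simp
  qed (use assms row_pos_less[of i] in auto)
  then show ?thesis using assms by (simp add: det_form_def)
qed

lemma det_form_scale_nth:
  fixes zs :: "(complex ^ 'm::finite) list"
  assumes "n < length zs"
  shows "det_form (zs[n := c *s z]) = c * det_form (zs[n := z])"
proof (cases "length zs = CARD('m)")
  case True
  obtain k :: 'm where "row_pos k = n" using row_pos_surj assms True by metis
  then show ?thesis
    using True by (simp add: det_form_update[OF True] det_row_mul)
qed (simp add: det_form_def)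

lemma det_form_add_nth:
  fixes zs :: "(complex ^ 'm::finite) list"
  assumes "n < length zs"
  shows "det_form (zs[n := y + z]) = det_form (zs[n := y]) + det_form (zs[n := z])"
proof (cases "length zs = CARD('m)")
  case True
  obtain k :: 'm where "row_pos k = n" using row_pos_surj assms True by metis
  then show ?thesis
    using True by (simp add: det_form_update[OF True] det_row_add)
qed (simp add: det_form_def)

lemma det_form_eq_0:
  fixes zs :: "(complex ^ 'm::finite) list"
  assumes "i < j" "j < length zs" "zs ! i = zs ! j"
  shows "det_form zs = 0"
proof (cases "length zs = CARD('m)")
  case True
  obtain k l :: 'm where kl: "row_pos k = i" "row_pos l = j"
    using row_pos_surj[where 'm='m] assms True by (metis order.strict_trans)
  then have "k \<noteq> l" using assms by auto
  have "det (\<chi> i. zs ! row_pos i) = 0"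
    by (rule det_identical_rows[OF \<open>k \<noteq> l\<close>]) (simp add: row_def kl assms)
  then show ?thesis by (simp add: det_form_def)
qed (simp add: det_form_def)

lemma det_form_map_matrix:
  fixes zs :: "(complex ^ 'm::finite) list"
  shows "det_form (map ((*v) A) zs) = det A * det_form zs"
proof (cases "length zs = CARD('m)")
  case True
  have "(\<chi> i::'m. map ((*v) A) zs ! row_pos i) = (\<chi> i. zs ! row_pos i) ** transpose A"
    using row_pos_less[where 'm='m] True
    by (simp add: vec_eq_iff matrix_vector_mult_def matrix_matrix_mult_def transpose_def mult.commute)
  then show ?thesis using True by (simp add: det_form_def det_mul)
qed (simp add: det_form_def)

lemma scaleR_eq_smult: "r *\<^sub>R (z :: complex ^ 'm) = complex_of_real r *s z"
  by (simp add: vec_eq_iff complex_eq_iff)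

lemma det_form_scaleR_nth:
  fixes zs :: "(complex ^ 'm::finite) list"
  shows "n < length zs \<Longrightarrow> det_form (zs[n := r *\<^sub>R z]) = r *\<^sub>R det_form (zs[n := z])"
  by (simp add: scaleR_eq_smult det_form_scale_nth scaleR_conv_of_real)

lemma alternating_Re_det_form:
  "alternating_form CARD('m) (\<lambda>zs :: (complex ^ 'm::finite) list. Re (det_form zs))"
  unfolding alternating_form_def
  by (auto simp: det_form_add_nth det_form_scaleR_nth det_form_eq_0 intro!: linearI)
    (simp_all add: det_form_def)

lemma alternating_Im_det_form:
  "alternating_form CARD('m) (\<lambda>zs :: (complex ^ 'm::finite) list. Im (det_form zs))"
  unfolding alternating_form_def
  by (auto simp: det_form_add_nth det_form_scaleR_nth det_form_eq_0 intro!: linearI)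
    (simp_all add: det_form_def)

lemma multilinear_det_form:
  "multilinear_form CARD('m) (det_form :: (complex ^ 'm::finite) list \<Rightarrow> complex)"
  unfolding multilinear_form_def
  by (auto simp: det_form_add_nth det_form_scaleR_nth intro!: linearI)

lemma det_form_scale_head: "det_form (c *s z # zs) = c * det_form (z # zs)"
  using det_form_scale_nth[of 0 "z # zs" c z] by simp

lemma det_form_scale_second: "det_form (y # c *s z # zs) = c * det_form (y # z # zs)"
  using det_form_scale_nth[of 1 "y # z # zs" c z] by simp

lemma det_form_scale_third: "det_form (x # y # c *s z # zs) = c * det_form (x # y # z # zs)"
  using det_form_scale_nth[of 2 "x # y # z # zs" c z] by (simp add: numeral_2_eq_2)

lemma det_form_diff_second: "det_form (x # (y - c *s x) # zs) = det_form (x # y # zs)"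
proof -
  have "det_form (x # x # zs) = 0" by (rule det_form_eq_0[of 0 1]) auto
  then show ?thesis
    using det_form_add_nth[of 1 "x # y # zs" y "(- c) *s x"] det_form_scale_second[of x "- c" x zs]
    by simp
qed

lemma det_form_swap: "det_form (x # y # zs) = - det_form (y # x # zs)"
  using alternating_form_swap_adjacent[OF alternating_Re_det_form, of "[]" x y zs]
    alternating_form_swap_adjacent[OF alternating_Im_det_form, of "[]" x y zs]
  by (simp add: complex_eq_iff)

lemma permutes_two_points:
  assumes "a \<noteq> b" "c \<noteq> d"
  obtains p where "p permutes UNIV" "p c = a" "p d = b"
proof
  \<comment> \<open>First send c to a; the image of d then differs from a, so a second transposition
    can move it to b without disturbing a.\<close>
  let ?p = "Transposition.transpose (Transposition.transpose c a d) b \<circ> Transposition.transpose c a"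
  show "?p permutes UNIV" by (intro permutes_compose permutes_swap_id) auto
  have "Transposition.transpose c a d \<noteq> a" using assms(2) by (metis transpose_involutory transpose_apply_second)
  then show "?p c = a" using assms(1) by (simp add: transpose_apply_other)
  show "?p d = b" by simp
qed

text \<open>Completes x and y to a basis. Eliminating a coordinate a with x $ a nonzero from y
  leaves a vector y' that is nonzero at some b, and the standard basis vectors at the other indices
  complete the pair. A row permutation then brings x and y' to the first two places, and y' may be
  replaced by y there.\<close>

lemma det_form_nondegenerate:
  fixes x y :: "complex ^ 'm::finite"
  assumes x: "x \<noteq> 0" and y: "\<And>c. y \<noteq> c *s x"
  obtains us where "length us = CARD('m) - 2" "det_form (x # y # us) \<noteq> 0"
proof -
  obtain a where a: "x $ a \<noteq> 0" using x by (auto simp: vec_eq_iff)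
  define c where "c = y $ a / x $ a"
  define y' where "y' = y - c *s x"
  have "y' \<noteq> 0" using y[of c] by (simp add: y'_def)
  then obtain b where b: "y' $ b \<noteq> 0" by (auto simp: vec_eq_iff)
  have ya: "y' $ a = 0" using a by (simp add: y'_def c_def)
  then have "a \<noteq> b" using b by auto
  define B where "B = (\<chi> i. if i = a then x else if i = b then y' else axis i 1)"
  have "z = 0" if z: "B *v z = 0" for z
  proof -
    have rows: "(\<Sum>j\<in>UNIV. B $ i $ j * z $ j) = 0" for i
      using arg_cong[OF z, of "\<lambda>v. v $ i"] by (simp add: matrix_vector_mult_def)
    have z0: "z $ i = 0" if "i \<noteq> a" "i \<noteq> b" for i
      using rows[of i] that by (simp add: B_def axis_def if_distrib[of "\<lambda>x. x * _"] cong: if_cong)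
    have two: "(\<Sum>j\<in>UNIV. f j * z $ j) = f a * z $ a + f b * z $ b" for f
    proof -
      have "(\<Sum>j\<in>UNIV. f j * z $ j) = (\<Sum>j\<in>{a, b}. f j * z $ j)"
        using z0 by (intro sum.mono_neutral_right) auto
      then show ?thesis using \<open>a \<noteq> b\<close> by simp
    qed
    have "z $ b = 0" using rows[of b] \<open>a \<noteq> b\<close> b ya by (simp add: two B_def)
    moreover have "z $ a = 0" using rows[of a] a \<open>z $ b = 0\<close> by (simp add: two B_def)
    ultimately show ?thesis using z0 by (metis vec_eq_iff zero_index)
  qed
  then have "invertible B"
    by (metis invertible_left_inverse matrix_left_invertible_ker)
  then have det: "det B \<noteq> 0" by (simp add: invertible_det_nz)
  have card: "CARD('m) \<ge> 2"
    using card_mono[of "UNIV :: 'm set" "{a, b}"] \<open>a \<noteq> b\<close> by simp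
  obtain i0 i1 :: 'm where i01: "row_pos i0 = 0" "row_pos i1 = 1"
    using row_pos_surj[where 'm='m] card by (metis One_nat_def Suc_1 Suc_le_eq order.strict_trans zero_less_Suc)
  then have "i0 \<noteq> i1" by auto
  obtain p where p: "p permutes UNIV" "p i0 = a" "p i1 = b"
    using permutes_two_points[OF \<open>a \<noteq> b\<close> \<open>i0 \<noteq> i1\<close>] .
  define zs where "zs = map (\<lambda>n. B $ p (inv row_pos n)) [0..<CARD('m)]"
  have nth: "zs ! row_pos i = B $ p i" for i
    using row_pos_less[of i] by (simp add: zs_def inj_row_pos)
  have len: "length zs = CARD('m)" by (simp add: zs_def)
  have "det_form zs = of_int (sign p) * det B"
    using det_permute_rows[OF p(1), of B] by (simp add: det_form_def len nth)
  then have nz: "det_form zs \<noteq> 0" using det by (simp add: sign_nz)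
  obtain z0 z1 us where zs: "zs = z0 # z1 # us"
    using len card by (metis One_nat_def Suc_1 Suc_le_length_iff)
  have "z0 = x" using nth[of i0] by (simp add: i01 zs p(2) B_def)
  moreover have "z1 = y'" using nth[of i1] \<open>a \<noteq> b\<close> by (simp add: i01 zs p(3) B_def)
  ultimately have "det_form (x # y # us) \<noteq> 0"
    using nz by (simp add: zs y'_def det_form_diff_second)
  then show thesis using that[of us] len zs by simp
qed

lemma exists_not_multiple:
  fixes x :: "complex ^ 'm::finite"
  assumes "CARD('m) \<ge> 2" "x \<noteq> 0"
  obtains y where "\<And>c. y \<noteq> c *s x"
proof -
  obtain a where a: "x $ a \<noteq> 0" using assms(2) by (auto simp: vec_eq_iff)
  obtain b :: 'm where "b \<noteq> a"
    using assms(1) by (metis (full_types) CARD_1 One_nat_def Suc_1 UNIV_I card_1_singleton_iff not_less_eq_eq order_refl subset_antisym subset_singleton_iff top_greatest insertI1 insert_iff subsetI)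
  show thesis
  proof (rule that[of "axis b 1"])
    show "axis b 1 \<noteq> c *s x" for c
    proof
      assume eq: "axis b 1 = c *s x"
      have "c * x $ a = 0" using arg_cong[OF eq, of "\<lambda>v. v $ a"] \<open>b \<noteq> a\<close> by (simp add: axis_def)
      then show False using arg_cong[OF eq, of "\<lambda>v. v $ b"] a by (simp add: axis_def)
    qed
  qed
qed

lemma det_form_nondegenerate_head:
  fixes x :: "complex ^ 'm::finite"
  assumes "CARD('m) \<ge> 2" "x \<noteq> 0"
  obtains us where "length us = CARD('m) - 1" "det_form (x # us) \<noteq> 0"
proof -
  obtain y where "\<And>c. y \<noteq> c *s x" using exists_not_multiple assms by metis
  from det_form_nondegenerate[OF assms(2) this]
  obtain us where "length us = CARD('m) - 2" "det_form (x # y # us) \<noteq> 0" .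
  then show thesis using that[of "y # us"] assms(1) by simp
qed

text \<open>For w off the complex line of v, additivity at v + w forces equal factors. As B is only
  real linear, the factors of two vectors on the same complex line are not related directly; they
  are compared through a third vector off that line, which exists in complex dimension at least
  2.\<close>

lemma linear_pointwise_scalar:
  fixes B :: "complex ^ 'm::finite \<Rightarrow> complex ^ 'm"
  assumes card: "CARD('m) \<ge> 2" and B: "linear B" and ex: "\<And>v. \<exists>c. B v = c *s v"
  obtains c where "\<And>v. B v = c *s v"
proof -
  obtain l where l: "\<And>v. B v = l v *s v" using ex by metis
  have same: "l v = l w" if "v \<noteq> 0" "\<And>c. w \<noteq> c *s v" for v w
  proof -
    have "l (v + w) *s v + l (v + w) *s w = l v *s v + l w *s w"
      using linear_add[OF B, of v w] by (simp add: l vector_add_ldistrib)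
    then have eq: "(l (v + w) - l w) *s w = (l v - l (v + w)) *s v"
      by (simp add: algebra_simps vec_eq_iff)
    have "l (v + w) = l w"
    proof (rule ccontr)
      assume n: "l (v + w) \<noteq> l w"
      have "w = (inverse (l (v + w) - l w) * (l (v + w) - l w)) *s w" using n by simp
      also have "\<dots> = inverse (l (v + w) - l w) *s ((l v - l (v + w)) *s v)"
        unfolding eq[symmetric] by (simp only: vector_smult_assoc)
      also have "\<dots> = (inverse (l (v + w) - l w) * (l v - l (v + w))) *s v"
        by (simp only: vector_smult_assoc)
      finally show False using that(2) by blast
    qed
    then have "(l v - l w) *s v = 0" using eq by simp
    then show ?thesis using that(1) by simp
  qed
  obtain v0 :: "complex ^ 'm" where v0: "v0 \<noteq> 0"
    using axis_eq_0_iff[of undefined "1 :: complex"] by (metis one_neq_zero)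
  have "B w = l v0 *s w" for w
  proof (cases "w = 0")
    case True
    then show ?thesis by (simp add: l)
  next
    case False
    show ?thesis
    proof (cases "\<exists>c. w = c *s v0")
      case True
      obtain u where u: "\<And>c. u \<noteq> c *s v0" using exists_not_multiple card v0 by metis
      have "u \<noteq> c *s w" for c using True u by (metis vector_smult_assoc)
      then have "l w = l u" using same False by blast
      moreover have "l v0 = l u" using same v0 u by blast
      ultimately show ?thesis using l by metis
    next
      case False
      then have "l v0 = l w" using same v0 by blast
      then show ?thesis using l by metis
    qed
  qed
  then show thesis using that by blast
qed

text \<open>For w = v the symmetry and the sign rule for a swap make the real part of the
  determinant of (v, B v, ...) equal to its own negative. A third argument is available since m > 2,
  and multiplying it by i makes the imaginary part vanish too. Nondegeneracy then puts B v on the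
  complex line of v.\<close>

lemma Re_det_form_symmetric_iff:
  fixes B :: "complex ^ 'm::finite \<Rightarrow> complex ^ 'm"
  assumes card: "CARD('m) > 2" and B: "linear B"
  shows "(\<forall>v w us. Re (det_form (v # B w # us)) = Re (det_form (B v # w # us))) \<longleftrightarrow> (\<exists>c. \<forall>v. B v = c *s v)"
proof
  assume "\<exists>c. \<forall>v. B v = c *s v"
  then show "\<forall>v w us. Re (det_form (v # B w # us)) = Re (det_form (B v # w # us))"
    by (auto simp: det_form_scale_head det_form_scale_second)
next
  assume sym: "\<forall>v w us. Re (det_form (v # B w # us)) = Re (det_form (B v # w # us))"
  have re: "Re (det_form (v # B v # us)) = 0" for v us
    using sym[rule_format, of v v us] det_form_swap[of "B v" v us] by simp
  have zero: "det_form (v # B v # us) = 0" for v us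
  proof (cases us)
    case Nil
    \<comment> \<open>Two arguments are fewer than m, where \<open>det_form\<close> is 0 by
      convention.\<close>
    then show ?thesis using card by (simp add: det_form_def)
  next
    case (Cons u us')
    have "Im (det_form (v # B v # us)) = 0"
      using re[of v "\<i> *s u # us'"] by (simp add: det_form_scale_third Cons)
    then show ?thesis using re[of v us] by (simp add: complex_eq_iff)
  qed
  have "\<exists>c. B v = c *s v" for v
  proof (cases "v = 0")
    case True
    then show ?thesis using linear_0[OF B] by simp
  next
    case False
    show ?thesis
      using det_form_nondegenerate[OF False, of "B v"] zero by metis
  qed
  from linear_pointwise_scalar[OF _ B this] card show "\<exists>c. \<forall>v. B v = c *s v"
    by (metis less_imp_le)
qed

section \<open>The model form as the real part of a determinant\<close>

definition complex_coords :: "real ^ 'm::finite bit0 \<Rightarrow> complex ^ 'm" where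
  "complex_coords v = (\<chi> k. dz (Suc (row_pos k)) v)"

text \<open>Conjugation with \<open>row_pos\<close> carries the permutations of positions to
  permutations of the index type and preserves signs; the sum becomes the Leibniz formula for the
  transposed matrix.\<close>

lemma re_complex_volume_eq:
  "re_complex_volume vs = Re (det_form (map complex_coords (vs :: (real ^ 'm::finite bit0) list)))"
proof (cases "length vs = CARD('m)")
  case True
  let ?n = "CARD('m)"
  define rp where "rp = (row_pos :: 'm \<Rightarrow> nat)"
  have bij: "bij_betw rp UNIV {..<?n}" and inj: "inj rp"
    unfolding rp_def by (rule bij_row_pos inj_row_pos)+
  let ?f = "\<lambda>\<pi>. of_int (sign \<pi>) * (\<Prod>i<?n. (map dz [1..<Suc ?n] ! i) (vs ! \<pi> i)) :: complex"
  have "wedge_covectors (map dz [1..<Suc ?n]) vs = (\<Sum>\<pi> | \<pi> permutes {..<?n}. ?f \<pi>)"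
    using True by (simp add: wedge_covectors_def del: upt_Suc)
  also have "\<dots> = (\<Sum>p | p permutes (UNIV :: 'm set). ?f (map_permutation UNIV rp p))"
  proof (rule sum.reindex_bij_witness[where j="map_permutation {..<?n} (inv rp)" and i="map_permutation UNIV rp"])
    have bij': "bij_betw (inv rp) {..<?n} UNIV"
      using bij bij_betw_inv_into by blast
    fix \<pi> assume "\<pi> \<in> {\<pi>. \<pi> permutes {..<?n}}"
    then have \<pi>: "\<pi> permutes {..<?n}" by simp
    show *: "map_permutation UNIV rp (map_permutation {..<?n} (inv rp) \<pi>) = \<pi>"
      by (rule map_permutation_compose_inv[OF bij' \<pi>])
        (use bij in \<open>auto simp: bij_betw_def f_inv_into_f\<close>)
    show "map_permutation {..<?n} (inv rp) \<pi> \<in> {p. p permutes UNIV}"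
      using map_permutation_permutes[OF bij' \<pi>] by simp
    show "?f (map_permutation UNIV rp (map_permutation {..<?n} (inv rp) \<pi>)) = ?f \<pi>"
      unfolding * ..
  next
    fix p assume "p \<in> {p. p permutes (UNIV :: 'm set)}"
    then have p: "p permutes UNIV" by simp
    show "map_permutation {..<?n} (inv rp) (map_permutation UNIV rp p) = p"
      by (rule map_permutation_compose_inv[OF bij p]) (simp add: inj)
    show "map_permutation UNIV rp p \<in> {\<pi>. \<pi> permutes {..<?n}}"
      using map_permutation_permutes[OF bij p] by simp
  qed
  also have "\<dots> = (\<Sum>p | p permutes (UNIV :: 'm set). of_int (sign p) * (\<Prod>i\<in>UNIV. dz (Suc (rp i)) (vs ! rp (p i))))"
  proof (rule sum.cong)
    fix p assume "p \<in> {p. p permutes (UNIV :: 'm set)}"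
    then have p: "p permutes UNIV" by simp
    have "(\<Prod>i<?n. (map dz [1..<Suc ?n] ! i) (vs ! map_permutation UNIV rp p i))
       = (\<Prod>i<?n. dz (Suc i) (vs ! map_permutation UNIV rp p i))"
      by (rule prod.cong) (auto simp del: upt_Suc)
    also have "\<dots> = (\<Prod>i\<in>UNIV. dz (Suc (rp i)) (vs ! map_permutation UNIV rp p (rp i)))"
      using prod.reindex_bij_betw[OF bij, of "\<lambda>i. dz (Suc i) (vs ! map_permutation UNIV rp p i)"] by simp
    also have "\<dots> = (\<Prod>i\<in>UNIV. dz (Suc (rp i)) (vs ! rp (p i)))"
      by (simp add: map_permutation_apply[OF inj])
    finally show "?f (map_permutation UNIV rp p) = of_int (sign p) * (\<Prod>i\<in>UNIV. dz (Suc (rp i)) (vs ! rp (p i)))"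
      using sign_map_permutation[OF inj p] by simp
  qed simp
  also have "\<dots> = det (transpose (\<chi> i. map complex_coords vs ! rp i))"
    using True row_pos_less[where 'm='m]
    by (simp add: det_def transpose_def complex_coords_def rp_def)
  finally show ?thesis
    using True by (simp add: re_complex_volume_def det_form_def rp_def del: upt_Suc)
next
  case False
  then show ?thesis by (simp add: re_complex_volume_def wedge_covectors_def det_form_def del: upt_Suc)
qed

text \<open>The coordinates are numbered from 1 to 2m, so the residue 0 is represented by
  2m.\<close>

lemma surj_of_nat_bit0:
  fixes i :: "'m::finite bit0"
  obtains n where "1 \<le> n" "n \<le> 2 * CARD('m)" "i = of_nat n"
proof -
  have bound: "0 \<le> Rep_bit0 i \<and> Rep_bit0 i < 2 * int CARD('m)"
    using Rep_bit0[of i] by simp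
  have of_nat: "(of_nat k :: 'm bit0) = Abs_bit0 (int k mod (2 * int CARD('m)))" for k
    by (simp add: bit0.of_nat_eq)
  have i: "i = of_nat (nat (Rep_bit0 i))"
    using bound by (simp add: of_nat Rep_bit0_inverse)
  show thesis
  proof (cases "Rep_bit0 i = 0")
    case True
    have "i = of_nat (2 * CARD('m))"
      unfolding of_nat by (subst i) (simp add: True of_nat)
    then show thesis using that[of "2 * CARD('m)"] by simp
  next
    case False
    then show thesis using that[of "nat (Rep_bit0 i)"] i bound by auto
  qed
qed

lemma linear_complex_coords: "linear complex_coords"
  by (rule linearI) (auto simp: complex_coords_def dz_def vec_eq_iff complex_eq_iff)

lemma inj_complex_coords: "inj (complex_coords :: real ^ 'm::finite bit0 \<Rightarrow> complex ^ 'm)"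
proof (rule linear_injective_0[OF linear_complex_coords, THEN iffD2], intro allI impI)
  fix v :: "real ^ 'm bit0" assume v: "complex_coords v = 0"
  have dz: "dz (Suc n) v = 0" if n: "n < CARD('m)" for n
  proof -
    obtain k :: 'm where "row_pos k = n" using row_pos_surj n .
    then show ?thesis using arg_cong[OF v, of "\<lambda>z. z $ k"] by (simp add: complex_coords_def)
  qed
  have "v $ i = 0" for i
  proof -
    obtain n where n: "1 \<le> n" "n \<le> 2 * CARD('m)" "i = of_nat n" using surj_of_nat_bit0 .
    \<comment> \<open>Coordinate n is the real or the imaginary part of
      \<open>dz (Suc l)\<close>.\<close>
    define l where "l = (n - 1) div 2"
    have l: "l < CARD('m)" "n = 2 * Suc l - 1 \<or> n = 2 * Suc l"
      using n(1,2) unfolding l_def by (linarith, presburger)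
    then show ?thesis using dz[OF l(1)] n(3) unfolding dz_def by (auto simp: complex_eq_iff)
  qed
  then show "v = 0" by (simp add: vec_eq_iff)
qed

lemma linear_inj_imp_bij:
  fixes f :: "'a::euclidean_space \<Rightarrow> 'b::euclidean_space"
  assumes "linear f" "inj f" "DIM('a) = DIM('b)"
  shows "bij f"
proof -
  have "dim (range f) = DIM('b)" using dim_image_eq[OF assms(1), of UNIV] assms by simp
  then have "span (range f) = UNIV" using dim_eq_full by blast
  moreover have "span (range f) = range f"
    using linear_subspace_image[OF assms(1) subspace_UNIV] by (simp add: span_eq_iff)
  ultimately show ?thesis using assms(2) by (simp add: bij_def)
qed

lemma bij_complex_coords: "bij (complex_coords :: real ^ 'm::finite bit0 \<Rightarrow> complex ^ 'm)"
  by (rule linear_inj_imp_bij[OF linear_complex_coords inj_complex_coords]) simp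

section \<open>Complex frames and the local almost-complex structure\<close>

definition complex_frame :: "('a::euclidean_space list \<Rightarrow> real) \<Rightarrow> ('a \<Rightarrow> complex ^ 'm::finite) \<Rightarrow> bool" where
  "complex_frame \<alpha> \<Psi> \<longleftrightarrow> linear \<Psi> \<and> bij \<Psi> \<and> \<alpha> = pullback \<Psi> (\<lambda>zs. Re (det_form zs))"

definition adapted_at :: "('a::real_normed_vector list \<Rightarrow> real) \<Rightarrow> ('a \<Rightarrow>\<^sub>L 'a) \<Rightarrow> bool" where
  "adapted_at \<alpha> A \<longleftrightarrow> contraction_symmetric \<alpha> A \<and> A o\<^sub>L A = - id_blinfun"

lemma complex_frame_exists:
  assumes "has_linear_type \<alpha> (re_complex_volume :: (real ^ 'm::finite bit0) list \<Rightarrow> real)"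
  obtains \<Psi> :: "'a::euclidean_space \<Rightarrow> complex ^ 'm" where "complex_frame \<alpha> \<Psi>"
proof -
  obtain L :: "'a \<Rightarrow> real ^ 'm bit0" where L: "linear L" "bij L" "pullback L re_complex_volume = \<alpha>"
    using assms unfolding has_linear_type_def by blast
  have "complex_frame \<alpha> (complex_coords \<circ> L)"
    unfolding complex_frame_def
  proof (intro conjI)
    show "linear (complex_coords \<circ> L)" by (intro linear_compose L(1) linear_complex_coords)
    show "bij (complex_coords \<circ> L)" by (intro bij_comp L(2) bij_complex_coords)
    show "\<alpha> = pullback (complex_coords \<circ> L) (\<lambda>zs. Re (det_form zs))"
      unfolding L(3)[symmetric] by (simp add: fun_eq_iff pullback_def re_complex_volume_eq)
  qed
  then show thesis by (rule that)
qed

lemma complex_frameD: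
  assumes "complex_frame \<alpha> \<Psi>"
  shows "linear \<Psi>" "bij \<Psi>" "\<alpha> vs = Re (det_form (map \<Psi> vs))"
  using assms by (auto simp: complex_frame_def pullback_def)

lemma linear_inv_of_bij:
  assumes "linear f" "bij f"
  shows "linear (inv f)"
proof (rule linearI)
  show "inv f (x + y) = inv f x + inv f y" for x y
    using assms by (intro inv_f_eq) (auto simp: linear_add surj_f_inv_f bij_is_surj bij_is_inj)
  show "inv f (c *\<^sub>R x) = c *\<^sub>R inv f x" for c x
    using assms by (intro inv_f_eq) (auto simp: linear_scale surj_f_inv_f bij_is_surj bij_is_inj)
qed

section \<open>Complex conjugation and the structure induced by a frame\<close>

definition vcnj :: "complex ^ 'm \<Rightarrow> complex ^ 'm" where
  "vcnj z = (\<chi> i. cnj (z $ i))"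

lemma vcnj_vcnj: "vcnj (vcnj z) = z"
  by (simp add: vcnj_def vec_eq_iff)

lemma vcnj_smult: "vcnj (c *s z) = cnj c *s vcnj z"
  by (simp add: vcnj_def vec_eq_iff)

lemma linear_vcnj: "linear vcnj"
  by (rule linearI) (simp_all add: vcnj_def vec_eq_iff)

lemma bij_vcnj: "bij vcnj"
  by (rule involuntory_imp_bij) (rule vcnj_vcnj)

lemma det_form_map_vcnj: "det_form (map vcnj zs) = cnj (det_form (zs :: (complex ^ 'm::finite) list))"
proof (cases "length zs = CARD('m)")
  case True
  then show ?thesis
    using row_pos_less[where 'm='m] by (simp add: det_form_def det_def vcnj_def)
qed (simp add: det_form_def)

text \<open>Conjugation preserves the real part of the determinant but exchanges i and -i. Hence
  either sign of an adapted structure becomes multiplication by i in a suitable frame.\<close>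

lemma complex_frame_vcnj:
  assumes "complex_frame \<alpha> \<Psi>"
  shows "complex_frame \<alpha> (\<lambda>v. vcnj (\<Psi> v))"
proof -
  have "linear (vcnj \<circ> \<Psi>)"
    by (rule linear_compose[OF complex_frameD(1)[OF assms] linear_vcnj])
  moreover have "bij (vcnj \<circ> \<Psi>)"
    by (rule bij_comp[OF complex_frameD(2)[OF assms] bij_vcnj])
  moreover have "\<alpha> vs = Re (det_form (map (\<lambda>v. vcnj (\<Psi> v)) vs))" for vs
    using det_form_map_vcnj[of "map \<Psi> vs"] by (simp add: complex_frameD(3)[OF assms] o_def)
  ultimately show ?thesis by (simp add: complex_frame_def pullback_def fun_eq_iff o_def)
qed

lemma frame_structure:
  fixes \<Psi> :: "'a::euclidean_space \<Rightarrow> complex ^ 'm::finite"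
  assumes "linear \<Psi>" "bij \<Psi>"
  obtains J where "\<And>v. \<Psi> (blinfun_apply J v) = \<i> *s \<Psi> v" "J o\<^sub>L J = - id_blinfun"
proof
  have lin: "linear (\<lambda>v. inv \<Psi> (\<i> *s \<Psi> v))"
  proof -
    have "linear (\<lambda>z :: complex ^ 'm. \<i> *s z)"
      by (rule linearI) (simp_all add: vec_eq_iff algebra_simps)
    from linear_compose[OF linear_compose[OF assms(1) this] linear_inv_of_bij[OF assms]]
    show ?thesis by (simp add: o_def)
  qed
  show *: "\<Psi> (Blinfun (\<lambda>v. inv \<Psi> (\<i> *s \<Psi> v)) v) = \<i> *s \<Psi> v" for v
    using assms(2)
    by (simp add: bounded_linear_Blinfun_apply linear_conv_bounded_linear[symmetric] lin surj_f_inv_f bij_is_surj)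
  show "Blinfun (\<lambda>v. inv \<Psi> (\<i> *s \<Psi> v)) o\<^sub>L Blinfun (\<lambda>v. inv \<Psi> (\<i> *s \<Psi> v)) = - id_blinfun"
    (is "?J o\<^sub>L ?J = _")
  proof (rule blinfun_eqI, rule injD[OF bij_is_inj[OF assms(2)]])
    fix v
    have "\<Psi> ((?J o\<^sub>L ?J) v) = \<i> *s (\<i> *s \<Psi> v)" by (simp only: blinfun_apply_blinfun_compose *)
    also have "\<dots> = \<Psi> (- v)" using linear_neg[OF assms(1), of v] by simp
    finally show "\<Psi> ((?J o\<^sub>L ?J) v) = \<Psi> ((- id_blinfun) v)" by (simp add: uminus_blinfun.rep_eq)
  qed
qed

section \<open>Contraction-symmetric endomorphisms in a frame\<close>

lemma contraction_symmetric_iff: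
  "contraction_symmetric \<alpha> A \<longleftrightarrow> (\<forall>v w us. \<alpha> (v # blinfun_apply A w # us) = \<alpha> (blinfun_apply A v # w # us))"
  by (simp add: contraction_symmetric_def contract_def fun_eq_iff)

lemma contraction_symmetric_frame_iff:
  fixes \<Psi> :: "'a::euclidean_space \<Rightarrow> complex ^ 'm::finite"
  assumes card: "CARD('m) > 2" and \<Psi>: "complex_frame \<alpha> \<Psi>"
  shows "contraction_symmetric \<alpha> A \<longleftrightarrow> (\<exists>c. \<forall>v. \<Psi> (blinfun_apply A v) = c *s \<Psi> v)"
proof -
  define B where "B = (\<lambda>z. \<Psi> (blinfun_apply A (inv \<Psi> z)))"
  note bij = complex_frameD(2)[OF \<Psi>]
  have lin: "linear B"
    using linear_compose[OF linear_compose[OF linear_inv_of_bij[OF complex_frameD(1,2)[OF \<Psi>]]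
        bounded_linear.linear[OF blinfun.bounded_linear_right]] complex_frameD(1)[OF \<Psi>]]
    unfolding B_def o_def .
  have B: "B (\<Psi> v) = \<Psi> (blinfun_apply A v)" for v
    using bij by (simp add: B_def bij_is_inj)
  have all: "(\<forall>z. P z) \<longleftrightarrow> (\<forall>v. P (\<Psi> v))" for P
    using bij by (metis bij_pointE)
  have allus: "(\<forall>zs. P zs) \<longleftrightarrow> (\<forall>us. P (map \<Psi> us))" for P
    using bij by (metis bij_is_surj list.map_comp list.map_id surj_iff)
  have "contraction_symmetric \<alpha> A \<longleftrightarrow>
     (\<forall>v w us. Re (det_form (\<Psi> v # B (\<Psi> w) # map \<Psi> us)) = Re (det_form (B (\<Psi> v) # \<Psi> w # map \<Psi> us)))"
    by (simp add: contraction_symmetric_iff complex_frameD(3)[OF \<Psi>] B)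
  also have "\<dots> \<longleftrightarrow> (\<forall>v w us. Re (det_form (v # B w # us)) = Re (det_form (B v # w # us)))"
    unfolding all[of "\<lambda>v. \<forall>w us. Re (det_form (v # B w # us)) = Re (det_form (B v # w # us))"]
      all[of "\<lambda>w. \<forall>us. Re (det_form (\<Psi> _ # B w # us)) = Re (det_form (B (\<Psi> _) # w # us))"]
      allus[of "\<lambda>us. Re (det_form (\<Psi> _ # B (\<Psi> _) # us)) = Re (det_form (B (\<Psi> _) # \<Psi> _ # us))"] ..
  also have "\<dots> \<longleftrightarrow> (\<exists>c. \<forall>z. B z = c *s z)"
    by (rule Re_det_form_symmetric_iff[OF card lin])
  also have "\<dots> \<longleftrightarrow> (\<exists>c. \<forall>v. B (\<Psi> v) = c *s \<Psi> v)"
    unfolding all[of "\<lambda>z. B z = _ *s z"] ..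
  finally show ?thesis by (simp add: B)
qed

lemma adapted_at_frame_iff:
  fixes \<Psi> :: "'a::euclidean_space \<Rightarrow> complex ^ 'm::finite"
  assumes card: "CARD('m) > 2" and \<Psi>: "complex_frame \<alpha> \<Psi>"
  shows "adapted_at \<alpha> A \<longleftrightarrow>
    (\<forall>v. \<Psi> (blinfun_apply A v) = \<i> *s \<Psi> v) \<or> (\<forall>v. \<Psi> (blinfun_apply A v) = - (\<i> *s \<Psi> v))"
proof
  note lin = complex_frameD(1)[OF \<Psi>] and bij = complex_frameD(2)[OF \<Psi>]
  {
    assume A: "adapted_at \<alpha> A"
    then obtain c where c: "\<And>v. \<Psi> (blinfun_apply A v) = c *s \<Psi> v"
      using contraction_symmetric_frame_iff[OF card \<Psi>] unfolding adapted_at_def by blast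
    obtain v where v: "\<Psi> v = axis undefined 1" using bij by (metis bij_pointE)
    have "blinfun_apply A (blinfun_apply A v) = - v"
      using A arg_cong[of _ _ "\<lambda>B. blinfun_apply B v"] unfolding adapted_at_def
      by (metis blinfun_apply_blinfun_compose id_blinfun.rep_eq uminus_blinfun.rep_eq id_apply)
    then have "c *s (c *s \<Psi> v) = - \<Psi> v" by (metis c linear_neg[OF lin])
    from arg_cong[OF this, of "\<lambda>z. z $ undefined"] have "c * c = -1" by (simp add: v)
    then have "c = \<i> \<or> c = - \<i>"
      by (metis complex_i_mult_minus i_squared mult_minus_right square_eq_iff)
    then show "(\<forall>v. \<Psi> (blinfun_apply A v) = \<i> *s \<Psi> v) \<or> (\<forall>v. \<Psi> (blinfun_apply A v) = - (\<i> *s \<Psi> v))"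
      using c by auto
  next
    assume "(\<forall>v. \<Psi> (blinfun_apply A v) = \<i> *s \<Psi> v) \<or> (\<forall>v. \<Psi> (blinfun_apply A v) = - (\<i> *s \<Psi> v))"
    then obtain c where c: "\<And>v. \<Psi> (blinfun_apply A v) = c *s \<Psi> v" "c * c = -1"
    proof
      assume "\<forall>v. \<Psi> (blinfun_apply A v) = - (\<i> *s \<Psi> v)"
      then have "\<Psi> (blinfun_apply A v) = (- \<i>) *s \<Psi> v" for v by simp
      then show thesis using that[of "- \<i>"] by simp
    qed (use that[of \<i>] in simp)
    have "A o\<^sub>L A = - id_blinfun"
    proof (rule blinfun_eqI, rule injD[OF bij_is_inj[OF bij]])
      fix v
      have "\<Psi> ((A o\<^sub>L A) v) = (c * c) *s \<Psi> v" by (simp only: blinfun_apply_blinfun_compose c(1) vector_smult_assoc)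
      also have "\<dots> = \<Psi> (- v)" using linear_neg[OF lin, of v] by (simp add: c(2))
      finally show "\<Psi> ((A o\<^sub>L A) v) = \<Psi> ((- id_blinfun) v)" by (simp add: uminus_blinfun.rep_eq)
    qed
    then show "adapted_at \<alpha> A"
      unfolding adapted_at_def contraction_symmetric_frame_iff[OF card \<Psi>] using c(1) by blast
  }
qed

lemma adapted_at_sign:
  fixes \<Psi> :: "'a::euclidean_space \<Rightarrow> complex ^ 'm::finite"
  assumes card: "CARD('m) > 2" and \<Psi>: "complex_frame \<alpha> \<Psi>"
    and "adapted_at \<alpha> A"
  shows "adapted_at \<alpha> B \<longleftrightarrow> B = A \<or> B = - A"
proof -
  note lin = complex_frameD(1)[OF \<Psi>] and inj = bij_is_inj[OF complex_frameD(2)[OF \<Psi>]]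
  have eq: "B = A \<longleftrightarrow> (\<forall>v. \<Psi> (blinfun_apply B v) = \<Psi> (blinfun_apply A v))" for A B
    using inj by (metis blinfun_eqI injD)
  have neg: "\<Psi> (blinfun_apply (- A) v) = - \<Psi> (blinfun_apply A v)" for A v
    by (simp add: uminus_blinfun.rep_eq linear_neg[OF lin])
  show ?thesis
    using assms(3) unfolding adapted_at_frame_iff[OF card \<Psi>] eq neg by auto
qed

lemma adapted_at_exists:
  fixes \<Psi> :: "'a::euclidean_space \<Rightarrow> complex ^ 'm::finite"
  assumes card: "CARD('m) > 2" and \<Psi>: "complex_frame \<alpha> \<Psi>"
  obtains J where "adapted_at \<alpha> J" "\<And>v. \<Psi> (blinfun_apply J v) = \<i> *s \<Psi> v"
  using frame_structure[OF complex_frameD(1,2)[OF \<Psi>]] adapted_at_frame_iff[OF card \<Psi>] by metis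

text \<open>Keeps the two signs apart: A = - A would give A = 0, whose square is not minus the
  identity of a nonzero space.\<close>

lemma adapted_at_neq_minus:
  assumes "adapted_at \<alpha> (A :: 'a::euclidean_space \<Rightarrow>\<^sub>L 'a)"
  shows "A \<noteq> - A"
proof
  assume "A = - A"
  then have "2 *\<^sub>R A = 0" by (metis scaleR_2 ab_left_minus add.commute)
  then have "A = 0" by simp
  then have "(- id_blinfun :: 'a \<Rightarrow>\<^sub>L 'a) = 0" using assms by (simp add: adapted_at_def)
  moreover obtain b :: 'a where "b \<in> Basis" using nonempty_Basis by blast
  ultimately show False
    by (metis blinfun.zero_left id_apply id_blinfun.rep_eq neg_equal_0_iff_equal nonzero_Basis uminus_blinfun.rep_eq)
qed

lemma adapted_acs_iff:
  "adapted_acs U \<omega> J \<longleftrightarrow> smooth_on U J \<and> (\<forall>p\<in>U. adapted_at (\<omega> p) (J p))"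
  by (auto simp: adapted_acs_def almost_complex_structure_def adapted_at_def)

text \<open>A smooth overdetermined linear system is solved by the invertible Gram matrix of its rows.\<close>

lemma smooth_linear_system:
  fixes c :: "'i \<Rightarrow> 'a::real_normed_vector \<Rightarrow> real ^ 'k"
  assumes U: "open U" "p \<in> U" and I: "finite I" and c: "\<And>i j. i \<in> I \<Longrightarrow> smooth_on U (\<lambda>q. c i q $ j)"
    and inj: "\<And>x. (\<And>i. i \<in> I \<Longrightarrow> c i p \<bullet> x = 0) \<Longrightarrow> x = 0"
  obtains V where "open V" "p \<in> V" "V \<subseteq> U"
    "\<forall>q\<in>V. \<forall>x. (\<forall>i\<in>I. c i q \<bullet> x = 0) \<longrightarrow> x = 0"
    "\<forall>y r. (\<forall>q\<in>V. \<forall>i\<in>I. c i q \<bullet> y q = r i) \<longrightarrow> smooth_on V y"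
proof -
  define G where "G = (\<lambda>q. \<chi> a b. \<Sum>i\<in>I. c i q $ a * c i q $ b)"
  have G: "G q *v x = (\<Sum>i\<in>I. (c i q \<bullet> x) *\<^sub>R c i q)" for q x
    by (simp add: vec_eq_iff G_def matrix_vector_mult_def inner_vec_def sum_distrib_left sum_distrib_right
        sum.swap[of _ UNIV] mult_ac)
  have "x = 0" if "G p *v x = 0" for x
  proof (rule inj)
    \<comment> \<open>A kernel vector of the Gram matrix has vanishing sum of squares, so it solves
      every row.\<close>
    have "(\<Sum>i\<in>I. (c i p \<bullet> x)\<^sup>2) = (G p *v x) \<bullet> x"
      by (simp add: G inner_sum_left power2_eq_square)
    also have "\<dots> = 0" using that by simp
    finally show "c i p \<bullet> x = 0" if "i \<in> I" for i
      using that I by (simp add: sum_nonneg_eq_0_iff)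
  qed
  then have "det (G p) \<noteq> 0"
    by (metis invertible_det_nz invertible_left_inverse matrix_left_invertible_ker)
  have GC: "Ck_on k U (\<lambda>q. G q $ a $ b)" for k a b
    using c by (auto simp: G_def smooth_on_def intro!: Ck_on_sum Ck_on_mult U(1))
  define V where "V = U \<inter> (\<lambda>q. det (G q)) -` (- {0})"
  have "continuous_on U (\<lambda>q. det (G q))"
    using Ck_on_det[OF U(1) GC] by (rule Ck_on_imp_continuous_on)
  then have "open V"
    unfolding V_def using U(1) by (intro continuous_open_preimage) auto
  have "V \<subseteq> U" by (auto simp: V_def)
  have det: "det (G q) \<noteq> 0" if "q \<in> V" for q using that by (simp add: V_def)
  show thesis
  proof (rule that[OF \<open>open V\<close> _ \<open>V \<subseteq> U\<close>])
    show "p \<in> V" using U(2) \<open>det (G p) \<noteq> 0\<close> by (simp add: V_def)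
    have "x = 0" if "q \<in> V" "\<forall>i\<in>I. c i q \<bullet> x = 0" for q x
    proof -
      have "G q *v x = 0" using that(2) by (simp add: G)
      then show ?thesis
        using det[OF that(1)] by (metis invertible_det_nz invertible_left_inverse matrix_left_invertible_ker)
    qed
    then show "\<forall>q\<in>V. \<forall>x. (\<forall>i\<in>I. c i q \<bullet> x = 0) \<longrightarrow> x = 0" by blast
    \<comment> \<open>The rows combine to the normal equations, whose square matrix G is smooth and
      invertible on V, so that Cramer's rule applies.\<close>
    have "smooth_on V y" if y: "\<forall>q\<in>V. \<forall>i\<in>I. c i q \<bullet> y q = r i" for y r
    proof (rule smooth_onI, rule Ck_on_solve[OF \<open>open V\<close>, where A=G and r="\<lambda>q. \<Sum>i\<in>I. r i *\<^sub>R c i q"])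
      show "Ck_on k V (\<lambda>q. G q $ a $ b)" for k a b using GC \<open>V \<subseteq> U\<close> Ck_on_subset by blast
      show "Ck_on k V (\<lambda>q. (\<Sum>i\<in>I. r i *\<^sub>R c i q) $ a)" for k a
      proof -
        have "Ck_on k V (\<lambda>q. c i q $ a)" if "i \<in> I" for i
          using Ck_on_subset[OF smooth_onD[OF c[OF that]] \<open>V \<subseteq> U\<close>] .
        then have "Ck_on k V (\<lambda>q. \<Sum>i\<in>I. r i * c i q $ a)"
          by (intro Ck_on_sum Ck_on_mult Ck_on_const \<open>open V\<close>)
        then show ?thesis by simp
      qed
      show "G q *v y q = (\<Sum>i\<in>I. r i *\<^sub>R c i q)" if "q \<in> V" for q
        using y that by (simp add: G)
    qed (rule det)
    then show "\<forall>y r. (\<forall>q\<in>V. \<forall>i\<in>I. c i q \<bullet> y q = r i) \<longrightarrow> smooth_on V y" by blast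
  qed
qed

text \<open>Complex conjugation in the frame is an involution C that anticommutes with J. So C J C =
  - J, and the trace is invariant under conjugation by C.\<close>

lemma trace_frame_structure:
  fixes \<Psi> :: "real ^ 'n \<Rightarrow> complex ^ 'm::finite"
  assumes \<Psi>: "linear \<Psi>" "bij \<Psi>" and J: "\<And>v. \<Psi> (blinfun_apply J v) = \<i> *s \<Psi> v"
  shows "trace (matrix (blinfun_apply J)) = 0"
proof -
  define C where "C = (\<lambda>v. inv \<Psi> (vcnj (\<Psi> v)))"
  have C: "linear C"
    using linear_compose[OF linear_compose[OF \<Psi>(1) linear_vcnj] linear_inv_of_bij[OF \<Psi>]]
    by (simp add: C_def o_def)
  have \<Psi>C: "\<Psi> (C v) = vcnj (\<Psi> v)" for v
    using \<Psi>(2) by (simp add: C_def surj_f_inv_f bij_is_surj)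
  have linJ: "linear (blinfun_apply J)" by (simp add: blinfun.bounded_linear_right bounded_linear.linear)
  have inj: "\<And>x y. \<Psi> x = \<Psi> y \<Longrightarrow> x = y" using \<Psi>(2) by (metis bij_is_inj injD)
  have CC: "C \<circ> C = id"
    by (auto simp: fun_eq_iff \<Psi>C vcnj_vcnj intro!: inj)
  have CJ: "C \<circ> blinfun_apply J = (\<lambda>v. - v) \<circ> (blinfun_apply J \<circ> C)"
    by (auto simp: fun_eq_iff \<Psi>C J vcnj_smult linear_neg[OF \<Psi>(1)] intro!: inj)
  have m: "matrix C ** matrix (blinfun_apply J) = - (matrix (blinfun_apply J) ** matrix C)"
  proof -
    have "matrix C ** matrix (blinfun_apply J) = matrix (\<lambda>v. - (blinfun_apply J (C v)))"
      using matrix_compose[OF linJ C] CJ by (simp add: o_def)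
    also have "\<dots> = - matrix (blinfun_apply J \<circ> C)"
      by (simp add: matrix_def vec_eq_iff)
    finally show ?thesis using matrix_compose[OF C linJ] by simp
  qed
  have CC': "matrix C ** matrix C = mat 1"
    using matrix_compose[OF C C] unfolding CC matrix_id_mat_1 by simp
  have "trace (matrix (blinfun_apply J)) = trace (matrix C ** (matrix C ** matrix (blinfun_apply J)))"
    by (simp add: matrix_mul_assoc CC')
  also have "\<dots> = trace ((matrix C ** matrix (blinfun_apply J)) ** matrix C)"
    by (rule trace_mul_sym)
  also have "\<dots> = - trace (matrix (blinfun_apply J) ** (matrix C ** matrix C))"
  proof -
    have "(- A) ** B = - (A ** B)" "trace (- A) = - trace A" for A B :: "real ^ 'n ^ 'n"
      by (simp_all add: trace_def matrix_matrix_mult_def sum_negf vec_eq_iff)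
    then show ?thesis by (simp add: m matrix_mul_assoc)
  qed
  also have "\<dots> = - trace (matrix (blinfun_apply J))" by (simp add: CC')
  finally show ?thesis by simp
qed


text \<open>Endomorphisms as coordinate vectors, so that linear conditions on them become rows for
  \<open>smooth_linear_system\<close>.\<close>

definition blinfun_entries :: "((real ^ 'n) \<Rightarrow>\<^sub>L (real ^ 'n)) \<Rightarrow> real ^ ('n \<times> 'n)" where
  "blinfun_entries A = (\<chi> rs. blinfun_apply A (axis (snd rs) 1) $ fst rs)"

definition blinfun_of_entries :: "real ^ ('n \<times> 'n) \<Rightarrow> ((real ^ 'n) \<Rightarrow>\<^sub>L (real ^ 'n))" where
  "blinfun_of_entries x = Blinfun (\<lambda>v. \<chi> r. \<Sum>s\<in>UNIV. x $ (r, s) * v $ s)"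

lemma blinfun_of_entries_apply:
  fixes x :: "real ^ ('n::finite \<times> 'n)"
  shows "blinfun_apply (blinfun_of_entries x) v = (\<chi> r. \<Sum>s\<in>UNIV. x $ (r, s) * v $ s)"
proof -
  have "linear (\<lambda>v :: real ^ 'n. \<chi> r :: 'n. \<Sum>s\<in>UNIV. x $ (r, s) * v $ s)"
    by (rule linearI)
      (simp_all add: vec_eq_iff sum.distrib sum_distrib_left distrib_left mult.left_commute)
  then show ?thesis
    by (simp add: blinfun_of_entries_def bounded_linear_Blinfun_apply linear_conv_bounded_linear[symmetric])
qed

lemma blinfun_of_entries_axis: "blinfun_apply (blinfun_of_entries x) (axis s 1) = (\<chi> r. x $ (r, s))"
  by (simp add: blinfun_of_entries_apply vec_eq_iff axis_def if_distrib[of "\<lambda>y. _ * y"] cong: if_cong)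

lemma blinfun_entries_of_entries: "blinfun_entries (blinfun_of_entries x) = x"
  by (simp add: blinfun_entries_def blinfun_of_entries_axis vec_eq_iff)

lemma blinfun_entries_linear:
  "blinfun_entries (a *\<^sub>R A + b *\<^sub>R B) = a *\<^sub>R blinfun_entries A + b *\<^sub>R blinfun_entries B"
  by (simp add: blinfun_entries_def vec_eq_iff blinfun.add_left blinfun.scaleR_left)

lemma blinfun_entries_inj: "blinfun_entries A = blinfun_entries B \<Longrightarrow> A = B"
proof (rule blinfun_euclidean_eqI)
  fix i :: "real ^ 'a" assume eq: "blinfun_entries A = blinfun_entries B" and "i \<in> Basis"
  then obtain s where s: "i = axis s 1" by (auto simp: Basis_vec_def)
  show "blinfun_apply A i = blinfun_apply B i"
    using arg_cong[OF eq, of "\<lambda>x. x $ (_, s)"] unfolding s by (simp add: blinfun_entries_def vec_eq_iff)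
qed

text \<open>The coefficient vector of the linear functional that sends A to the defect of
  contraction symmetry at the basis vectors j and k; see \<open>inner_symmetry_row\<close>.\<close>

definition symmetry_row :: "((real ^ 'n) list \<Rightarrow> real) \<Rightarrow> 'n \<Rightarrow> 'n \<Rightarrow> (real ^ 'n) list \<Rightarrow> real ^ ('n \<times> 'n)" where
  "symmetry_row \<alpha> j k us = (\<chi> rs.
     (if snd rs = k then \<alpha> (axis j 1 # axis (fst rs) 1 # us) else 0)
     - (if snd rs = j then \<alpha> (axis (fst rs) 1 # axis k 1 # us) else 0))"

lemma vec_sum_axis: "(v :: real ^ 'n) = (\<Sum>r\<in>UNIV. v $ r *\<^sub>R axis r 1)"
  by (simp add: vec_eq_iff axis_def if_distrib[of "\<lambda>y. _ * y"] cong: if_cong)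

lemma linear_sum_axis:
  fixes h :: "real ^ 'n \<Rightarrow> real"
  assumes "linear h"
  shows "h v = (\<Sum>r\<in>UNIV. v $ r * h (axis r 1))"
  using arg_cong[OF vec_sum_axis[of v], of h]
  by (simp only: linear_sum[OF assms] linear_scale[OF assms] real_scaleR_def)

lemma multilinear_form_linear_second:
  assumes "multilinear_form k M" "k = Suc (Suc l)" "length vs = l"
  shows "linear (\<lambda>v. M (w # v # vs))"
  using assms multilinear_form_linear_head[OF multilinear_form_tail, of l M vs w] by simp

lemma inner_symmetry_row:
  assumes \<alpha>: "multilinear_form (Suc (Suc l)) \<alpha>" and "length us = l"
  shows "symmetry_row \<alpha> j k us \<bullet> blinfun_entries A
    = \<alpha> (axis j 1 # blinfun_apply A (axis k 1) # us) - \<alpha> (blinfun_apply A (axis j 1) # axis k 1 # us)"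
proof -
  have lin: "linear (\<lambda>v. \<alpha> (v # axis k 1 # us))" "linear (\<lambda>v. \<alpha> (axis j 1 # v # us))"
    using multilinear_form_linear_head[of "Suc l" \<alpha>] multilinear_form_linear_second[OF \<alpha>] \<alpha> assms(2) by auto
  have pairs: "(\<Sum>rs\<in>UNIV. f rs) = (\<Sum>r\<in>UNIV. \<Sum>s\<in>UNIV. f (r, s))" for f :: "'a \<times> 'a \<Rightarrow> real"
    by (simp add: sum.cartesian_product)
  show ?thesis
    unfolding linear_sum_axis[OF lin(1), of "blinfun_apply A (axis j 1)"]
      linear_sum_axis[OF lin(2), of "blinfun_apply A (axis k 1)"]
    by (simp add: inner_vec_def pairs symmetry_row_def blinfun_entries_def left_diff_distrib sum_subtractf
        if_distrib[of "\<lambda>y. y * _"] mult.commute[of "\<alpha> _"] cong: if_cong)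
qed

text \<open>Turns the condition into finitely many linear equations with smooth coefficients. Both
  sides are multilinear in v, w and the remaining arguments, so basis vectors suffice, and lists of
  the wrong length contribute nothing.\<close>

lemma contraction_symmetric_entries_iff:
  fixes \<alpha> :: "(real ^ 'n) list \<Rightarrow> real"
  assumes \<alpha>: "alternating_form (Suc (Suc l)) \<alpha>"
  shows "contraction_symmetric \<alpha> A \<longleftrightarrow>
    (\<forall>j k us. length us = l \<longrightarrow> set us \<subseteq> Basis \<longrightarrow> symmetry_row \<alpha> j k us \<bullet> blinfun_entries A = 0)"
    (is "_ \<longleftrightarrow> ?rows")
proof
  note M = alternating_form_multilinear[OF \<alpha>]
  {
    assume "contraction_symmetric \<alpha> A"
    then show ?rows by (simp add: contraction_symmetric_iff inner_symmetry_row[OF M])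
  next
    assume rows: ?rows
    have basis: "\<alpha> (axis j 1 # blinfun_apply A (axis k 1) # us) = \<alpha> (blinfun_apply A (axis j 1) # axis k 1 # us)"
      if us: "length us = l" for j k us
    proof -
      let ?M = "\<lambda>us. \<alpha> (axis j 1 # blinfun_apply A (axis k 1) # us) - \<alpha> (blinfun_apply A (axis j 1) # axis k 1 # us)"
      have "?M us = 0"
      proof (rule multilinear_form_zero_on_Basis[OF _ us])
        have "multilinear_form l (\<lambda>us. \<alpha> (v # w # us))" for v w
          by (rule multilinear_form_tail[OF multilinear_form_tail[OF M]])
        then show "multilinear_form l ?M"
          unfolding multilinear_form_def by (auto intro!: linear_compose_sub)
        show "?M us = 0" if "length us = l" "set us \<subseteq> Basis" for us
          using rows that by (simp add: inner_symmetry_row[OF M])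
      qed
      then show ?thesis by simp
    qed
    have linA: "linear (blinfun_apply A)" by (simp add: blinfun.bounded_linear_right bounded_linear.linear)
    have *: "\<alpha> (v # blinfun_apply A w # us) = \<alpha> (blinfun_apply A v # w # us)" if us: "length us = l" for v w us
    proof -
      have l1: "linear (\<lambda>v. \<alpha> (v # w # us))" for w
        using multilinear_form_linear_head[OF M, of "w # us"] us by simp
      have l2: "linear (\<lambda>w. \<alpha> (v # w # us))" for v
        using multilinear_form_linear_second[OF M refl us] .
      have ax: "\<alpha> (axis j 1 # blinfun_apply A w # us) = \<alpha> (blinfun_apply A (axis j 1) # w # us)" for j
      proof -
        have "(\<lambda>w. \<alpha> (axis j 1 # blinfun_apply A w # us)) = (\<lambda>w. \<alpha> (blinfun_apply A (axis j 1) # w # us))"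
          using linear_compose[OF linA l2[of "axis j 1"]]
          by (intro linear_eq_stdbasis l2) (auto simp: Basis_vec_def basis[OF us] o_def)
        then show ?thesis by (rule fun_cong)
      qed
      show ?thesis
      proof -
        have "(\<lambda>v. \<alpha> (v # blinfun_apply A w # us)) = (\<lambda>v. \<alpha> (blinfun_apply A v # w # us))"
          using linear_compose[OF linA l1[of w]]
          by (intro linear_eq_stdbasis l1) (auto simp: Basis_vec_def ax o_def)
        then show ?thesis by (rule fun_cong)
      qed
    qed
    show "contraction_symmetric \<alpha> A"
      unfolding contraction_symmetric_iff
    proof (intro allI)
      fix v w us
      show "\<alpha> (v # blinfun_apply A w # us) = \<alpha> (blinfun_apply A v # w # us)"
        using *[of us] \<alpha> by (cases "length us = l") (auto simp: alternating_form_def)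
    qed
  }
qed

lemma smooth_symmetry_row:
  assumes "open U" "\<And>vs. smooth_on U (\<lambda>q. \<omega> q vs)"
  shows "smooth_on U (\<lambda>q. symmetry_row (\<omega> q) j k us $ i)"
proof -
  have "Ck_on n U (\<lambda>q. if b then \<omega> q vs else 0)" for n b vs
    using assms by (cases b) (auto simp: smooth_on_def intro: Ck_on_const)
  then show ?thesis
    by (auto simp: symmetry_row_def smooth_on_def intro!: Ck_on_diff assms(1))
qed

text \<open>The contraction-symmetric endomorphisms form the plane spanned by \<open>id\<close> and \<open>J\<close>. Vanishing
  trace and a linear normalisation single out a multiple of \<open>J\<close>.\<close>

lemma local_adapted_acs:
  fixes U :: "(real ^ 'n) set" and \<omega> :: "real ^ 'n \<Rightarrow> (real ^ 'n) list \<Rightarrow> real"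
  assumes card: "CARD('m::finite) > 2" and U: "open U" and \<omega>: "smooth_form CARD('m) U \<omega>"
    and frames: "\<And>p. p \<in> U \<Longrightarrow> \<exists>\<Psi> :: real ^ 'n \<Rightarrow> complex ^ 'm. complex_frame (\<omega> p) \<Psi>"
    and p: "p \<in> U"
  obtains V J where "open V" "p \<in> V" "V \<subseteq> U" "adapted_acs V \<omega> J"
proof -
  define l where "l = CARD('m) - 2"
  have l: "CARD('m) = Suc (Suc l)" using card by (simp add: l_def)
  have alt: "alternating_form (Suc (Suc l)) (\<omega> q)" if "q \<in> U" for q
    using \<omega> that by (simp add: smooth_form_def l)
  define structure_at where "structure_at = (\<lambda>q J. adapted_at (\<omega> q) J \<and> trace (matrix (blinfun_apply J)) = 0 \<and>
     (\<forall>A. contraction_symmetric (\<omega> q) A \<longrightarrow> (\<exists>a b. A = a *\<^sub>R id_blinfun + b *\<^sub>R J)))"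
  have ex: "\<exists>J. structure_at q J" if q: "q \<in> U" for q
  proof -
    obtain \<Psi> :: "real ^ 'n \<Rightarrow> complex ^ 'm" where \<Psi>: "complex_frame (\<omega> q) \<Psi>" using frames[OF q] by blast
    obtain J where J: "adapted_at (\<omega> q) J" "\<And>v. \<Psi> (blinfun_apply J v) = \<i> *s \<Psi> v"
      using adapted_at_exists[OF card \<Psi>] by metis
    note lin = complex_frameD(1)[OF \<Psi>] and bij = complex_frameD(2)[OF \<Psi>]
    have "\<exists>a b. A = a *\<^sub>R id_blinfun + b *\<^sub>R J" if sym: "contraction_symmetric (\<omega> q) A" for A
    proof -
      obtain c where c: "\<And>v. \<Psi> (blinfun_apply A v) = c *s \<Psi> v"
        using sym contraction_symmetric_frame_iff[OF card \<Psi>] by blast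
      have "A = Re c *\<^sub>R id_blinfun + Im c *\<^sub>R J"
      proof (rule blinfun_eqI, rule injD[OF bij_is_inj[OF bij]])
        fix v
        have "\<Psi> ((Re c *\<^sub>R id_blinfun + Im c *\<^sub>R J) v) = Re c *\<^sub>R \<Psi> v + Im c *\<^sub>R (\<i> *s \<Psi> v)"
          by (simp add: blinfun.add_left blinfun.scaleR_left linear_add[OF lin] linear_scale[OF lin] J(2))
        also have "\<dots> = c *s \<Psi> v" by (simp add: vec_eq_iff complex_eq_iff)
        finally show "\<Psi> (blinfun_apply A v) = \<Psi> ((Re c *\<^sub>R id_blinfun + Im c *\<^sub>R J) v)" by (simp add: c)
      qed
      then show ?thesis by blast
    qed
    then show ?thesis
      unfolding structure_at_def using J(1) trace_frame_structure[OF lin bij J(2)] by blast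
  qed
  \<comment> \<open>The sign is chosen at each point independently, so \<open>Jc\<close> need not be
    continuous.\<close>
  define Jc where "Jc = (\<lambda>q. SOME J. structure_at q J)"
  have Jc: "structure_at q (Jc q)" if "q \<in> U" for q
    unfolding Jc_def using ex[OF that] by (rule someI_ex)
  define diagonal :: "real ^ ('n \<times> 'n)" where "diagonal = (\<chi> rs. if fst rs = snd rs then 1 else 0)"
  have diagonal: "diagonal \<bullet> blinfun_entries A = trace (matrix (blinfun_apply A))" for A
  proof -
    have "diagonal \<bullet> blinfun_entries A = (\<Sum>r\<in>UNIV. \<Sum>s\<in>UNIV. (if r = s then 1 else 0) * blinfun_entries A $ (r, s))"
      by (simp add: inner_vec_def diagonal_def sum.cartesian_product split_beta)
    then show ?thesis
      by (simp add: blinfun_entries_def trace_def matrix_def if_distrib[of "\<lambda>y. y * _"] cong: if_cong)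
  qed
  \<comment> \<open>The normalising functional is the inner product with J at the base point, which
    is nonzero there and hence detects J at p.\<close>
  define nrm where "nrm = blinfun_entries (Jc p)"
  define L where "L = {us :: (real ^ 'n) list. length us = l \<and> set us \<subseteq> Basis}"
  have "finite L"
    unfolding L_def using finite_lists_length_eq[OF finite_Basis, of l] by (simp add: conj_commute)
  \<comment> \<open>\<open>None\<close> stands for the normalisation, \<open>Some None\<close> for
    the trace, and the rest for the symmetry rows.\<close>
  define I where "I = {None, Some None} \<union> (\<lambda>x. Some (Some x)) ` ((UNIV :: ('n \<times> 'n) set) \<times> L)"
  define c where "c = (\<lambda>i q. case i of None \<Rightarrow> nrm | Some None \<Rightarrow> diagonal
     | Some (Some ((j, k), us)) \<Rightarrow> symmetry_row (\<omega> q) j k us)"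
  define r where "r = (\<lambda>i :: (('n \<times> 'n) \<times> (real ^ 'n) list) option option. if i = None then 1 else 0 :: real)"
  have "finite I" unfolding I_def using \<open>finite L\<close> by simp
  \<comment> \<open>The value \<rho> = 0 gives the homogeneous system for uniqueness; \<rho> = t q
    is used for the solution.\<close>
  have rows: "(\<forall>i\<in>I. c i q \<bullet> blinfun_entries A = (if i = None then \<rho> else 0)) \<longleftrightarrow>
     contraction_symmetric (\<omega> q) A \<and> trace (matrix (blinfun_apply A)) = 0 \<and> nrm \<bullet> blinfun_entries A = \<rho>"
    if "q \<in> U" for q A \<rho>
    unfolding contraction_symmetric_entries_iff[OF alt[OF that]]
    by (auto simp: I_def c_def L_def diagonal)
  have determined: "x = 0" if q: "q \<in> U" "nrm \<bullet> blinfun_entries (Jc q) \<noteq> 0"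
    and x: "\<And>i. i \<in> I \<Longrightarrow> c i q \<bullet> x = 0" for q x
  proof -
    define A where "A = blinfun_of_entries x"
    have A: "x = blinfun_entries A" by (simp add: A_def blinfun_entries_of_entries)
    have sym: "contraction_symmetric (\<omega> q) A" "trace (matrix (blinfun_apply A)) = 0" "nrm \<bullet> blinfun_entries A = 0"
      using rows[OF q(1), of A 0] x A by auto
    obtain a b where ab: "A = a *\<^sub>R id_blinfun + b *\<^sub>R Jc q"
      using Jc[OF q(1)] sym(1) unfolding structure_at_def by blast
    \<comment> \<open>The identity has trace n and J has trace 0, so the trace equation isolates
      a.\<close>
    have "diagonal \<bullet> blinfun_entries A = a * CARD('n)"
      unfolding ab blinfun_entries_linear inner_add_right inner_scaleR_right diagonal
      using Jc[OF q(1)] by (simp add: structure_at_def trace_def matrix_def axis_def)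
    then have "a = 0" using sym(2) by (simp add: diagonal)
    have "nrm \<bullet> blinfun_entries A = b * (nrm \<bullet> blinfun_entries (Jc q))"
      unfolding ab blinfun_entries_linear inner_add_right inner_scaleR_right by (simp add: \<open>a = 0\<close>)
    then have "b = 0" using sym(3) q(2) by simp
    have "A = 0" using ab \<open>a = 0\<close> \<open>b = 0\<close> by simp
    then show ?thesis unfolding A by (simp add: blinfun_entries_def vec_eq_iff)
  qed
  have nz: "blinfun_entries (Jc q) \<noteq> 0" if "q \<in> U" for q
  proof
    assume "blinfun_entries (Jc q) = 0"
    also have "0 = blinfun_entries (0 :: (real ^ 'n) \<Rightarrow>\<^sub>L (real ^ 'n))" by (simp add: blinfun_entries_def vec_eq_iff)
    finally have "Jc q = 0" by (rule blinfun_entries_inj)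
    then show False
      using Jc[OF that] adapted_at_neq_minus[of "\<omega> q" "Jc q"] by (simp add: structure_at_def)
  qed
  have smooth: "smooth_on U (\<lambda>q. c i q $ j)" if "i \<in> I" for i j
  proof -
    have row: "smooth_on U (\<lambda>q. symmetry_row (\<omega> q) a b us $ j)" for a b us
      using \<omega> by (intro smooth_symmetry_row U) (simp add: smooth_form_def)
    have const: "smooth_on U (\<lambda>q. x :: real)" for x
      by (intro smooth_onI Ck_on_const U)
    show ?thesis
      using that unfolding I_def by (auto simp: c_def intro: row const)
  qed
  have "nrm \<bullet> blinfun_entries (Jc p) \<noteq> 0" using nz[OF p] by (simp add: nrm_def)
  note det_p = determined[OF p this]
  obtain V where V: "open V" "p \<in> V" "V \<subseteq> U"
    and inj: "\<forall>q\<in>V. \<forall>x. (\<forall>i\<in>I. c i q \<bullet> x = 0) \<longrightarrow> x = 0"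
    and sm: "\<forall>y r. (\<forall>q\<in>V. \<forall>i\<in>I. c i q \<bullet> y q = r i) \<longrightarrow> smooth_on V y"
    using smooth_linear_system[OF U p \<open>finite I\<close> smooth det_p] .
  define t where "t = (\<lambda>q. nrm \<bullet> blinfun_entries (Jc q))"
  have Jrows: "contraction_symmetric (\<omega> q) (Jc q)" "trace (matrix (blinfun_apply (Jc q))) = 0" if "q \<in> V" for q
    using Jc[of q] that V(3) by (auto simp: structure_at_def adapted_at_def)
  \<comment> \<open>Otherwise J at q would be a nonzero solution of the homogeneous system, which
    has only the zero solution on V.\<close>
  have t: "t q \<noteq> 0" if q: "q \<in> V" for q
  proof
    assume "t q = 0"
    then have "blinfun_entries (Jc q) = 0"
      using rows[of q "Jc q" 0] Jrows[OF q] q V(3) inj by (auto simp: t_def)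
    then show False using nz q V(3) by blast
  qed
  \<comment> \<open>The quotient does not see the arbitrary sign of \<open>Jc q\<close>, and it
    makes the right-hand side r constant, as \<open>smooth_linear_system\<close> requires.\<close>
  define y where "y = (\<lambda>q. (1 / t q) *\<^sub>R blinfun_entries (Jc q))"
  have "smooth_on V y"
  proof (rule sm[rule_format, of y r])
    show "c i q \<bullet> y q = r i" if "q \<in> V" "i \<in> I" for q i
      using rows[of q "Jc q" "t q"] Jrows[OF that(1)] that V(3) t[OF that(1)]
      by (auto simp: y_def r_def t_def)
  qed
  then have yC: "Ck_on k V (\<lambda>q. y q $ i)" for k i
    by (intro Ck_on_vec_nth V(1) smooth_onD)
  define A where "A = (\<lambda>q. blinfun_of_entries (y q))"
  have A: "A q = (1 / t q) *\<^sub>R Jc q" for q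
  proof (rule blinfun_entries_inj)
    show "blinfun_entries (A q) = blinfun_entries ((1 / t q) *\<^sub>R Jc q)"
      using blinfun_entries_linear[of "1 / t q" "Jc q" 0 0]
      by (simp add: A_def blinfun_entries_of_entries y_def)
  qed
  have AC: "Ck_on k V A" for k
  proof (rule Ck_on_blinfunI[OF V(1)])
    fix b :: "real ^ 'n" assume "b \<in> Basis"
    then obtain s where "b = axis s 1" by (auto simp: Basis_vec_def)
    then show "Ck_on k V (\<lambda>q. blinfun_apply (A q) b)"
      by (simp add: A_def blinfun_of_entries_axis Ck_on_vec_lambda V(1) yC)
  qed
  define e :: "real ^ 'n" where "e = axis undefined 1"
  \<comment> \<open>A q squares to a negative multiple of the identity, and s reads off (1 / t q)^2
    from the smooth A. Dividing A by sqrt s gives \<open>Jc q\<close> up to the sign of t q.\<close>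
  define s where "s = (\<lambda>q. - (blinfun_apply (A q o\<^sub>L A q) e \<bullet> e))"
  have s: "s q = (1 / t q)\<^sup>2" if "q \<in> V" for q
  proof -
    have "Jc q o\<^sub>L Jc q = - id_blinfun" using Jc[of q] that V(3) by (auto simp: structure_at_def adapted_at_def)
    from arg_cong[OF this, of "\<lambda>B. blinfun_apply B e"] have "blinfun_apply (Jc q) (blinfun_apply (Jc q) e) = - e"
      by (simp add: uminus_blinfun.rep_eq)
    then show ?thesis
      by (simp add: s_def A blinfun.scaleR_left blinfun.scaleR_right power2_eq_square e_def inner_axis_axis)
  qed
  have sC: "Ck_on k V s" for k
    unfolding s_def
    by (intro Ck_on_uminus V(1) Ck_on_bounded_linear_compose[OF bounded_linear_inner_left]
        Ck_on_blinfun_apply Ck_on_bilinear[OF bounded_bilinear_blinfun_compose] AC)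
  define J where "J = (\<lambda>q. (1 / sqrt (s q)) *\<^sub>R A q)"
  have "smooth_on V J"
    unfolding J_def using t
    by (intro smooth_onI Ck_on_scaleR Ck_on_divide Ck_on_const V(1) Ck_on_sqrt sC AC) (auto simp: s)
  moreover have "adapted_at (\<omega> q) (J q)" if q: "q \<in> V" for q
  proof -
    obtain \<Psi> :: "real ^ 'n \<Rightarrow> complex ^ 'm" where \<Psi>: "complex_frame (\<omega> q) \<Psi>" using frames V(3) q by blast
    have "adapted_at (\<omega> q) (Jc q)" using Jc[of q] q V(3) by (auto simp: structure_at_def)
    moreover have "J q = Jc q \<or> J q = - Jc q"
      using t[OF q] by (cases "t q > 0") (auto simp: J_def A s[OF q])
    ultimately show ?thesis using adapted_at_sign[OF card \<Psi>] by blast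
  qed
  ultimately have "adapted_acs V \<omega> J" by (simp add: adapted_acs_iff)
  then show thesis using that V by blast
qed

section \<open>Global almost-complex structures\<close>

text \<open>Where the norm of f + g exceeds that of f - g, the alternative f = - g is excluded. This
  is an open condition, and it holds at p.\<close>

lemma eq_near_if_eq_up_to_sign:
  fixes f g :: "'a::topological_space \<Rightarrow> 'b::real_normed_vector"
  assumes V: "open V" "p \<in> V" and cont: "continuous_on V f" "continuous_on V g"
    and p: "f p = g p" "g p \<noteq> 0" and sgn: "\<And>q. q \<in> V \<Longrightarrow> f q = g q \<or> f q = - g q"
  obtains W where "open W" "p \<in> W" "W \<subseteq> V" "\<And>q. q \<in> W \<Longrightarrow> f q = g q"
proof
  define W where "W = V \<inter> (\<lambda>q. norm (f q + g q) - norm (f q - g q)) -` {0<..}"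
  show "open W"
    unfolding W_def using V(1) cont by (intro continuous_open_preimage continuous_intros) auto
  have "g p + g p \<noteq> 0" using p(2) by (metis scaleR_2 scaleR_eq_0_iff zero_neq_numeral)
  then show "p \<in> W" using V(2) p by (simp add: W_def)
  show "W \<subseteq> V" by (auto simp: W_def)
  show "f q = g q" if "q \<in> W" for q
    using that sgn[of q] by (auto simp: W_def)
qed

text \<open>Provides a reference isomorphism for orientations. Conjugation reverses the m imaginary
  coordinates, which is the source of the sign and of the role of the parity of m.\<close>

lemma real_coordinates_exist:
  assumes "CARD('n::finite) = 2 * CARD('m::finite)"
  obtains \<psi> :: "real ^ 'n \<Rightarrow> complex ^ 'm"
  where "linear \<psi>" "bij \<psi>" "det (matrix (\<lambda>v. inv \<psi> (vcnj (\<psi> v)))) = (- 1) ^ CARD('m)"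
proof -
  have "card (UNIV :: 'n set) = card (UNIV :: ('m \<times> bool) set)"
    using assms by (simp add: card_cartesian_product flip: UNIV_Times_UNIV)
  then obtain \<beta> :: "'n \<Rightarrow> 'm \<times> bool" where \<beta>: "bij \<beta>"
    using finite_same_card_bij[of "UNIV :: 'n set" "UNIV :: ('m \<times> bool) set"] by auto
  define \<psi> :: "real ^ 'n \<Rightarrow> complex ^ 'm"
    where "\<psi> = (\<lambda>v. \<chi> k. Complex (v $ inv \<beta> (k, False)) (v $ inv \<beta> (k, True)))"
  have lin: "linear \<psi>"
    by (rule linearI) (auto simp: \<psi>_def vec_eq_iff complex_eq_iff)
  have inj: "inj \<psi>"
  proof (rule injI)
    fix v w assume eq: "\<psi> v = \<psi> w"
    have "v $ inv \<beta> (k, b) = w $ inv \<beta> (k, b)" for k b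
      using arg_cong[OF eq, of "\<lambda>z. z $ k"] by (cases b) (auto simp: \<psi>_def)
    then have "v $ inv \<beta> (\<beta> i) = w $ inv \<beta> (\<beta> i)" for i by (cases "\<beta> i") simp
    then show "v = w" using \<beta> by (simp add: vec_eq_iff bij_is_inj)
  qed
  have bij: "bij \<psi>" by (rule linear_inj_imp_bij[OF lin inj]) (simp add: assms)
  define \<sigma> where "\<sigma> = (\<lambda>i. if snd (\<beta> i) then - 1 else 1 :: real)"
  have C: "inv \<psi> (vcnj (\<psi> v)) = (\<chi> i. \<sigma> i * v $ i)" for v
  proof (rule inv_f_eq[OF inj])
    show "\<psi> (\<chi> i. \<sigma> i * v $ i) = vcnj (\<psi> v)"
      using \<beta> by (simp add: \<psi>_def vcnj_def vec_eq_iff complex_eq_iff \<sigma>_def surj_f_inv_f bij_is_surj)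
  qed
  have "det (matrix (\<lambda>v. inv \<psi> (vcnj (\<psi> v)))) = (\<Prod>i\<in>UNIV. \<sigma> i)"
    unfolding C by (subst det_diagonal) (auto simp: matrix_def axis_def)
  also have "\<dots> = (\<Prod>x\<in>UNIV. if snd (x :: 'm \<times> bool) then - 1 else 1)"
    using prod.reindex_bij_betw[OF \<beta>, of "\<lambda>x. if snd x then - 1 else 1 :: real"] by (simp add: \<sigma>_def)
  also have "\<dots> = (\<Prod>k\<in>(UNIV :: 'm set). \<Prod>b\<in>UNIV. if b then - 1 else 1)"
    by (simp only: prod.cartesian_product UNIV_Times_UNIV case_prod_unfold)
  also have "\<dots> = (- 1) ^ CARD('m)" by (simp add: UNIV_bool)
  finally show thesis using that lin bij by blast
qed

text \<open>Its sign is the orientation of \<Phi> relative to the reference isomorphism \<psi>, with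
  value 0 for singular \<Phi>.\<close>

definition orientation :: "(real ^ 'n \<Rightarrow> complex ^ 'm::finite) \<Rightarrow> (real ^ 'n \<Rightarrow> complex ^ 'm) \<Rightarrow> real" where
  "orientation \<psi> \<Phi> = det (matrix (\<lambda>v. inv \<psi> (\<Phi> v)))"

lemma orientation_compose:
  fixes \<psi> \<Phi> :: "real ^ 'n \<Rightarrow> complex ^ 'm::finite"
  assumes \<psi>: "linear \<psi>" "bij \<psi>" and "linear g" "linear \<Phi>"
  shows "orientation \<psi> (\<lambda>v. g (\<Phi> v)) = orientation \<psi> (\<lambda>v. g (\<psi> v)) * orientation \<psi> \<Phi>"
proof -
  note inv = linear_inv_of_bij[OF \<psi>]
  have l: "linear (\<lambda>v. inv \<psi> (g (\<psi> v)))" "linear (\<lambda>v. inv \<psi> (\<Phi> v))"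
    using linear_compose[OF linear_compose[OF \<psi>(1) assms(3)] inv] linear_compose[OF assms(4) inv]
    by (simp_all add: o_def)
  have "(\<lambda>v. inv \<psi> (g (\<Phi> v))) = (\<lambda>v. inv \<psi> (g (\<psi> v))) \<circ> (\<lambda>v. inv \<psi> (\<Phi> v))"
    using \<psi>(2) by (simp add: fun_eq_iff surj_f_inv_f bij_is_surj)
  then show ?thesis
    unfolding orientation_def using matrix_compose[OF l(2,1)] by (simp add: det_mul)
qed

lemma orientation_nonzero:
  fixes \<psi> \<Phi> :: "real ^ 'n \<Rightarrow> complex ^ 'm::finite"
  assumes \<psi>: "linear \<psi>" "bij \<psi>" and \<Phi>: "linear \<Phi>"
  shows "orientation \<psi> \<Phi> \<noteq> 0 \<longleftrightarrow> inj \<Phi>"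
proof -
  have "linear (\<lambda>v. inv \<psi> (\<Phi> v))"
    using linear_compose[OF \<Phi> linear_inv_of_bij[OF \<psi>]] by (simp add: o_def)
  moreover have "inj (\<lambda>v. inv \<psi> (\<Phi> v)) \<longleftrightarrow> inj \<Phi>"
    using bij_is_inj[OF bij_imp_bij_inv[OF \<psi>(2)]] by (auto simp: inj_def)
  ultimately show ?thesis unfolding orientation_def by (simp add: det_nz_iff_inj)
qed

lemma linear_smult: "linear ((*v) A)" for A :: "complex ^ 'n ^ 'm"
  by (rule linearI) (simp_all add: matrix_vector_mult_def vec_eq_iff sum.distrib distrib_left scaleR_sum_right)

text \<open>The segment from \<open>A\<close> to the identity lies on a complex line in which the singular
  matrices are finitely many points, and the complement of these points is connected.\<close>

lemma orientation_complex_linear_nonneg: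
  fixes \<psi> :: "real ^ 'n \<Rightarrow> complex ^ 'm::finite"
  assumes \<psi>: "linear \<psi>" "bij \<psi>"
  shows "orientation \<psi> (\<lambda>v. A *v \<psi> v) \<ge> 0"
proof (rule ccontr)
  assume neg: "\<not> orientation \<psi> (\<lambda>v. A *v \<psi> v) \<ge> 0"
  define B where "B = (\<lambda>z. \<chi> i j. A $ i $ j + z * (mat 1 $ i $ j - A $ i $ j))"
  define h where "h = (\<lambda>z. orientation \<psi> (\<lambda>v. B z *v \<psi> v))"
  \<comment> \<open>The entries of B z are affine in z, so its determinant is a polynomial in z, and
    it is nonzero because B 1 is the identity.\<close>
  define P where "P = det (\<chi> i j. [:A $ i $ j, mat 1 $ i $ j - A $ i $ j:])"
  have P: "poly P z = det (B z)" for z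
    by (simp add: P_def B_def det_def poly_sum poly_prod)
  have B01: "B 0 = A" "B 1 = mat 1" by (simp_all add: B_def vec_eq_iff)
  have "poly P 1 \<noteq> 0" by (simp add: P B01)
  then have "P \<noteq> 0" by auto
  define S where "S = {z. poly P z = 0}"
  have "finite S" unfolding S_def using \<open>P \<noteq> 0\<close> by (rule poly_roots_finite)
  \<comment> \<open>A finite set does not disconnect the complex plane. The real function h is
    continuous and has no zero off S, so it cannot pass there from h 0 < 0 to h 1 = 1.\<close>
  then have conn: "connected (- S)"
    by (intro path_connected_imp_connected path_connected_complement_countable countable_finite) auto
  have nz: "h z \<noteq> 0 \<longleftrightarrow> det (B z) \<noteq> 0" for z
  proof -
    have lin: "linear (\<lambda>v. B z *v \<psi> v)" using linear_compose[OF \<psi>(1) linear_smult] by (simp add: o_def)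
    moreover have "inj (\<lambda>v. B z *v \<psi> v) \<longleftrightarrow> inj ((*v) (B z))"
      unfolding inj_def using \<psi>(2) by (metis bij_pointE)
    ultimately show ?thesis
      unfolding h_def orientation_nonzero[OF \<psi> lin]
      using det_nz_iff_inj_gen[OF matrix_vector_mul_linear_gen, of "B z"] by simp
  qed
  have "continuous_on UNIV (\<lambda>z. inv \<psi> (B z *v \<psi> (axis j 1)) $ i)" for i j
  proof -
    have "continuous_on UNIV (\<lambda>z. B z *v w)" for w
      unfolding B_def matrix_vector_mult_def by (intro continuous_intros)
    then show ?thesis
      using linear_continuous_on_compose[of UNIV _ "inv \<psi>"] linear_inv_of_bij[OF \<psi>]
      by (intro continuous_on_component) auto
  qed
  \<comment> \<open>\<open>Ck_on 0\<close> is continuity, so \<open>Ck_on_det\<close> also yields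
    the continuity of a determinant.\<close>
  then have "continuous_on UNIV h"
    unfolding h_def orientation_def using Ck_on_det[of UNIV 0 "\<lambda>z. matrix (\<lambda>v. inv \<psi> (B z *v \<psi> v))"]
    by (simp add: matrix_def)
  then have "connected (h ` (- S))"
    using conn by (intro connected_continuous_image) (auto intro: continuous_on_subset)
  moreover have "h 0 < 0" using neg by (simp add: h_def B01)
  moreover have "h 1 = 1"
  proof -
    have "(\<lambda>v. inv \<psi> (\<psi> v)) = id" using \<psi>(2) by (simp add: fun_eq_iff bij_is_inj)
    then show ?thesis by (simp add: h_def B01 orientation_def)
  qed
  moreover have "0 \<in> - S" "1 \<in> - S"
    using nz[of 0] \<open>h 0 < 0\<close> nz[of 1] \<open>h 1 = 1\<close> by (auto simp: S_def P)
  ultimately have "0 \<in> h ` (- S)"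
    using connectedD_interval[of "h ` (- S)" "h 0" "h 1" 0] by auto
  then obtain z where "z \<in> - S" "h z = 0" by (metis imageE)
  then show False using nz[of z] by (simp add: S_def P)
qed

lemma smult_eq_scaleR: "c *s z = Re c *\<^sub>R z + Im c *\<^sub>R (\<i> *s z)" for z :: "complex ^ 'n"
  by (simp add: vec_eq_iff complex_eq_iff)

lemma vec_linear_if_commutes:
  fixes g :: "complex ^ 'n \<Rightarrow> complex ^ 'm"
  assumes "linear g" "\<And>z. g (\<i> *s z) = \<i> *s g z"
  shows "g z = matrix g *v z"
proof -
  have "g (c *s z) = c *s g z" for c z
  proof -
    show ?thesis
      unfolding smult_eq_scaleR[of c] using assms by (simp add: linear_add linear_scale)
  qed
  then have "Vector_Spaces.linear (*s) (*s) g"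
    by unfold_locales (simp_all add: linear_add[OF assms(1)])
  then show ?thesis by (simp add: matrix_works)
qed

text \<open>\<Phi> is J-antilinear and \<Psi> is J-linear, so \<Phi> is conjugation after a
  complex-linear g after \<Psi>. The three orientations are negative, nonnegative and positive; g
  may be singular, whence the weak inequality.\<close>

lemma orientation_antilinear_nonpos:
  fixes \<psi> \<Phi> \<Psi> :: "real ^ 'n \<Rightarrow> complex ^ 'm::finite"
  assumes \<psi>: "linear \<psi>" "bij \<psi>" "orientation \<psi> (\<lambda>v. vcnj (\<psi> v)) < 0"
    and \<Psi>: "linear \<Psi>" "bij \<Psi>" "orientation \<psi> \<Psi> > 0" and \<Phi>: "linear \<Phi>"
    and J: "\<And>v. \<Psi> (blinfun_apply J v) = \<i> *s \<Psi> v" "\<And>v. \<Phi> (blinfun_apply J v) = - (\<i> *s \<Phi> v)"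
  shows "orientation \<psi> \<Phi> \<le> 0"
proof -
  define g where "g = (\<lambda>z. vcnj (\<Phi> (inv \<Psi> z)))"
  have g: "linear g"
    using linear_compose[OF linear_compose[OF linear_inv_of_bij[OF \<Psi>(1,2)] \<Phi>] linear_vcnj]
    by (simp add: g_def o_def)
  have "g (\<i> *s z) = \<i> *s g z" for z
  proof -
    obtain v where v: "z = \<Psi> v" using \<Psi>(2) by (metis bij_pointE)
    have "g (\<i> *s z) = vcnj (\<Phi> (blinfun_apply J v))"
      using \<Psi>(2) by (simp add: g_def v J(1)[symmetric] bij_is_inj)
    also have "\<dots> = vcnj ((- \<i>) *s \<Phi> v)" by (simp add: J(2))
    also have "\<dots> = \<i> *s vcnj (\<Phi> v)" by (subst vcnj_smult) simp
    also have "\<dots> = \<i> *s g z" using \<Psi>(2) by (simp add: g_def v bij_is_inj)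
    finally show ?thesis .
  qed
  note gA = vec_linear_if_commutes[OF g this]
  have "\<Phi> v = vcnj (matrix g *v \<Psi> v)" for v
  proof -
    have "vcnj (g (\<Psi> v)) = \<Phi> v" using \<Psi>(2) by (simp add: g_def vcnj_vcnj bij_is_inj)
    then show ?thesis by (simp only: gA[symmetric])
  qed
  then have "orientation \<psi> \<Phi> = orientation \<psi> (\<lambda>v. vcnj (matrix g *v \<Psi> v))" by presburger
  also have "\<dots> = orientation \<psi> (\<lambda>v. vcnj (\<psi> v)) * (orientation \<psi> (\<lambda>v. matrix g *v \<psi> v) * orientation \<psi> \<Psi>)"
    using orientation_compose[OF \<psi>(1,2) linear_vcnj, of "\<lambda>v. matrix g *v \<Psi> v"]
      orientation_compose[OF \<psi>(1,2) linear_smult[of "matrix g"] \<Psi>(1)]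
      linear_compose[OF \<Psi>(1) linear_smult[of "matrix g"]] by (simp add: o_def)
  also have "\<dots> \<le> 0"
    using \<psi>(3) \<Psi>(3) orientation_complex_linear_nonneg[OF \<psi>(1,2), of "matrix g"]
    by (simp add: mult_nonpos_nonneg)
  finally show ?thesis .
qed

text \<open>The \<open>itself\<close> parameter carries the complex dimension, which the types of U
  and \<omega> do not mention; \<open>frames\<close> is the form in which the linear type
  enters.\<close>

locale complex_volume_form =
  fixes U :: "(real ^ 'n) set" and \<omega> :: "real ^ 'n \<Rightarrow> (real ^ 'n) list \<Rightarrow> real" and m :: "'m::finite itself"
  assumes card: "CARD('m) > 2" and open_U: "open U" and smooth_\<omega>: "smooth_form CARD('m) U \<omega>"
    and frames: "\<And>p. p \<in> U \<Longrightarrow> \<exists>\<Psi> :: real ^ 'n \<Rightarrow> complex ^ 'm. complex_frame (\<omega> p) \<Psi>"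
begin

lemma adapted_sign:
  assumes "p \<in> U" "adapted_at (\<omega> p) A"
  shows "adapted_at (\<omega> p) B \<longleftrightarrow> B = A \<or> B = - A"
  using frames[OF assms(1)] adapted_at_sign[OF card _ assms(2)] by blast

lemma local_acs:
  assumes "p \<in> U" "adapted_at (\<omega> p) A"
  obtains V J where "open V" "p \<in> V" "V \<subseteq> U" "adapted_acs V \<omega> J" "J p = A"
proof -
  obtain V J where V: "open V" "p \<in> V" "V \<subseteq> U" "adapted_acs V \<omega> J"
    using local_adapted_acs[OF card open_U smooth_\<omega> frames assms(1)] by metis
  have J: "smooth_on V J" "\<And>q. q \<in> V \<Longrightarrow> adapted_at (\<omega> q) (J q)"
    using V(4) by (auto simp: adapted_acs_iff)
  have "A = J p \<or> A = - J p" using adapted_sign[OF assms(1) J(2)[OF V(2)]] assms(2) by blast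
  then show thesis
  proof
    assume "A = - J p"
    moreover have "smooth_on V (\<lambda>q. - J q)"
      using J(1) V(1) by (auto simp: smooth_on_def intro: Ck_on_uminus)
    moreover have "adapted_at (\<omega> q) (- J q)" if "q \<in> V" for q
      using adapted_sign[of q "J q" "- J q"] J(2) that V(3) by blast
    ultimately show thesis using that[of V "\<lambda>q. - J q"] V by (simp add: adapted_acs_iff)
  qed (use that V in blast)
qed

lemma adapted_ex:
  assumes "p \<in> U"
  obtains A where "adapted_at (\<omega> p) A"
  using frames[OF assms] adapted_at_exists[OF card] by metis

text \<open>Near each point there is a smooth adapted structure through the prescribed value, and a
  continuous J must coincide with it close to that point. So a global construction has to arrange
  continuity only.\<close>

lemma adapted_acs_of_continuous:
  assumes at: "\<And>p. p \<in> U \<Longrightarrow> adapted_at (\<omega> p) (J p)"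
    and cont: "\<And>p. p \<in> U \<Longrightarrow> \<exists>W. open W \<and> p \<in> W \<and> continuous_on W J"
  shows "adapted_acs U \<omega> J"
  unfolding adapted_acs_iff
proof (intro conjI ballI at)
  show "smooth_on U J"
  proof (rule smooth_on_local)
    fix p assume p: "p \<in> U"
    obtain V J' where V: "open V" "p \<in> V" "V \<subseteq> U" "adapted_acs V \<omega> J'" "J' p = J p"
      using local_acs[OF p at[OF p]] .
    have J': "smooth_on V J'" "\<And>q. q \<in> V \<Longrightarrow> adapted_at (\<omega> q) (J' q)"
      using V(4) by (auto simp: adapted_acs_iff)
    obtain W where W: "open W" "p \<in> W" "continuous_on W J" using cont[OF p] by blast
    have "J p \<noteq> 0" using adapted_at_neq_minus[OF at[OF p]] by auto
    then obtain X where X: "open X" "p \<in> X" "X \<subseteq> V \<inter> W" "\<And>q. q \<in> X \<Longrightarrow> J' q = J q"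
    proof (rule eq_near_if_eq_up_to_sign[of "V \<inter> W" p J' J, rotated 5])
      show "J' q = J q \<or> J' q = - J q" if "q \<in> V \<inter> W" for q
        using that adapted_sign[of q "J q" "J' q"] at[of q] J'(2) V(3) by blast
    qed (use V W smooth_on_imp_continuous_on[OF J'(1)] in \<open>auto intro: continuous_on_subset\<close>)
    have "smooth_on X J"
      using smooth_on_cong[OF X(1) smooth_on_subset[OF J'(1)]] X(3,4) by blast
    then show "\<exists>V. open V \<and> p \<in> V \<and> smooth_on V J" using X by blast
  qed
qed

text \<open>The sets where the structures agree and where they are opposite are closed in C, cover
  it and are disjoint, so connectedness leaves only one of them.\<close>

lemma adapted_acs_unique_on_components:
  assumes J: "adapted_acs U \<omega> J" and J': "adapted_acs U \<omega> J'" and C: "C \<in> components U"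
  shows "(\<forall>p\<in>C. J' p = J p) \<or> (\<forall>p\<in>C. J' p = - J p)"
proof (rule ccontr)
  assume neg: "\<not> ?thesis"
  have CU: "C \<subseteq> U" using C by (rule in_components_subset)
  have cont: "continuous_on C J" "continuous_on C J'"
    using J J' CU by (auto simp: adapted_acs_iff dest!: smooth_on_imp_continuous_on intro: continuous_on_subset)
  have at: "adapted_at (\<omega> p) (J p)" "J' p = J p \<or> J' p = - J p" if "p \<in> C" for p
    using J J' CU that adapted_sign[of p "J p" "J' p"] by (auto simp: adapted_acs_iff)
  define E1 E2 where "E1 = {p \<in> C. J' p - J p = 0}" and "E2 = {p \<in> C. J' p + J p = 0}"
  have "closedin (top_of_set C) E1"
    unfolding E1_def using cont by (intro continuous_closedin_preimage_constant continuous_intros)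
  moreover have "closedin (top_of_set C) E2"
    unfolding E2_def using cont by (intro continuous_closedin_preimage_constant continuous_intros)
  moreover have "E1 \<union> E2 = C" using at(2) by (force simp: E1_def E2_def)
  moreover have "E1 \<inter> E2 = {}"
    using adapted_at_neq_minus[OF at(1)] by (auto simp: E1_def E2_def eq_neg_iff_add_eq_0)
  moreover have "E1 \<noteq> {}" "E2 \<noteq> {}" using neg at(2) by (auto simp: E1_def E2_def eq_neg_iff_add_eq_0)
  ultimately show False
    using in_components_connected[OF C] unfolding connected_closedin_eq by blast
qed

text \<open>Defined by the condition itself, so that no sign is chosen; this is the witness
  \<open>P\<close> of the theorem.\<close>

definition sign_pair :: "real ^ 'n \<Rightarrow> ((real ^ 'n) \<Rightarrow>\<^sub>L (real ^ 'n)) set" where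
  "sign_pair p = {A. adapted_at (\<omega> p) A}"

lemma sign_pair_eq: "p \<in> U \<Longrightarrow> adapted_at (\<omega> p) A \<Longrightarrow> sign_pair p = {A, - A}"
  using adapted_sign by (auto simp: sign_pair_def)

lemma represents_on_sign_pair_iff:
  assumes "V \<subseteq> U"
  shows "represents_on V J sign_pair \<longleftrightarrow> open V \<and> adapted_acs V \<omega> J"
proof -
  have "sign_pair q = {J q, - J q} \<longleftrightarrow> adapted_at (\<omega> q) (J q)" if "q \<in> V" for q
    using sign_pair_eq[of q "J q"] assms that by (auto simp: sign_pair_def)
  then show ?thesis
    by (auto simp: represents_on_def adapted_acs_iff almost_complex_structure_def adapted_at_def)
qed

lemma adapted_up_to_sign_sign_pair: "adapted_up_to_sign U \<omega> sign_pair"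
  unfolding adapted_up_to_sign_def acs_up_to_sign_def
proof (intro conjI ballI)
  fix p assume p: "p \<in> U"
  show "contraction_symmetric (\<omega> p) A" if "A \<in> sign_pair p" for A
    using that by (simp add: sign_pair_def adapted_at_def)
  obtain A where "adapted_at (\<omega> p) A" using adapted_ex[OF p] .
  then show "\<exists>V J. p \<in> V \<and> V \<subseteq> U \<and> represents_on V J sign_pair"
    using local_acs[OF p] represents_on_sign_pair_iff by metis
qed

lemma adapted_up_to_sign_unique:
  assumes P: "adapted_up_to_sign U \<omega> P" and p: "p \<in> U"
  shows "P p = sign_pair p"
proof -
  obtain V J where "p \<in> V" "V \<subseteq> U" "represents_on V J P"
    using P p unfolding adapted_up_to_sign_def acs_up_to_sign_def by blast
  then have J: "P p = {J p, - J p}" "J p o\<^sub>L J p = - id_blinfun"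
    by (auto simp: represents_on_def almost_complex_structure_def)
  then have "adapted_at (\<omega> p) (J p)"
    using P p by (auto simp: adapted_up_to_sign_def adapted_at_def)
  from sign_pair_eq[OF p this] show ?thesis by (simp add: J)
qed

text \<open>For odd m conjugation reverses orientation, so each point has a positively oriented
  frame, and J is multiplication by i in it. These frames may jump, so continuity is tested against
  a smooth local \<open>J'\<close> with the same value at p. A continuous family \<Phi> q of
  \<open>J'\<close>-linear maps that starts at the frame of p keeps positive orientation near p; if
  J q were - \<open>J' q\<close>, then \<Phi> q would be J-antilinear and could not be
  positive.\<close>

lemma adapted_acs_if_odd:
  assumes odd: "odd CARD('m)"
  shows "\<exists>J. adapted_acs U \<omega> J"
\<comment> \<open>The equality of dimensions is read off a frame at some point of U.\<close>
proof (cases "U = {}")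
  case True
  then show ?thesis by (auto simp: adapted_acs_iff intro: smooth_on_local)
next
  case False
  then obtain p0 where "p0 \<in> U" by blast
  then obtain \<Psi>0 :: "real ^ 'n \<Rightarrow> complex ^ 'm" where "complex_frame (\<omega> p0) \<Psi>0"
    using frames by blast
  note \<Psi>0 = complex_frameD(1,2)[OF this]
  have "CARD('n) = 2 * CARD('m)"
  proof -
    have "dim (range \<Psi>0) = dim (UNIV :: (real ^ 'n) set)"
      using \<Psi>0 by (intro dim_image_eq) (auto simp: bij_is_inj)
    then show ?thesis using \<Psi>0(2) by (simp add: bij_is_surj mult.commute)
  qed
  then obtain \<psi> :: "real ^ 'n \<Rightarrow> complex ^ 'm" where
    \<psi>: "linear \<psi>" "bij \<psi>" "det (matrix (\<lambda>v. inv \<psi> (vcnj (\<psi> v)))) = (- 1) ^ CARD('m)"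
    using real_coordinates_exist by metis
  have \<psi>cnj: "orientation \<psi> (\<lambda>v. vcnj (\<psi> v)) = - 1"
    using \<psi>(3) odd by (simp add: orientation_def)
  have "\<exists>\<Psi> :: real ^ 'n \<Rightarrow> complex ^ 'm. complex_frame (\<omega> p) \<Psi> \<and> orientation \<psi> \<Psi> > 0" if p: "p \<in> U" for p
  proof -
    obtain \<Psi> :: "real ^ 'n \<Rightarrow> complex ^ 'm" where \<Psi>: "complex_frame (\<omega> p) \<Psi>" using frames[OF p] by blast
    note \<Psi>D = complex_frameD(1,2)[OF \<Psi>]
    have "orientation \<psi> \<Psi> \<noteq> 0"
      using orientation_nonzero[OF \<psi>(1,2) \<Psi>D(1)] \<Psi>D(2) by (simp add: bij_is_inj)
    moreover have "orientation \<psi> (\<lambda>v. vcnj (\<Psi> v)) = - orientation \<psi> \<Psi>"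
      using orientation_compose[OF \<psi>(1,2) linear_vcnj \<Psi>D(1)] by (simp add: \<psi>cnj)
    ultimately show ?thesis
      using \<Psi> complex_frame_vcnj[OF \<Psi>] by (metis neg_0_less_iff_less linorder_less_linear)
  qed
  then obtain \<Psi> :: "real ^ 'n \<Rightarrow> real ^ 'n \<Rightarrow> complex ^ 'm" where
    \<Psi>: "\<And>p. p \<in> U \<Longrightarrow> complex_frame (\<omega> p) (\<Psi> p)" "\<And>p. p \<in> U \<Longrightarrow> orientation \<psi> (\<Psi> p) > 0"
    by metis
  have "\<exists>J. adapted_at (\<omega> p) J \<and> (\<forall>v. \<Psi> p (blinfun_apply J v) = \<i> *s \<Psi> p v)" if "p \<in> U" for p
    using adapted_at_exists[OF card \<Psi>(1)[OF that]] by metis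
  then obtain J where J: "\<And>p. p \<in> U \<Longrightarrow> adapted_at (\<omega> p) (J p)"
    "\<And>p v. p \<in> U \<Longrightarrow> \<Psi> p (blinfun_apply (J p) v) = \<i> *s \<Psi> p v"
    by metis
  have "\<exists>W. open W \<and> p \<in> W \<and> continuous_on W J" if p: "p \<in> U" for p
  proof -
    obtain V J' where V: "open V" "p \<in> V" "V \<subseteq> U" "adapted_acs V \<omega> J'" "J' p = J p"
      using local_acs[OF p J(1)[OF p]] .
    have J': "continuous_on V J'" "\<And>q. q \<in> V \<Longrightarrow> adapted_at (\<omega> q) (J' q)"
      using V(4) by (auto simp: adapted_acs_iff smooth_on_imp_continuous_on)
    have JJ: "blinfun_apply A (blinfun_apply A v) = - v" if "adapted_at \<alpha> A" for \<alpha> v and A :: "(real ^ 'n) \<Rightarrow>\<^sub>L (real ^ 'n)"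
    proof -
      have "A o\<^sub>L A = - id_blinfun" using that by (simp add: adapted_at_def)
      from arg_cong[OF this, of "\<lambda>B. blinfun_apply B v"] show ?thesis by (simp add: uminus_blinfun.rep_eq)
    qed
    note lin = complex_frameD(1)[OF \<Psi>(1)[OF p]]
    \<comment> \<open>\<open>C\<close> intertwines \<open>J' q\<close> with \<open>J p\<close>, and it is the identity for \<open>q = p\<close>.\<close>
    define C where "C = (\<lambda>q v. (1 / 2) *\<^sub>R (v - blinfun_apply (J p) (blinfun_apply (J' q) v)))"
    define \<Phi> where "\<Phi> = (\<lambda>q v. \<Psi> p (C q v))"
    have linC: "linear (C q)" for q
      by (rule linearI) (simp_all add: C_def blinfun.add_right blinfun.scaleR_right algebra_simps)
    have lin\<Phi>: "linear (\<Phi> q)" for q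
      using linear_compose[OF linC lin] by (simp add: \<Phi>_def o_def)
    have CJ: "C q (blinfun_apply (J' q) v) = blinfun_apply (J p) (C q v)" if "q \<in> V" for q v
      by (simp add: C_def JJ[OF J'(2)[OF that]] JJ[OF J(1)[OF p]] blinfun.scaleR_right
          blinfun.diff_right blinfun.minus_right add.commute)
    have \<Phi>J: "\<Phi> q (blinfun_apply (J' q) v) = \<i> *s \<Phi> q v" if "q \<in> V" for q v
      by (simp add: \<Phi>_def CJ[OF that] J(2)[OF p])
    have "C p v = v" for v
      by (simp add: C_def V(5) JJ[OF J(1)[OF p]] scaleR_2[symmetric])
    then have \<Phi>p: "\<Phi> p = \<Psi> p" by (simp add: \<Phi>_def)
    define h where "h = (\<lambda>q. orientation \<psi> (\<Phi> q))"
    have "continuous_on V (\<lambda>q. inv \<psi> (\<Phi> q (axis j 1)) $ i)" for i j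
    proof -
      have "continuous_on V (\<lambda>q. C q (axis j 1))"
        unfolding C_def by (intro continuous_intros J'(1))
      then have "continuous_on V (\<lambda>q. \<Phi> q (axis j 1))"
        unfolding \<Phi>_def using linear_continuous_on_compose lin by blast
      then show ?thesis
        using linear_continuous_on_compose linear_inv_of_bij[OF \<psi>(1,2)]
        by (intro continuous_on_component) blast
    qed
    then have "continuous_on V h"
      unfolding h_def orientation_def using Ck_on_det[of V 0 "\<lambda>q. matrix (\<lambda>v. inv \<psi> (\<Phi> q v))"] V(1)
      by (simp add: matrix_def)
    define W where "W = V \<inter> h -` {0<..}"
    have "open W" unfolding W_def using V(1) \<open>continuous_on V h\<close> by (intro continuous_open_preimage) auto
    moreover have "p \<in> W" using V(2) \<Psi>(2)[OF p] by (simp add: W_def h_def \<Phi>p)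
    moreover have "J' q = J q" if q: "q \<in> W" for q
    proof (rule ccontr)
      assume "J' q \<noteq> J q"
      have qV: "q \<in> V" "q \<in> U" "h q > 0" using q V(3) by (auto simp: W_def)
      then have "J' q = - J q" using adapted_sign J(1) J'(2) \<open>J' q \<noteq> J q\<close> by blast
      then have "J q = - J' q" by simp
      then have "\<Phi> q (blinfun_apply (J q) v) = - (\<i> *s \<Phi> q v)" for v
        using \<Phi>J[OF qV(1), of v] linear_neg[OF lin\<Phi>[of q], of "blinfun_apply (J' q) v"]
        by (simp add: uminus_blinfun.rep_eq)
      then have "orientation \<psi> (\<Phi> q) \<le> 0"
        using orientation_antilinear_nonpos[OF \<psi>(1,2) _ complex_frameD(1,2)[OF \<Psi>(1)[OF qV(2)]]
            \<Psi>(2)[OF qV(2)] lin\<Phi> J(2)[OF qV(2)]] \<psi>cnj by simp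
      then show False using qV(3) by (simp add: h_def)
    qed
    then have "continuous_on W J"
      using J'(1) by (metis (no_types, lifting) W_def continuous_on_cong continuous_on_subset inf_le1)
    ultimately show ?thesis by blast
  qed
  then show ?thesis using adapted_acs_of_continuous[of J] J(1) by blast
qed

text \<open>Over a component C the pairs (q, A) with A adapted at q form a two-sheeted covering E,
  and a continuous J on C is a section of it. Components of an open set are open, so the sections on
  different components combine to a continuous structure on U.\<close>

lemma adapted_acs_if_simply_connected:
  assumes sc: "\<And>C. C \<in> components U \<Longrightarrow> simply_connected C"
  shows "\<exists>J. adapted_acs U \<omega> J"
proof -
  have "\<exists>J. continuous_on C J \<and> (\<forall>q\<in>C. adapted_at (\<omega> q) (J q))" if C: "C \<in> components U" for C
  proof -
    have CU: "C \<subseteq> U" using C by (rule in_components_subset)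
    have "open C" using open_components[OF open_U C] .
    define E where "E = {(q, A). q \<in> C \<and> adapted_at (\<omega> q) A}"
    have "covering_space E fst C"
    proof
      show "continuous_on E fst" by (intro continuous_intros)
      show "fst ` E = C"
        using adapted_ex CU unfolding E_def by (force simp: image_iff)
      fix p assume p: "p \<in> C"
      obtain A where A: "adapted_at (\<omega> p) A" using adapted_ex p CU by blast
      have "p \<in> U" using p CU by blast
      obtain V J where V: "open V" "p \<in> V" "V \<subseteq> U" "adapted_acs V \<omega> J" "J p = A"
        using local_acs[OF \<open>p \<in> U\<close> A] .
      have J: "continuous_on V J" "\<And>q. q \<in> V \<Longrightarrow> adapted_at (\<omega> q) (J q)"
        using V(4) by (auto simp: adapted_acs_iff smooth_on_imp_continuous_on)
      define T where "T = V \<inter> C"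
      \<comment> \<open>The parameter s is 1 or -1; the two graphs are the sheets over T.\<close>
      define sheet where "sheet = (\<lambda>s :: real. (\<lambda>q. (q, s *\<^sub>R J q)) ` T)"
      have T: "T \<subseteq> C" "T \<subseteq> V" "T \<subseteq> U" by (auto simp: T_def V(3)[THEN subsetD])
      have signs: "(q, B) \<in> E \<longleftrightarrow> B = J q \<or> B = - J q" if "q \<in> T" for q B
        using adapted_sign[of q "J q" B] J(2)[of q] T that by (auto simp: E_def)
      have Jn: "J q \<noteq> - J q" "- J q \<noteq> J q" "J q \<noteq> 0" if "q \<in> T" for q
        using adapted_at_neq_minus[OF J(2)[of q]] T that by auto
      have sheet_open: "openin (top_of_set E) (sheet s)" if s: "s = 1 \<or> s = - 1" for s
      proof -
        \<comment> \<open>The inequality of norms separates s J q from - s J q by an open condition,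
          which makes the sheet relatively open in E.\<close>
        have eq: "sheet s = (E \<inter> (V \<times> UNIV)) \<inter>
          (\<lambda>x. norm (snd x + s *\<^sub>R J (fst x)) - norm (snd x - s *\<^sub>R J (fst x))) -` {0<..}" (is "_ = ?R")
        proof (intro set_eqI iffI)
          fix x assume "x \<in> sheet s"
          then obtain q where q: "q \<in> T" "x = (q, s *\<^sub>R J q)" by (auto simp: sheet_def)
          have "s *\<^sub>R J q + s *\<^sub>R J q = (2 * s) *\<^sub>R J q" by (simp add: scaleR_left_distrib[symmetric])
          then show "x \<in> ?R" using q T signs[OF q(1)] Jn[OF q(1)] s by auto
        next
          fix x assume x: "x \<in> ?R"
          obtain q B where x': "x = (q, B)" by (cases x)
          have q: "q \<in> T" using x x' by (auto simp: T_def E_def)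
          then have "B = J q \<or> B = - J q" using x x' signs by blast
          then have "B = s *\<^sub>R J q" using x x' s by auto
          then show "x \<in> sheet s" using q x' by (auto simp: sheet_def)
        qed
        have cont: "continuous_on (E \<inter> (V \<times> UNIV))
          (\<lambda>x. norm (snd x + s *\<^sub>R J (fst x)) - norm (snd x - s *\<^sub>R J (fst x)))"
          by (intro continuous_intros continuous_on_compose2[OF J(1)]) auto
        have "openin (top_of_set (E \<inter> (V \<times> UNIV))) (sheet s)"
          unfolding eq by (rule continuous_openin_preimage_gen[OF cont]) simp
        moreover have "openin (top_of_set E) (E \<inter> (V \<times> UNIV))"
          using V(1) by (intro openin_open_Int open_Times) auto
        ultimately show ?thesis by (rule openin_trans)
      qed
      have hom: "homeomorphism (sheet s) T fst (\<lambda>q. (q, s *\<^sub>R J q))" for s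
      proof (rule homeomorphismI)
        show "continuous_on (sheet s) fst" by (rule continuous_on_fst[OF continuous_on_id])
        show "continuous_on T (\<lambda>q. (q, s *\<^sub>R J q))"
          by (intro continuous_intros continuous_on_subset[OF J(1) T(2)])
      qed (auto simp: sheet_def)
      show "\<exists>T. p \<in> T \<and> openin (top_of_set C) T \<and>
          (\<exists>v. \<Union>v = E \<inter> fst -` T \<and> (\<forall>u\<in>v. openin (top_of_set E) u) \<and>
               pairwise disjnt v \<and> (\<forall>u\<in>v. \<exists>q. homeomorphism u T fst q))"
      proof (intro exI[of _ T] conjI exI[of _ "{sheet 1, sheet (- 1)}"])
        show "p \<in> T" using p V(2) by (simp add: T_def)
        show "openin (top_of_set C) T"
          unfolding T_def using V(1) by (metis inf_commute openin_open_Int)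
        show "\<Union>{sheet 1, sheet (- 1)} = E \<inter> fst -` T"
          using signs by (auto simp: sheet_def)
        show "pairwise disjnt {sheet 1, sheet (- 1)}"
          using Jn by (auto simp: pairwise_def disjnt_def sheet_def)
      qed (use sheet_open hom in auto)
    qed
    moreover have "locally path_connected C"
      using \<open>open C\<close> open_imp_locally_path_connected by blast
    \<comment> \<open>A lift of the identity map of C is a section of the covering; simple
      connectedness of C is what allows the lift.\<close>
    ultimately obtain g where g: "continuous_on C g" "g \<in> C \<rightarrow> E" "\<And>y. y \<in> C \<Longrightarrow> fst (g y) = y"
      using covering_space_lift[of E fst C C "\<lambda>x. x"] sc[OF C] by auto
    have "continuous_on C (\<lambda>q. snd (g q))" using g(1) by (intro continuous_intros)
    moreover have "adapted_at (\<omega> q) (snd (g q))" if "q \<in> C" for q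
      using g(2,3) that by (force simp: E_def Pi_iff)
    ultimately show ?thesis by blast
  qed
  then obtain J where J: "\<And>C. C \<in> components U \<Longrightarrow> continuous_on C (J C)"
    "\<And>C q. C \<in> components U \<Longrightarrow> q \<in> C \<Longrightarrow> adapted_at (\<omega> q) (J C q)"
    by metis
  define c where "c = connected_component_set U"
  have c: "c p \<in> components U" "p \<in> c p" "open (c p)" if "p \<in> U" for p
    using that open_connected_component[OF open_U] by (auto simp: c_def componentsI)
  have same: "c q = c p" if "q \<in> c p" for p q
    using that unfolding c_def by (metis connected_component_eq)
  have "adapted_acs U \<omega> (\<lambda>q. J (c q) q)"
  proof (rule adapted_acs_of_continuous)
    fix p assume p: "p \<in> U"
    show "adapted_at (\<omega> p) (J (c p) p)" using J(2) c p by blast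
    have "continuous_on (c p) (\<lambda>q. J (c q) q)"
      using J(1)[OF c(1)[OF p]] same by (simp cong: continuous_on_cong)
    then show "\<exists>W. open W \<and> p \<in> W \<and> continuous_on W (\<lambda>q. J (c q) q)" using c p by blast
  qed
  then show ?thesis by blast
qed

end

section \<open>Charts and inverse functions\<close>

lemma Ck_on_derivative_apply:
  fixes \<phi> :: "'a::euclidean_space \<Rightarrow> 'b::real_normed_vector"
  assumes V: "open V" and \<phi>: "smooth_on V \<phi>" and f: "Ck_on k V f"
  shows "Ck_on k V (\<lambda>q. fderiv \<phi> q (f q))"
proof -
  have lin: "linear (fderiv \<phi> q)" if "q \<in> V" for q
    using has_derivative_linear[OF smooth_on_has_derivative[OF \<phi> that]] .
  have "Ck_on k V (\<lambda>q. \<Sum>b\<in>Basis. (f q \<bullet> b) *\<^sub>R fderiv \<phi> q b)"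
    by (intro Ck_on_sum Ck_on_scaleR V Ck_on_bounded_linear_compose[OF bounded_linear_inner_left] f
        smooth_onD smooth_on_frechet_derivative \<phi>)
  then show ?thesis
    by (rule Ck_on_cong[OF V]) (simp add: linear_sum_Basis[OF lin, symmetric])
qed

lemma chart_derivative:
  assumes \<phi>: "chart_on V \<phi>" and q: "q \<in> V"
  obtains D' where "(\<phi> has_derivative fderiv \<phi> q) (at q)"
    "(inv_into V \<phi> has_derivative D') (at (\<phi> q))"
    "\<And>w. fderiv \<phi> q (D' w) = w" "\<And>v. D' (fderiv \<phi> q v) = v"
proof -
  let ?\<psi> = "inv_into V \<phi>"
  let ?D = "fderiv \<phi> q"
  have V: "open V" "open (\<phi> ` V)" "inj_on \<phi> V" "smooth_on V \<phi>" "smooth_on (\<phi> ` V) ?\<psi>"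
    using \<phi> by (auto simp: chart_on_def)
  have D: "(\<phi> has_derivative ?D) (at q)" by (rule smooth_on_has_derivative[OF V(4) q])
  have inv: "?\<psi> (\<phi> x) = x" if "x \<in> V" for x using V(3) that by simp
  define D' where "D' = fderiv ?\<psi> (\<phi> q)"
  have D': "(?\<psi> has_derivative D') (at (\<phi> q))"
    unfolding D'_def using q by (intro smooth_on_has_derivative[OF V(5)]) auto
  have "((\<lambda>x. ?\<psi> (\<phi> x)) has_derivative (\<lambda>v. D' (?D v))) (at q)"
    by (rule has_derivative_compose[OF D D'])
  moreover have "((\<lambda>x. ?\<psi> (\<phi> x)) has_derivative (\<lambda>v. v)) (at q)"
    by (rule has_derivative_transform_within_open[OF has_derivative_ident V(1) q]) (simp add: inv)
  ultimately have 1: "(\<lambda>v. D' (?D v)) = (\<lambda>v. v)" by (rule has_derivative_unique)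
  have "(\<phi> has_derivative ?D) (at (?\<psi> (\<phi> q)))" using D inv[OF q] by simp
  then have "((\<lambda>y. \<phi> (?\<psi> y)) has_derivative (\<lambda>w. ?D (D' w))) (at (\<phi> q))"
    by (rule has_derivative_compose[OF D'])
  moreover have "((\<lambda>y. \<phi> (?\<psi> y)) has_derivative (\<lambda>w. w)) (at (\<phi> q))"
    by (rule has_derivative_transform_within_open[OF has_derivative_ident V(2)]) (use q in \<open>auto simp: f_inv_into_f\<close>)
  ultimately have 2: "(\<lambda>w. ?D (D' w)) = (\<lambda>w. w)" by (rule has_derivative_unique)
  show thesis
    using that[OF D D'] 1 2 by (simp add: fun_eq_iff)
qed

lemma chart_derivative_linear_bij:
  assumes "chart_on V \<phi>" "q \<in> V"
  shows "linear (fderiv \<phi> q)" "bij (fderiv \<phi> q)"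
proof -
  obtain D' where D: "(\<phi> has_derivative fderiv \<phi> q) (at q)"
    "\<And>w. fderiv \<phi> q (D' w) = w" "\<And>v. D' (fderiv \<phi> q v) = v"
    using chart_derivative[OF assms] by metis
  show "linear (fderiv \<phi> q)" using has_derivative_linear[OF D(1)] .
  show "bij (fderiv \<phi> q)"
    using D(2,3) by (intro o_bij[of D']) (auto simp: fun_eq_iff)
qed

lemma chart_on_subset:
  assumes \<phi>: "chart_on V \<phi>" and W: "open W" "W \<subseteq> V"
  shows "chart_on W \<phi>"
proof -
  have V: "open V" "open (\<phi> ` V)" "inj_on \<phi> V" "smooth_on V \<phi>" "smooth_on (\<phi> ` V) (inv_into V \<phi>)"
    using \<phi> by (auto simp: chart_on_def)
  have inj: "inj_on \<phi> W" using V(3) W(2) by (rule inj_on_subset)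
  have "\<phi> ` W = \<phi> ` V \<inter> inv_into V \<phi> -` W"
    using V(3) W(2) by (auto simp: subset_iff)
  then have "open (\<phi> ` W)"
    using continuous_open_preimage[OF smooth_on_imp_continuous_on[OF V(5)] V(2) W(1)] by simp
  moreover have "smooth_on (\<phi> ` W) (inv_into W \<phi>)"
  proof (rule smooth_on_cong[OF \<open>open (\<phi> ` W)\<close>])
    show "smooth_on (\<phi> ` W) (inv_into V \<phi>)" using V(5) W(2) by (auto intro: smooth_on_subset)
    show "inv_into V \<phi> y = inv_into W \<phi> y" if "y \<in> \<phi> ` W" for y
      using that V(3) W(2) inj by (auto simp: subset_iff)
  qed
  ultimately show ?thesis
    using inj W smooth_on_subset[OF V(4) W(2)] by (simp add: chart_on_def)
qed

lemma bounded_linear_euclidean: "linear (f :: 'a::euclidean_space \<Rightarrow> 'b::real_normed_vector) \<Longrightarrow> bounded_linear f"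
  by (simp add: linear_conv_bounded_linear)

lemma chart_on_linear_compose:
  fixes \<phi> :: "'a::euclidean_space \<Rightarrow> 'b::euclidean_space" and L :: "'b \<Rightarrow> 'c::euclidean_space"
  assumes \<phi>: "chart_on V \<phi>" and L: "linear L" "bij L"
  shows "chart_on V (\<lambda>x. L (\<phi> x))"
proof -
  have V: "open V" "open (\<phi> ` V)" "inj_on \<phi> V" "smooth_on V \<phi>" "smooth_on (\<phi> ` V) (inv_into V \<phi>)"
    using \<phi> by (auto simp: chart_on_def)
  note linv = bounded_linear_euclidean[OF linear_inv_of_bij[OF L]]
  have im: "(\<lambda>x. L (\<phi> x)) ` V = inv L -` (\<phi> ` V)"
    using L(2) by (auto simp: bij_is_inj image_iff) (metis bij_is_surj surj_f_inv_f)
  have op: "open ((\<lambda>x. L (\<phi> x)) ` V)"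
    unfolding im by (rule open_vimage[OF V(2) linear_continuous_on[OF linv]])
  have inj: "inj_on (\<lambda>x. L (\<phi> x)) V"
    by (rule inj_onI) (use inj_onD[OF V(3)] injD[OF bij_is_inj[OF L(2)]] in blast)
  have "smooth_on ((\<lambda>x. L (\<phi> x)) ` V) (\<lambda>y. inv_into V \<phi> (inv L y))"
    by (rule smooth_onI, rule Ck_on_compose[OF op smooth_onD[OF V(5)] Ck_on_bounded_linear[OF linv op]])
      (simp add: im)
  then have "smooth_on ((\<lambda>x. L (\<phi> x)) ` V) (inv_into V (\<lambda>x. L (\<phi> x)))"
  proof (rule smooth_on_cong[OF op])
    fix y assume "y \<in> (\<lambda>x. L (\<phi> x)) ` V"
    then obtain x where x: "x \<in> V" "y = L (\<phi> x)" by blast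
    then show "inv_into V \<phi> (inv L y) = inv_into V (\<lambda>x. L (\<phi> x)) y"
      using inv_into_f_f[OF inj x(1)] inv_into_f_f[OF V(3) x(1)] L(2) by (simp add: bij_is_inj)
  qed
  moreover have "smooth_on V (\<lambda>x. L (\<phi> x))"
    using V(4) by (auto simp: smooth_on_def intro: Ck_on_bounded_linear_compose bounded_linear_euclidean L V(1))
  ultimately show ?thesis using V(1) op inj by (simp add: chart_on_def)
qed

text \<open>The inverse function theorem gives a differentiable local inverse g, and smoothness
  follows by bootstrapping: the derivative of g solves a linear system with matrix D (g y), whose
  entries are as regular as g, so Cramer's rule raises the regularity of g by one.\<close>

lemma smooth_local_inverse:
  fixes h :: "real ^ 'n \<Rightarrow> real ^ 'n"
  assumes V: "open V" "p \<in> V" and h: "smooth_on V h" and inj: "inj (fderiv h p)"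
  obtains W where "open W" "p \<in> W" "W \<subseteq> V" "chart_on W h"
proof -
  define D where "D = (\<lambda>x. fderiv h x)"
  have D: "(h has_derivative D x) (at x)" if "x \<in> V" for x
    unfolding D_def by (rule smooth_on_has_derivative[OF h that])
  have app: "blinfun_apply (Blinfun (D x)) = D x" if "x \<in> V" for x
    using D[OF that] by (simp add: bounded_linear_Blinfun_apply has_derivative_bounded_linear)
  have bijp: "bij (D p)"
    using inj has_derivative_linear[OF D[OF V(2)]] linear_injective_imp_surjective unfolding D_def bij_def by blast
  have inv: "Blinfun (inv (D p)) o\<^sub>L Blinfun (D p) = id_blinfun"
  proof (rule blinfun_eqI)
    fix v
    have "bounded_linear (inv (D p))"
      using bounded_linear_euclidean[OF linear_inv_of_bij[OF has_derivative_linear[OF D[OF V(2)]] bijp]] .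
    then show "blinfun_apply (Blinfun (inv (D p)) o\<^sub>L Blinfun (D p)) v = blinfun_apply id_blinfun v"
      using bijp by (simp add: app[OF V(2)] bounded_linear_Blinfun_apply bij_is_inj)
  qed
  have "continuous_on V (\<lambda>x. Blinfun (D x))"
    unfolding D_def by (rule continuous_on_blinfun_derivative[OF h])
  from inverse_function_theorem[OF V(1) _ this V(2) inv, of h] D app
  obtain W X g g' where W: "open W" "W \<subseteq> V" "p \<in> W" "open X" "homeomorphism W X h g"
    and g: "\<And>y. y \<in> X \<Longrightarrow> (g has_derivative (g' y)) (at y)"
    and g': "\<And>y. y \<in> X \<Longrightarrow> g' y = inv (blinfun_apply (Blinfun (D (g y))))"
    and bij: "\<And>y. y \<in> X \<Longrightarrow> bij (blinfun_apply (Blinfun (D (g y))))"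
    by metis
  have gW: "g y \<in> W" "h (g y) = y" if "y \<in> X" for y
    using W(5) that by (auto simp: homeomorphism_def)
  have hg: "g (h x) = x" if "x \<in> W" for x using W(5) that by (auto simp: homeomorphism_def)
  have hW: "h ` W = X" using W(5) by (auto simp: homeomorphism_def)
  have injW: "inj_on h W" using hg by (metis inj_onI)
  have "Ck_on k X g" for k
  proof (induction k)
    case 0
    then show ?case using W(5) by (simp add: homeomorphism_def)
  next
    case (Suc k)
    show ?case
    proof (rule Ck_on_Suc_I[OF W(4) g])
      fix v
      show "Ck_on k X (\<lambda>y. g' y v)"
      proof (rule Ck_on_solve[OF W(4), where A="\<lambda>y. matrix (D (g y))" and r="\<lambda>y. v"])
        show "Ck_on k X (\<lambda>y. matrix (D (g y)) $ i $ j)" for i j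
        proof -
          have "Ck_on k V (\<lambda>x. D x (axis j 1))"
            unfolding D_def by (intro smooth_onD smooth_on_frechet_derivative h)
          then have "Ck_on k X (\<lambda>y. D (g y) (axis j 1))"
            by (rule Ck_on_compose[OF W(4) _ Suc]) (use gW W(2) in auto)
          from Ck_on_vec_nth[OF W(4) this] show ?thesis by (simp add: matrix_def)
        qed
        fix y assume y: "y \<in> X"
        have gV: "g y \<in> V" using gW(1)[OF y] W(2) by blast
        have lin: "linear (D (g y))" using has_derivative_linear[OF D[OF gV]] .
        show "det (matrix (D (g y))) \<noteq> 0"
          using det_nz_iff_inj[OF lin] bij[OF y] by (simp add: app[OF gV] bij_is_inj)
        show "matrix (D (g y)) *v g' y v = v"
          using bij[OF y] by (simp add: g'[OF y] app[OF gV] matrix_works[OF lin[unfolded linear_matrix_vector_mul_eq[symmetric]]] surj_f_inv_f bij_is_surj)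
      qed (auto intro: Ck_on_const W(4))
    qed
  qed
  then have "smooth_on X g" by (rule smooth_onI)
  then have "smooth_on X (inv_into W h)"
    by (rule smooth_on_cong[OF W(4)]) (rule inv_into_f_eq[OF injW gW, symmetric])
  then have "chart_on W h"
    using W hW injW smooth_on_subset[OF h W(2)] by (simp add: chart_on_def)
  then show thesis using that W by blast
qed

section \<open>Primitives of holomorphic functions\<close>

definition coord_proj :: "'m::finite \<Rightarrow> (complex ^ 'm) \<Rightarrow>\<^sub>L (complex ^ 'm)" where
  "coord_proj k = Blinfun (\<lambda>z. axis k (z $ k))"

lemma coord_proj_apply: "blinfun_apply (coord_proj k) z = axis k (z $ k)"
proof -
  have "bounded_linear (\<lambda>z :: complex ^ 'a. axis k (z $ k))"
    by (rule bounded_linear_compose[OF bounded_linear_axis bounded_linear_vec_nth])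
  then show ?thesis by (simp add: coord_proj_def bounded_linear_Blinfun_apply)
qed

text \<open>As t runs from 0 to 1, the image of z traces the segment in direction k from z with its
  k-th coordinate replaced by 0 to z itself.\<close>

definition coord_scale :: "'m::finite \<Rightarrow> real \<Rightarrow> (complex ^ 'm) \<Rightarrow>\<^sub>L (complex ^ 'm)" where
  "coord_scale k t = id_blinfun + (t - 1) *\<^sub>R coord_proj k"

lemma coord_scale_apply:
  "blinfun_apply (coord_scale k t) z = z + (t - 1) *\<^sub>R blinfun_apply (coord_proj k) z"
  by (simp add: coord_scale_def blinfun.add_left blinfun.scaleR_left)

lemma coord_scale_nth: "blinfun_apply (coord_scale k t) z $ j = (if j = k then t *\<^sub>R z $ j else z $ j)"
  by (simp add: coord_scale_apply coord_proj_apply axis_def algebra_simps)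

lemma coord_scale_smult: "blinfun_apply (coord_scale k t) (c *s z) = c *s blinfun_apply (coord_scale k t) z"
  by (simp add: vec_eq_iff coord_scale_nth)

lemma coord_scale_in_ball:
  assumes "t \<in> {0..1}" "z \<in> ball 0 r"
  shows "blinfun_apply (coord_scale k t) z \<in> ball 0 r"
proof -
  have "norm (blinfun_apply (coord_scale k t) z) \<le> norm z"
    using assms(1) by (intro norm_le_componentwise_cart) (auto simp: coord_scale_nth mult_left_le_one_le)
  then show ?thesis using assms(2) by simp
qed

lemma continuous_on_coord_scale: "continuous_on S (coord_scale k)"
  unfolding coord_scale_def by (intro continuous_intros)

text \<open>For n = 0, multiplication by the k-th coordinate gives the primitive of f in the k-th
  variable that vanishes where this coordinate is 0. Higher powers arise on differentiation, since
  the k-th component of a direction is scaled by t.\<close>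

definition segment_integral :: "'m::finite \<Rightarrow> nat \<Rightarrow> (complex ^ 'm \<Rightarrow> complex) \<Rightarrow> complex ^ 'm \<Rightarrow> complex" where
  "segment_integral k n f z = integral {0..1} (\<lambda>t. t ^ n *\<^sub>R f (blinfun_apply (coord_scale k t) z))"

lemma continuous_on_segment:
  fixes f :: "complex ^ 'm::finite \<Rightarrow> 'b::real_normed_vector"
  assumes "continuous_on (ball 0 r) f" "z \<in> ball 0 r"
  shows "continuous_on {0..1} (\<lambda>t. f (blinfun_apply (coord_scale k t) z))"
proof (rule continuous_on_compose2[OF assms(1)])
  show "continuous_on {0..1} (\<lambda>t. blinfun_apply (coord_scale k t) z)"
    by (intro continuous_intros continuous_on_coord_scale)
qed (use coord_scale_in_ball assms(2) in blast)

lemma has_derivative_segment_integral: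
  fixes f :: "complex ^ 'm::finite \<Rightarrow> complex"
  assumes f: "smooth_on (ball 0 r) f" and z: "z \<in> ball 0 r"
  shows "(segment_integral k n f has_derivative (\<lambda>v. integral {0..1} (\<lambda>t. t ^ n *\<^sub>R
     fderiv f (blinfun_apply (coord_scale k t) z) (blinfun_apply (coord_scale k t) v)))) (at z)"
proof -
  define Df where "Df = (\<lambda>x. Blinfun (fderiv f x))"
  have app: "blinfun_apply (Df x) = fderiv f x" if "x \<in> ball 0 r" for x
    using smooth_on_has_derivative[OF f that] by (simp add: Df_def bounded_linear_Blinfun_apply has_derivative_bounded_linear)
  have Df: "continuous_on (ball 0 r) Df"
    unfolding Df_def by (rule continuous_on_blinfun_derivative[OF f])
  define fx where "fx = (\<lambda>x t. t ^ n *\<^sub>R (Df (blinfun_apply (coord_scale k t) x) o\<^sub>L coord_scale k t))"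
  have fx_apply: "blinfun_apply (fx x t) v = t ^ n *\<^sub>R
     fderiv f (blinfun_apply (coord_scale k t) x) (blinfun_apply (coord_scale k t) v)"
    if "x \<in> ball 0 r" "t \<in> {0..1}" for x t v
    using app[OF coord_scale_in_ball[OF that(2,1)]] by (simp add: fx_def blinfun.scaleR_left)
  have "((\<lambda>x. integral (cbox 0 1) (\<lambda>t. t ^ n *\<^sub>R f (blinfun_apply (coord_scale k t) x))) has_derivative
     blinfun_apply (integral (cbox 0 1) (fx z))) (at z within ball 0 r)"
  proof (rule leibniz_rule)
    fix x :: "complex ^ 'm" and t :: real assume x: "x \<in> ball 0 r" and t: "t \<in> cbox 0 1"
    have D: "(f has_derivative fderiv f (blinfun_apply (coord_scale k t) x))
      (at (blinfun_apply (coord_scale k t) x))"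
      using coord_scale_in_ball[of t x r k] x t by (intro smooth_on_has_derivative[OF f]) auto
    have "((\<lambda>x. blinfun_apply (coord_scale k t) x) has_derivative blinfun_apply (coord_scale k t)) (at x)"
      by (rule bounded_linear_imp_has_derivative[OF blinfun.bounded_linear_right])
    note Dx = has_derivative_scaleR_right[OF has_derivative_compose[OF this D], of "t ^ n"]
    have fx: "blinfun_apply (fx x t) = (\<lambda>v. t ^ n *\<^sub>R
        fderiv f (blinfun_apply (coord_scale k t) x) (blinfun_apply (coord_scale k t) v))"
      by (rule ext, rule fx_apply) (use x t in auto)
    have "((\<lambda>x. t ^ n *\<^sub>R f (blinfun_apply (coord_scale k t) x)) has_derivative blinfun_apply (fx x t)) (at x)"
      unfolding fx by (rule Dx)
    then show "((\<lambda>x. t ^ n *\<^sub>R f (blinfun_apply (coord_scale k t) x)) has_derivative blinfun_apply (fx x t)) (at x within ball 0 r)"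
      by (rule has_derivative_at_withinI)
  next
    fix x :: "complex ^ 'm" assume x: "x \<in> ball 0 r"
    show "(\<lambda>t. t ^ n *\<^sub>R f (blinfun_apply (coord_scale k t) x)) integrable_on cbox 0 1"
      using continuous_on_segment[OF smooth_on_imp_continuous_on[OF f] x]
      by (intro integrable_continuous continuous_intros) auto
  next
    have cs: "continuous_on (ball 0 r \<times> cbox 0 1) (\<lambda>xt :: (complex ^ 'm) \<times> real. coord_scale k (snd xt))"
      by (rule continuous_on_compose2[OF continuous_on_coord_scale[of UNIV]]) (auto intro: continuous_intros)
    have "continuous_on (ball 0 r \<times> cbox 0 1) (\<lambda>xt. Df (blinfun_apply (coord_scale k (snd xt)) (fst xt)))"
    proof (rule continuous_on_compose2[OF Df])
      show "continuous_on (ball 0 r \<times> cbox 0 1) (\<lambda>xt. blinfun_apply (coord_scale k (snd xt)) (fst xt))"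
        by (intro continuous_intros cs)
    qed (use coord_scale_in_ball[of _ _ r k] in auto)
    then show "continuous_on (ball 0 r \<times> cbox 0 1) (\<lambda>(x, t). fx x t)"
      unfolding fx_def case_prod_unfold by (intro continuous_intros cs)
  qed (use z in auto)
  then have "(segment_integral k n f has_derivative blinfun_apply (integral {0..1} (fx z))) (at z)"
    using z at_within_open[OF z open_ball] by (simp add: segment_integral_def[abs_def])
  moreover have "blinfun_apply (integral {0..1} (fx z)) v = integral {0..1} (\<lambda>t. t ^ n *\<^sub>R
     fderiv f (blinfun_apply (coord_scale k t) z) (blinfun_apply (coord_scale k t) v))" for v
  proof -
    have "continuous_on {0..1} (fx z)"
      unfolding fx_def by (intro continuous_intros continuous_on_coord_scale continuous_on_segment[OF Df z])
    then have "fx z integrable_on {0..1}" by (rule integrable_continuous_real)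
    from integral_linear[OF this blinfun.bounded_linear_left[of v]]
    have "blinfun_apply (integral {0..1} (fx z)) v = integral {0..1} (\<lambda>t. blinfun_apply (fx z t) v)"
      by (simp add: o_def)
    also have "\<dots> = integral {0..1} (\<lambda>t. t ^ n *\<^sub>R
        fderiv f (blinfun_apply (coord_scale k t) z) (blinfun_apply (coord_scale k t) v))"
      by (rule integral_cong) (rule fx_apply[OF z])
    finally show ?thesis .
  qed
  then have "blinfun_apply (integral {0..1} (fx z)) = (\<lambda>v. integral {0..1} (\<lambda>t. t ^ n *\<^sub>R
     fderiv f (blinfun_apply (coord_scale k t) z) (blinfun_apply (coord_scale k t) v)))"
    by (rule ext)
  ultimately show ?thesis by simp
qed

lemma Ck_on_segment_integral:
  fixes f :: "complex ^ 'm::finite \<Rightarrow> complex"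
  assumes "smooth_on (ball 0 r) f"
  shows "Ck_on l (ball 0 r) (segment_integral k n f)"
  using assms
proof (induction l arbitrary: n f)
  case 0
  have "continuous_on (ball 0 r) (segment_integral k n f)"
    using has_derivative_continuous[OF has_derivative_segment_integral[OF 0]] continuous_at_imp_continuous_on by blast
  then show ?case by simp
next
  case (Suc l)
  note f = Suc.prems
  show ?case
  proof (rule Ck_on_Suc_I[OF open_ball has_derivative_segment_integral[OF f]])
    fix v :: "complex ^ 'm"
    \<comment> \<open>The direction of differentiation is u + t w and depends on t. Splitting it
      leaves the fixed directions u and w, the factor t being absorbed into the exponent; hence the
      induction covers all n at once.\<close>
    let ?u = "v - blinfun_apply (coord_proj k) v" and ?w = "blinfun_apply (coord_proj k) v"
    have sm: "smooth_on (ball 0 r) (\<lambda>x. fderiv f x u)" for u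
      by (rule smooth_on_frechet_derivative[OF f])
    have "Ck_on l (ball 0 r) (\<lambda>z. segment_integral k n (\<lambda>x. fderiv f x ?u) z
        + segment_integral k (Suc n) (\<lambda>x. fderiv f x ?w) z)"
      by (intro Ck_on_add open_ball Suc.IH sm)
    then show "Ck_on l (ball 0 r) (\<lambda>z. integral {0..1} (\<lambda>t. t ^ n *\<^sub>R
       fderiv f (blinfun_apply (coord_scale k t) z) (blinfun_apply (coord_scale k t) v)))"
    proof (rule Ck_on_cong[OF open_ball])
      fix z :: "complex ^ 'm" assume z: "z \<in> ball 0 r"
      let ?D = "\<lambda>t. fderiv f (blinfun_apply (coord_scale k t) z)"
      have int: "(\<lambda>t. t ^ j *\<^sub>R ?D t u) integrable_on {0..1}" for j u
        using continuous_on_segment[OF smooth_on_imp_continuous_on[OF sm[of u]] z]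
        by (intro integrable_continuous_real continuous_intros)
      have split: "t ^ n *\<^sub>R ?D t ?u + t ^ Suc n *\<^sub>R ?D t ?w = t ^ n *\<^sub>R ?D t (blinfun_apply (coord_scale k t) v)"
        if t: "t \<in> {0..1}" for t
      proof -
        have lin: "linear (?D t)"
          using has_derivative_linear[OF smooth_on_has_derivative[OF f coord_scale_in_ball[OF t z]]] .
        have "blinfun_apply (coord_scale k t) v = ?u + t *\<^sub>R ?w"
          by (simp add: coord_scale_apply algebra_simps)
        then show ?thesis
          by (simp add: linear_add[OF lin] linear_scale[OF lin] scaleR_add_right mult.commute)
      qed
      have "segment_integral k n (\<lambda>x. fderiv f x ?u) z
        + segment_integral k (Suc n) (\<lambda>x. fderiv f x ?w) z
        = integral {0..1} (\<lambda>t. t ^ n *\<^sub>R ?D t ?u + t ^ Suc n *\<^sub>R ?D t ?w)"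
        unfolding segment_integral_def by (rule integral_add[OF int int, symmetric])
      also have "\<dots> = integral {0..1} (\<lambda>t. t ^ n *\<^sub>R ?D t (blinfun_apply (coord_scale k t) v))"
        by (rule integral_cong[OF split])
      finally show "segment_integral k n (\<lambda>x. fderiv f x ?u) z
        + segment_integral k (Suc n) (\<lambda>x. fderiv f x ?w) z
        = integral {0..1} (\<lambda>t. t ^ n *\<^sub>R ?D t (blinfun_apply (coord_scale k t) v))" .
    qed
  qed
qed

text \<open>The map replaces one coordinate \<open>z\<^sub>k\<close> by the primitive of \<open>f\<close> in the \<open>k\<close>-th variable.\<close>

lemma holomorphic_map_with_jacobian:
  fixes f :: "complex ^ 'm::finite \<Rightarrow> complex"
  assumes f: "smooth_on (ball 0 r) f"
    and holo: "\<And>z v. z \<in> ball 0 r \<Longrightarrow> fderiv f z (\<i> *s v) = \<i> * fderiv f z v"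
  obtains w :: "complex ^ 'm \<Rightarrow> complex ^ 'm" where "smooth_on (ball 0 r) w" "w 0 = 0"
    "\<forall>z\<in>ball 0 r. \<forall>zs. det_form (map (fderiv w z) zs) = f z * det_form zs"
proof -
  \<comment> \<open>Any coordinate serves.\<close>
  define k :: 'm where "k = undefined"
  let ?S = "\<lambda>t. blinfun_apply (coord_scale k t)"
  define I where "I = segment_integral k 0 f"
  define I' where "I' = (\<lambda>z v. integral {0..1} (\<lambda>t. fderiv f (?S t z) (?S t v)))"
  have I': "(I has_derivative I' z) (at z)" if "z \<in> ball 0 r" for z
    using has_derivative_segment_integral[OF f that, of k 0] by (simp add: I_def I'_def)
  define W' where "W' = (\<lambda>z v. z $ k * I' z v + v $ k * I z)"
  define w where "w = (\<lambda>z. \<chi> j. if j = k then z $ k * I z else z $ j)"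
  define w' where "w' = (\<lambda>z v. \<chi> j. if j = k then W' z v else v $ j)"
  have CkI: "Ck_on n (ball 0 r) I" for n unfolding I_def by (rule Ck_on_segment_integral[OF f])
  have nth: "Ck_on n (ball 0 r) (\<lambda>z :: complex ^ 'm. z $ j)" for n j
    by (rule Ck_on_bounded_linear[OF bounded_linear_vec_nth open_ball])
  have "Ck_on n (ball 0 r) (\<lambda>z. if j = k then z $ k * I z else z $ j)" for n j
    by (cases "j = k") (auto intro: Ck_on_mult open_ball CkI nth)
  then have "smooth_on (ball 0 r) w"
    unfolding w_def by (intro smooth_onI Ck_on_vec_lambda open_ball)
  have "(w has_derivative w' z) (at z)" if z: "z \<in> ball 0 r" for z
  proof -
    have "((\<lambda>z. z $ k * I z) has_derivative W' z) (at z)"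
      unfolding W'_def by (rule has_derivative_mult[OF bounded_linear_imp_has_derivative[OF bounded_linear_vec_nth] I'[OF z]])
    then have "((\<lambda>z. if j = k then z $ k * I z else z $ j) has_derivative (\<lambda>v. if j = k then W' z v else v $ j)) (at z)" for j
      by (cases "j = k") (auto intro: bounded_linear_imp_has_derivative[OF bounded_linear_vec_nth])
    then show ?thesis
      unfolding w_def w'_def vec_lambda_sum_axis
      by (intro has_derivative_sum bounded_linear.has_derivative[OF bounded_linear_axis])
  qed
  then have fd: "fderiv w z = w' z" if "z \<in> ball 0 r" for z
    using frechet_derivative_at that by metis
  have lin: "linear (fderiv f z)" if "z \<in> ball 0 r" for z
    using has_derivative_linear[OF smooth_on_has_derivative[OF f that]] .
  have fsmult: "fderiv f z (c *s v) = c * fderiv f z v" if z: "z \<in> ball 0 r" for z c v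
  proof -
    have "fderiv f z (c *s v) = Re c *\<^sub>R fderiv f z v
        + Im c *\<^sub>R (\<i> * fderiv f z v)"
      by (subst smult_eq_scaleR) (simp add: linear_add[OF lin[OF z]] linear_scale[OF lin[OF z]] holo[OF z])
    also have "\<dots> = c * fderiv f z v"
      by (simp add: complex_eq_iff)
    finally show ?thesis .
  qed
  have jac: "det_form (map (w' z) zs) = f z * det_form zs" if z: "z \<in> ball 0 r" for z zs
  proof -
    note inb = coord_scale_in_ball[OF _ z, where k=k]
    have "linear (w' z)" using has_derivative_linear[OF \<open>\<And>z. z \<in> ball 0 r \<Longrightarrow> (w has_derivative w' z) (at z)\<close>[OF z]] .
    moreover have "w' z (\<i> *s v) = \<i> *s w' z v" for v
    proof -
      have "I' z (\<i> *s v) = integral {0..1} (\<lambda>t. \<i> * fderiv f (?S t z) (?S t v))"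
        unfolding I'_def by (rule integral_cong) (simp add: coord_scale_smult holo[OF inb])
      also have "\<dots> = \<i> * I' z v" unfolding I'_def by (rule integral_mult_right)
      finally show ?thesis by (simp add: w'_def W'_def vec_eq_iff algebra_simps)
    qed
    ultimately have M: "w' z v = matrix (w' z) *v v" for v by (rule vec_linear_if_commutes)
    \<comment> \<open>With S t the scaling of the k-th coordinate, integrating the t-derivative of t
      f (S t z) over the unit interval gives f z. Complex linearity of the derivative of f moves the
      factor z $ k out of the direction, and the integrand becomes that of the k-th partial
      derivative of z $ k times I.\<close>
    have "W' z (axis k 1) = f z"
    proof -
      have "((\<lambda>t. t *\<^sub>R f (?S t z)) has_vector_derivative
          t *\<^sub>R fderiv f (?S t z) (axis k (z $ k)) + f (?S t z)) (at t within {0..1})"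
        if t: "t \<in> {0..1}" for t
      proof -
        have D: "(f has_derivative fderiv f (?S t z)) (at (?S t z))"
          by (rule smooth_on_has_derivative[OF f inb[OF t]])
        have "((\<lambda>t. ?S t z) has_derivative (\<lambda>s. s *\<^sub>R axis k (z $ k))) (at t)"
          unfolding coord_scale_apply coord_proj_apply
          by (auto intro!: derivative_eq_intros)
        from has_derivative_compose[OF this D]
        have "((\<lambda>t. f (?S t z)) has_vector_derivative fderiv f (?S t z) (axis k (z $ k))) (at t)"
          by (simp add: has_vector_derivative_def linear_scale[OF lin[OF inb[OF t]]])
        then have "((\<lambda>t. t *\<^sub>R f (?S t z)) has_vector_derivative
            t *\<^sub>R fderiv f (?S t z) (axis k (z $ k)) + 1 *\<^sub>R f (?S t z)) (at t)"
          by (intro has_vector_derivative_scaleR DERIV_ident)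
        then show ?thesis by (simp add: has_vector_derivative_at_within)
      qed
      from fundamental_theorem_of_calculus[OF _ this]
      have "integral {0..1} (\<lambda>t. t *\<^sub>R fderiv f (?S t z) (axis k (z $ k)) + f (?S t z))
          = 1 *\<^sub>R f (?S 1 z) - 0 *\<^sub>R f (?S 0 z)"
        by (intro integral_unique) simp
      also have "?S 1 z = z" by (simp add: coord_scale_apply)
      finally have FTC: "integral {0..1} (\<lambda>t. t *\<^sub>R fderiv f (?S t z) (axis k (z $ k)) + f (?S t z)) = f z"
        by simp
      have cont: "continuous_on {0..1} (\<lambda>t. f (?S t z))" "continuous_on {0..1} (\<lambda>t. fderiv f (?S t z) v)" for v
        by (rule continuous_on_segment[OF smooth_on_imp_continuous_on z];
            intro f smooth_on_frechet_derivative)+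
      have axis: "axis k (z $ k) = z $ k *s axis k 1" "?S t (axis k 1) = t *\<^sub>R axis k 1" for t
        by (simp_all add: vec_eq_iff axis_def coord_scale_nth)
      have "z $ k * I' z (axis k 1) = integral {0..1} (\<lambda>t. z $ k * fderiv f (?S t z) (?S t (axis k 1)))"
        unfolding I'_def by (rule integral_mult_right[symmetric])
      also have "\<dots> = integral {0..1} (\<lambda>t. t *\<^sub>R fderiv f (?S t z) (axis k (z $ k)))"
        by (rule integral_cong) (simp add: axis fsmult[OF inb] linear_scale[OF lin[OF inb]])
      finally have "W' z (axis k 1) = integral {0..1} (\<lambda>t. t *\<^sub>R fderiv f (?S t z) (axis k (z $ k)))
          + integral {0..1} (\<lambda>t. f (?S t z))"
        by (simp add: W'_def I_def segment_integral_def)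
      also have "\<dots> = f z"
        unfolding FTC[symmetric]
        by (intro integral_add[symmetric] integrable_continuous_real continuous_intros cont)
      finally show ?thesis .
    qed
    have "det (matrix (w' z)) = f z"
    proof -
      \<comment> \<open>The Jacobian matrix is the identity with row k replaced by the gradient x of
        the new coordinate, so its determinant is the k-th entry of x.\<close>
      define x where "x = (\<chi> j. W' z (axis j 1))"
      have rows: "row i (mat 1 :: complex ^ 'm ^ 'm) = axis i 1" for i
        by (auto simp: row_def mat_def axis_def vec_eq_iff)
      have "(\<Sum>i\<in>UNIV. x $ i *s axis i 1) = x"
        by (simp add: vec_eq_iff axis_def if_distrib[of "\<lambda>y. _ * y"] cong: if_cong)
      then have "matrix (w' z) = (\<chi> i. if i = k then (\<Sum>i\<in>UNIV. x $ i *s row i (mat 1)) else row i (mat 1))"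
        unfolding rows by (auto simp: vec_eq_iff matrix_def w'_def x_def axis_def)
      then have "det (matrix (w' z)) = x $ k"
        using cramer_lemma_transpose[of k x "mat 1"] by simp
      then show ?thesis using \<open>W' z (axis k 1) = f z\<close> by (simp add: x_def)
    qed
    moreover have "(*v) (matrix (w' z)) = w' z" using M by (simp add: fun_eq_iff)
    ultimately show ?thesis using det_form_map_matrix[of "matrix (w' z)" zs] by simp
  qed
  show thesis
  proof (rule that[OF \<open>smooth_on (ball 0 r) w\<close>])
    show "w 0 = 0" by (simp add: w_def vec_eq_iff)
  qed (use jac fd in auto)
qed

section \<open>Flatness and integrability\<close>

text \<open>The atlas consists of all charts in V whose derivative carries J to multiplication by i.
  A transition between two of them goes from i to J and back to i, so its derivative is complex
  linear.\<close>

lemma integrable_acsI: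
  fixes V :: "(real ^ 'm::finite bit0) set"
  assumes charts: "\<And>p. p \<in> V \<Longrightarrow> \<exists>W (\<phi> :: real ^ 'm bit0 \<Rightarrow> complex ^ 'm). p \<in> W \<and> W \<subseteq> V \<and> chart_on W \<phi> \<and>
    (\<forall>q\<in>W. \<forall>v. fderiv \<phi> q (blinfun_apply (J q) v) = \<i> *s fderiv \<phi> q v)"
  shows "integrable_acs V J"
proof -
  define \<A> where "\<A> = {(W, \<phi> :: real ^ 'm bit0 \<Rightarrow> complex ^ 'm). W \<subseteq> V \<and> chart_on W \<phi> \<and>
    (\<forall>q\<in>W. \<forall>v. fderiv \<phi> q (blinfun_apply (J q) v) = \<i> *s fderiv \<phi> q v)}"
  have "holomorphic_map_on (\<phi> ` (W \<inter> X)) (\<psi> \<circ> inv_into W \<phi>)" if \<phi>: "(W, \<phi>) \<in> \<A>" and \<psi>: "(X, \<psi>) \<in> \<A>" for W \<phi> X \<psi>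
    unfolding holomorphic_map_on_def
  proof
    fix z assume "z \<in> \<phi> ` (W \<inter> X)"
    then obtain q where q: "q \<in> W" "q \<in> X" "z = \<phi> q" by blast
    have ch: "chart_on W \<phi>" "chart_on X \<psi>" using \<phi> \<psi> by (auto simp: \<A>_def)
    obtain D' where D': "(inv_into W \<phi> has_derivative D') (at (\<phi> q))"
      "\<And>w. fderiv \<phi> q (D' w) = w" "\<And>v. D' (fderiv \<phi> q v) = v"
      using chart_derivative[OF ch(1) q(1)] by metis
    have inv: "inv_into W \<phi> z = q" using ch(1) q by (simp add: chart_on_def)
    have "(\<psi> has_derivative fderiv \<psi> q) (at (inv_into W \<phi> z))"
      unfolding inv using ch(2) q(2) by (auto simp: chart_on_def intro: smooth_on_has_derivative)
    then have "((\<psi> \<circ> inv_into W \<phi>) has_derivative (\<lambda>v. fderiv \<psi> q (D' v))) (at z)"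
      unfolding o_def using has_derivative_compose[OF D'(1)[folded q(3)]] by blast
    moreover have "fderiv \<psi> q (D' (\<i> *s v)) = \<i> *s fderiv \<psi> q (D' v)" for v
    proof -
      have "\<i> *s v = fderiv \<phi> q (blinfun_apply (J q) (D' v))"
        using \<phi> q(1) D'(2) by (simp add: \<A>_def)
      then have "D' (\<i> *s v) = blinfun_apply (J q) (D' v)" using D'(3) by metis
      then show ?thesis using \<psi> q(2) by (simp add: \<A>_def)
    qed
    ultimately show "\<exists>D. ((\<psi> \<circ> inv_into W \<phi>) has_derivative D) (at z) \<and> (\<forall>v. D (\<i> *s v) = \<i> *s D v)"
      by blast
  qed
  moreover have "(\<Union>(W, \<phi>)\<in>\<A>. W) = V"
  proof
    show "V \<subseteq> (\<Union>(W, \<phi>)\<in>\<A>. W)"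
    proof
      fix p assume "p \<in> V"
      from charts[OF this] obtain W \<phi> where "p \<in> W" "(W, \<phi>) \<in> \<A>" unfolding \<A>_def by blast
      then show "p \<in> (\<Union>(W, \<phi>)\<in>\<A>. W)" by blast
    qed
  qed (auto simp: \<A>_def)
  moreover have "\<forall>(W, \<phi>)\<in>\<A>. chart_on W \<phi>" by (auto simp: \<A>_def)
  ultimately have "complex_atlas V \<A>" unfolding complex_atlas_def by blast
  then show ?thesis unfolding integrable_acs_def by (intro exI[of _ \<A>]) (auto simp: \<A>_def)
qed

text \<open>If the real part happens to vanish, multiplying the second argument by i brings the
  imaginary part into its place.\<close>

lemma Re_det_form_nondegenerate:
  fixes x :: "complex ^ 'm::finite"
  assumes "CARD('m) \<ge> 2" "x \<noteq> 0" "c \<noteq> 0"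
  obtains us where "length us = CARD('m) - 1" "Re (c * det_form (x # us)) \<noteq> 0"
proof -
  obtain us where us: "length us = CARD('m) - 1" "det_form (x # us) \<noteq> 0"
    using det_form_nondegenerate_head assms by metis
  obtain u us' where us': "us = u # us'" using us(1) assms(1) by (cases us) auto
  show thesis
  proof (cases "Re (c * det_form (x # us)) = 0")
    case True
    then have im: "Im (c * det_form (x # us)) \<noteq> 0" using us(2) assms(3) by (metis complex_eq_0 complex_eq_iff mult_eq_0_iff zero_complex.sel)
    have "c * det_form (x # \<i> *s u # us') = \<i> * (c * det_form (x # us))"
      by (simp add: us' det_form_scale_second)
    then have "Re (c * det_form (x # \<i> *s u # us')) \<noteq> 0"
      using im by (metis Re_i_times neg_equal_0_iff_equal)
    then show thesis using us(1) by (intro that) (auto simp: us')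
  qed (use that us in blast)
qed

lemma smooth_on_derivative_apply_list:
  fixes \<phi> :: "'a::euclidean_space \<Rightarrow> complex ^ 'm::finite"
  assumes V: "open V" and \<phi>: "smooth_on V \<phi>"
  shows "smooth_on V (\<lambda>q. det_form (map (fderiv \<phi> q) vs))"
proof (cases "length vs = CARD('m)")
  case True
  show ?thesis
  proof (rule smooth_onI)
    fix k
    have "Ck_on k V (\<lambda>q. det_form (map (\<lambda>f. f q) (map (\<lambda>v q. fderiv \<phi> q v) vs)))"
      using True multilinear_det_form[where 'm='m] smooth_onD[OF smooth_on_frechet_derivative[OF \<phi>]]
      by (intro Ck_on_multilinear[where M="\<lambda>q. det_form"] V Ck_on_const) auto
    then show "Ck_on k V (\<lambda>q. det_form (map (fderiv \<phi> q) vs))"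
      by (simp add: o_def)
  qed
qed (simp add: det_form_def smooth_onI Ck_on_const V)

section \<open>From flat charts to complex charts and back\<close>

context complex_volume_form begin

lemma frame_for:
  assumes "p \<in> U" "adapted_at (\<omega> p) A"
  obtains \<Psi> :: "real ^ 'n \<Rightarrow> complex ^ 'm"
  where "complex_frame (\<omega> p) \<Psi>" "\<And>v. \<Psi> (blinfun_apply A v) = \<i> *s \<Psi> v"
proof -
  obtain \<Psi> :: "real ^ 'n \<Rightarrow> complex ^ 'm" where \<Psi>: "complex_frame (\<omega> p) \<Psi>"
    using frames[OF assms(1)] by blast
  from assms(2)[unfolded adapted_at_frame_iff[OF card \<Psi>]] show thesis
  proof
    assume neg: "\<forall>v. \<Psi> (blinfun_apply A v) = - (\<i> *s \<Psi> v)"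
    show thesis
    proof (rule that[OF complex_frame_vcnj[OF \<Psi>]])
      show "vcnj (\<Psi> (blinfun_apply A v)) = \<i> *s vcnj (\<Psi> v)" for v
        using neg by (simp add: vcnj_def vec_eq_iff)
    qed
  qed (use that \<Psi> in blast)
qed

text \<open>The complex chart is a flat chart \<phi> followed by a frame \<Psi> at p. As \<phi>
  pulls \<omega> p back to \<omega> q, the composite of \<Psi> with the derivative of \<phi> at q is
  a frame at q, in which J q is multiplication by i or by -i. The sign is made right at p by
  conjugating \<Psi> if necessary, and it persists near p by continuity, tested on the single vector
  v0.\<close>

lemma flat_imp_holomorphic_chart:
  assumes flat: "flat_form U \<omega>" and V: "open V" "V \<subseteq> U" and J: "adapted_acs V \<omega> J" and p: "p \<in> V"
  obtains W and \<xi> :: "real ^ 'n \<Rightarrow> complex ^ 'm" where "p \<in> W" "W \<subseteq> V" "chart_on W \<xi>"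
    "\<And>q v. q \<in> W \<Longrightarrow> fderiv \<xi> q (blinfun_apply (J q) v) = \<i> *s fderiv \<xi> q v"
proof -
  have pU: "p \<in> U" using p V(2) by blast
  obtain W0 \<phi> where \<phi>: "p \<in> W0" "W0 \<subseteq> U" "chart_on W0 \<phi>"
    "\<forall>q\<in>W0. pullback (fderiv \<phi> q) (\<omega> p) = \<omega> q"
    using bspec[OF flat[unfolded flat_form_def] pU] by blast
  have W0: "open W0" "smooth_on W0 \<phi>" using \<phi>(3) by (auto simp: chart_on_def)
  define D where "D = (\<lambda>q. fderiv \<phi> q)"
  have D: "linear (D q)" "bij (D q)" if "q \<in> W0" for q
    unfolding D_def by (rule chart_derivative_linear_bij[OF \<phi>(3) that])+
  have Jat: "adapted_at (\<omega> q) (J q)" if "q \<in> V" for q using J that by (simp add: adapted_acs_iff)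
  have frame: "complex_frame (\<omega> q) (\<lambda>v. \<Psi> (D q v))" if "complex_frame (\<omega> p) \<Psi>" "q \<in> W0"
    for q and \<Psi> :: "real ^ 'n \<Rightarrow> complex ^ 'm"
  proof -
    have "linear (\<Psi> \<circ> D q)" "bij (\<Psi> \<circ> D q)"
      using D[OF that(2)] complex_frameD(1,2)[OF that(1)] linear_compose bij_comp by blast+
    moreover have "\<omega> q vs = Re (det_form (map (\<lambda>v. \<Psi> (D q v)) vs))" for vs
      using fun_cong[OF bspec[OF \<phi>(4) that(2)], of vs] complex_frameD(3)[OF that(1)]
      by (simp add: pullback_def D_def o_def)
    ultimately show ?thesis by (simp add: complex_frame_def pullback_def fun_eq_iff o_def)
  qed
  obtain \<Psi>0 :: "real ^ 'n \<Rightarrow> complex ^ 'm" where \<Psi>0: "complex_frame (\<omega> p) \<Psi>0"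
    using frames[OF pU] by blast
  obtain \<Psi> :: "real ^ 'n \<Rightarrow> complex ^ 'm" where \<Psi>: "complex_frame (\<omega> p) \<Psi>"
    "\<And>v. \<Psi> (D p (blinfun_apply (J p) v)) = \<i> *s \<Psi> (D p v)"
  proof -
    from Jat[OF p, unfolded adapted_at_frame_iff[OF card frame[OF \<Psi>0 \<phi>(1)]]] show thesis
    proof
      assume neg: "\<forall>v. \<Psi>0 (D p (blinfun_apply (J p) v)) = - (\<i> *s \<Psi>0 (D p v))"
      show thesis
      proof (rule that[OF complex_frame_vcnj[OF \<Psi>0]])
        show "vcnj (\<Psi>0 (D p (blinfun_apply (J p) v))) = \<i> *s vcnj (\<Psi>0 (D p v))" for v
          using neg by (simp add: vcnj_def vec_eq_iff)
      qed
    qed (use that \<Psi>0 in blast)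
  qed
  note \<Psi>D = complex_frameD(1,2)[OF \<Psi>(1)]
  note bl = bounded_linear_euclidean[OF \<Psi>D(1)]
  define v0 :: "real ^ 'n" where "v0 = axis undefined 1"
  have "v0 \<noteq> 0" by (simp add: v0_def axis_eq_0_iff)
  have nz: "\<i> *s \<Psi> (D q v0) \<noteq> 0" if "q \<in> W0" for q
  proof -
    have "inj (\<lambda>v. \<Psi> (D q v))" "linear (\<lambda>v. \<Psi> (D q v))"
      using complex_frameD(1,2)[OF frame[OF \<Psi>(1) that]] by (auto simp: bij_is_inj)
    then have "\<Psi> (D q v0) \<noteq> 0" using \<open>v0 \<noteq> 0\<close> by (metis linear_injective_0)
    then show ?thesis by simp
  qed
  have sgn: "(\<forall>v. \<Psi> (D q (blinfun_apply (J q) v)) = \<i> *s \<Psi> (D q v)) \<or>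
     (\<forall>v. \<Psi> (D q (blinfun_apply (J q) v)) = - (\<i> *s \<Psi> (D q v)))" if "q \<in> V \<inter> W0" for q
    using Jat[of q] adapted_at_frame_iff[OF card frame[OF \<Psi>(1)]] that by blast
  have cont: "continuous_on (V \<inter> W0) (\<lambda>q. \<Psi> (D q (f q)))" if "continuous_on (V \<inter> W0) f" for f
  proof -
    have "Ck_on 0 (V \<inter> W0) (\<lambda>q. D q (f q))"
      unfolding D_def using V(1) W0 that by (intro Ck_on_derivative_apply) (auto intro: smooth_on_subset)
    then show ?thesis using bounded_linear.continuous_on[OF bl] by simp
  qed
  have contJ: "continuous_on (V \<inter> W0) (\<lambda>q. blinfun_apply (J q) v0)"
    using J by (intro continuous_intros continuous_on_subset[OF smooth_on_imp_continuous_on[of V J]]) (auto simp: adapted_acs_iff)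
  have conti: "continuous_on (V \<inter> W0) (\<lambda>q. \<i> *s \<Psi> (D q v0))"
  proof -
    have "bounded_linear (\<lambda>z :: complex ^ 'm. \<i> *s z)"
      by (intro bounded_linear_euclidean linearI) (simp_all add: vec_eq_iff algebra_simps)
    from bounded_linear.continuous_on[OF this cont[OF continuous_on_const]] show ?thesis .
  qed
  obtain W where W: "open W" "p \<in> W" "W \<subseteq> V \<inter> W0"
    "\<And>q. q \<in> W \<Longrightarrow> \<Psi> (D q (blinfun_apply (J q) v0)) = \<i> *s \<Psi> (D q v0)"
  proof (rule eq_near_if_eq_up_to_sign[of "V \<inter> W0" p "\<lambda>q. \<Psi> (D q (blinfun_apply (J q) v0))" "\<lambda>q. \<i> *s \<Psi> (D q v0)"])
    show "\<Psi> (D q (blinfun_apply (J q) v0)) = \<i> *s \<Psi> (D q v0) \<or>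
      \<Psi> (D q (blinfun_apply (J q) v0)) = - (\<i> *s \<Psi> (D q v0))" if "q \<in> V \<inter> W0" for q
      using sgn[OF that] by blast
    show "\<i> *s \<Psi> (D p v0) \<noteq> 0" by (rule nz[OF \<phi>(1)])
  qed (use V(1) W0(1) p \<phi>(1) cont[OF contJ] conti \<Psi>(2) in \<open>auto intro: that\<close>)
  have hol: "\<Psi> (D q (blinfun_apply (J q) v)) = \<i> *s \<Psi> (D q v)" if q: "q \<in> W" for q v
  proof -
    have "\<not> (\<forall>v. \<Psi> (D q (blinfun_apply (J q) v)) = - (\<i> *s \<Psi> (D q v)))"
    proof
      assume "\<forall>v. \<Psi> (D q (blinfun_apply (J q) v)) = - (\<i> *s \<Psi> (D q v))"
      then have "\<i> *s \<Psi> (D q v0) = - (\<i> *s \<Psi> (D q v0))" using W(4)[OF q] by simp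
      then have "2 *\<^sub>R (\<i> *s \<Psi> (D q v0)) = 0" by (metis scaleR_2 ab_left_minus add.commute)
      then show False using nz[of q] q W(3) by auto
    qed
    then show ?thesis using sgn[of q] q W(3) by blast
  qed
  show thesis
  proof (rule that[OF W(2)])
    show "W \<subseteq> V" using W(3) by blast
    show "chart_on W (\<lambda>x. \<Psi> (\<phi> x))"
      using W(3) by (intro chart_on_linear_compose[OF chart_on_subset[OF \<phi>(3) W(1)] \<Psi>D]) blast
    fix q v assume q: "q \<in> W"
    have "fderiv (\<lambda>x. \<Psi> (\<phi> x)) q v = \<Psi> (D q v)" for v
      unfolding D_def using smooth_on_has_derivative[OF W0(2), of q] q W(3)
      by (intro frechet_derivative_bounded_linear_compose[OF bl]) (auto simp: differentiable_def)
    then show "fderiv (\<lambda>x. \<Psi> (\<phi> x)) q (blinfun_apply (J q) v)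
       = \<i> *s fderiv (\<lambda>x. \<Psi> (\<phi> x)) q v"
      by (simp add: hol[OF q])
  qed
qed

text \<open>At q, both the derivative of \<phi> and a suitable frame carry J q to multiplication by
  i, so they differ by a complex matrix, and F q is its determinant. This gives F pointwise; its
  smoothness is obtained separately, by dividing two smooth functions.\<close>

lemma complex_density:
  fixes \<phi> :: "real ^ 'n \<Rightarrow> complex ^ 'm"
  assumes V: "V \<subseteq> U" and J: "adapted_acs V \<omega> J" and \<phi>: "chart_on V \<phi>" and p: "p \<in> V"
    and hol: "\<And>q v. q \<in> V \<Longrightarrow> fderiv \<phi> q (blinfun_apply (J q) v) = \<i> *s fderiv \<phi> q v"
  obtains X F where "open X" "p \<in> X" "X \<subseteq> V" "smooth_on X F"
    "\<And>q vs. q \<in> X \<Longrightarrow> \<omega> q vs = Re (F q * det_form (map (fderiv \<phi> q) vs))"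
proof -
  have oV: "open V" and sm: "smooth_on V \<phi>" using \<phi> by (auto simp: chart_on_def)
  define D where "D = (\<lambda>q. fderiv \<phi> q)"
  have lin: "linear (D q)" and bij: "bij (D q)" if "q \<in> V" for q
    unfolding D_def by (rule chart_derivative_linear_bij[OF \<phi> that])+
  have "\<exists>c. \<forall>vs. \<omega> q vs = Re (c * det_form (map (D q) vs))" if q: "q \<in> V" for q
  proof -
    have "q \<in> U" "adapted_at (\<omega> q) (J q)" using q V J by (auto simp: adapted_acs_iff)
    from frame_for[OF this] obtain \<Psi> :: "real ^ 'n \<Rightarrow> complex ^ 'm"
      where \<Psi>: "complex_frame (\<omega> q) \<Psi>" "\<And>v. \<Psi> (blinfun_apply (J q) v) = \<i> *s \<Psi> v" by metis
    define g where "g = (\<lambda>z. \<Psi> (inv (D q) z))"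
    have g: "linear g"
      using linear_compose[OF linear_inv_of_bij[OF lin[OF q] bij[OF q]] complex_frameD(1)[OF \<Psi>(1)]]
      by (simp add: g_def o_def)
    have gD: "g (D q v) = \<Psi> v" for v using bij[OF q] by (simp add: g_def bij_is_inj)
    have "g (\<i> *s z) = \<i> *s g z" for z
    proof -
      obtain v where v: "z = D q v" using bij[OF q] by (metis bij_pointE)
      have "g (\<i> *s z) = g (D q (blinfun_apply (J q) v))" using hol[OF q, of v] by (simp add: v D_def)
      then show ?thesis by (simp add: gD \<Psi>(2) v)
    qed
    note gA = vec_linear_if_commutes[OF g this]
    have maps: "map ((*v) (matrix g)) (map (D q) vs) = map \<Psi> vs" for vs
      by (simp add: o_def gA[symmetric] gD)
    have "\<omega> q vs = Re (det (matrix g) * det_form (map (D q) vs))" for vs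
      using det_form_map_matrix[of "matrix g" "map (D q) vs"] complex_frameD(3)[OF \<Psi>(1), of vs]
      unfolding maps by simp
    then show ?thesis by blast
  qed
  then obtain F where F: "\<And>q vs. q \<in> V \<Longrightarrow> \<omega> q vs = Re (F q * det_form (map (D q) vs))" by metis
  obtain z :: "complex ^ 'm" where "z \<noteq> 0" using axis_eq_0_iff[of undefined "1 :: complex"] by (metis one_neq_zero)
  then obtain zs where zs: "det_form (z # zs) \<noteq> 0" using det_form_nondegenerate_head card by (metis less_imp_le)
  define e es where "e = inv (D p) z" and "es = map (inv (D p)) zs"
  have len: "Suc (length es) = CARD('m)" using zs by (auto simp: es_def det_form_def split: if_splits)
  define \<theta> where "\<theta> = (\<lambda>q. det_form (map (D q) (e # es)))"
  have \<theta>: "smooth_on V \<theta>"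
    unfolding \<theta>_def D_def by (rule smooth_on_derivative_apply_list[OF oV sm])
  have "map (D p) (e # es) = z # zs"
    using bij[OF p] by (simp add: e_def es_def o_def surj_f_inv_f bij_is_surj)
  then have "\<theta> p \<noteq> 0" using zs by (simp add: \<theta>_def)
  define X where "X = V \<inter> \<theta> -` (- {0})"
  have X: "open X" "p \<in> X" "X \<subseteq> V"
    unfolding X_def using continuous_open_preimage[OF smooth_on_imp_continuous_on[OF \<theta>] oV, of "- {0}"] p \<open>\<theta> p \<noteq> 0\<close> by auto
  \<comment> \<open>J e in the first slot multiplies the complex form by i, so the second value of
    \<omega> is minus the imaginary part of F \<theta>. Thus N equals F \<theta>, while it is built
    from \<omega> and J alone.\<close>
  define N where "N = (\<lambda>q. of_real (\<omega> q (e # es)) - \<i> * of_real (\<omega> q (blinfun_apply (J q) e # es)))"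
  have NC: "Ck_on k V N" for k
  proof -
    have \<omega>C: "Ck_on k V (\<lambda>q. \<omega> q vs)" for vs
    proof (rule Ck_on_subset[OF smooth_onD V])
      show "smooth_on U (\<lambda>q. \<omega> q vs)" using smooth_\<omega> by (simp add: smooth_form_def)
    qed
    have ml: "multilinear_form CARD('m) (\<omega> q)" if "q \<in> V" for q
      using smooth_\<omega> V that by (auto simp: smooth_form_def intro: alternating_form_multilinear)
    have "Ck_on k V (\<lambda>q. \<omega> q (map (\<lambda>f. f q) ((\<lambda>q. blinfun_apply (J q) e) # map (\<lambda>v q. v) es)))"
    proof (rule Ck_on_multilinear[OF oV _ \<omega>C])
      show "multilinear_form (length ((\<lambda>q. blinfun_apply (J q) e) # map (\<lambda>v q. v) es)) (\<omega> q)" if "q \<in> V" for q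
        using ml[OF that] len by simp
      have "Ck_on k V J" using J by (simp add: adapted_acs_iff smooth_on_def)
      then show "Ck_on k V f" if "f \<in> set ((\<lambda>q. blinfun_apply (J q) e) # map (\<lambda>v q. v) es)" for f
        using that oV by (auto intro: Ck_on_const Ck_on_blinfun_apply)
    qed
    then have "Ck_on k V (\<lambda>q. \<omega> q (blinfun_apply (J q) e # es))" by (simp add: o_def)
    then show ?thesis
      unfolding N_def using \<omega>C
      by (intro Ck_on_diff Ck_on_mult Ck_on_const oV Ck_on_bounded_linear_compose[OF bounded_linear_of_real])
  qed
  have NF: "N q = F q * \<theta> q" if q: "q \<in> V" for q
  proof -
    have "\<omega> q (e # es) = Re (F q * \<theta> q)" by (simp add: F[OF q] \<theta>_def)
    moreover have "\<omega> q (blinfun_apply (J q) e # es) = Re (\<i> * (F q * \<theta> q))"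
      using hol[OF q, of e] by (simp add: F[OF q] \<theta>_def D_def det_form_scale_head mult.left_commute)
    ultimately show ?thesis by (simp add: N_def complex_eq_iff)
  qed
  have "smooth_on X (\<lambda>q. N q / \<theta> q)"
    using NC \<theta> X by (intro smooth_onI Ck_on_divide) (auto simp: smooth_on_def X_def intro: Ck_on_subset)
  then have "smooth_on X F"
    by (rule smooth_on_cong[OF X(1)]) (use NF X(3) in \<open>auto simp: X_def\<close>)
  then show thesis
  proof (rule that[OF X])
    show "\<omega> q vs = Re (F q * det_form (map (fderiv \<phi> q) vs))" if "q \<in> X" for q vs
      using F[of q vs] that X(3) by (auto simp: D_def)
  qed
qed

text \<open>The real and imaginary parts of the pulled-back determinant form \<theta> are closed, so
  closedness of \<omega> says that the wedge of dF with \<theta> has real part 0. On the arguments J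
  u, u, us, deleting any entry of us leaves two vectors on one complex line, and only the first two
  terms survive. They combine to dF (J u) - i dF u times \<theta> (u, us), and varying us forces
  this factor to be 0.\<close>

lemma density_holomorphic:
  fixes \<phi> :: "real ^ 'n \<Rightarrow> complex ^ 'm"
  assumes closed: "closed_form U \<omega>" and X: "open X" "X \<subseteq> U" and \<phi>: "chart_on X \<phi>" and F: "smooth_on X F"
    and \<omega>F: "\<And>q vs. q \<in> X \<Longrightarrow> \<omega> q vs = Re (F q * det_form (map (fderiv \<phi> q) vs))"
    and hol: "\<And>q v. q \<in> X \<Longrightarrow> fderiv \<phi> q (blinfun_apply (J q) v) = \<i> *s fderiv \<phi> q v"
    and q: "q \<in> X"
  shows "fderiv F q (blinfun_apply (J q) u) = \<i> * fderiv F q u"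
proof (rule ccontr)
  assume neq: "\<not> ?thesis"
  define D where "D = (\<lambda>q. fderiv \<phi> q)"
  define F' where "F' = fderiv F q"
  have sm: "smooth_on X \<phi>" using \<phi> by (auto simp: chart_on_def)
  have lin: "linear (D q)" and bij: "bij (D q)"
    unfolding D_def by (rule chart_derivative_linear_bij[OF \<phi> q])+
  have FD: "(F has_derivative F') (at q)" unfolding F'_def by (rule smooth_on_has_derivative[OF F q])
  define \<alpha> \<beta> where "\<alpha> = (\<lambda>q. pullback (D q) (\<lambda>zs. Re (det_form zs)))"
    and "\<beta> = (\<lambda>q. pullback (D q) (\<lambda>zs. Im (det_form zs)))"
  have diff\<theta>: "(\<lambda>q. det_form (map (D q) vs)) differentiable at q" for vs
    using smooth_on_has_derivative[OF smooth_on_derivative_apply_list[OF X(1) sm] q]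
    unfolding D_def differentiable_def by blast
  have d\<alpha>: "(\<lambda>q. \<alpha> q vs) differentiable at q" and d\<beta>: "(\<lambda>q. \<beta> q vs) differentiable at q" for vs
    using diff\<theta>[of vs] bounded_linear.has_derivative[OF bounded_linear_Re] bounded_linear.has_derivative[OF bounded_linear_Im]
    unfolding \<alpha>_def \<beta>_def pullback_def differentiable_def by blast+
  have FRI: "((\<lambda>q. Re (F q)) has_derivative (\<lambda>v. Re (F' v))) (at q)" "((\<lambda>q. Im (F q)) has_derivative (\<lambda>v. Im (F' v))) (at q)"
    using bounded_linear.has_derivative[OF bounded_linear_Re FD] bounded_linear.has_derivative[OF bounded_linear_Im FD] by auto
  have dF: "(\<lambda>q. Re (F q)) differentiable at q" "(\<lambda>q. Im (F q)) differentiable at q"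
    using FRI by (auto simp: differentiable_def)
  have closed\<alpha>: "ext_deriv \<alpha> q vs = 0" "ext_deriv \<beta> q vs = 0" for vs
    unfolding \<alpha>_def \<beta>_def D_def
    by (rule ext_deriv_pullback_const[OF X(1) q sm alternating_Re_det_form]
        ext_deriv_pullback_const[OF X(1) q sm alternating_Im_det_form])+
  have sum0: "Re (\<Sum>i<length vs. (- 1) ^ i * F' (vs ! i) * det_form (map (D q) (delete_nth i vs))) = 0" for vs
  proof -
    have "0 = ext_deriv \<omega> q vs" using closed q X(2) by (auto simp: closed_form_def)
    also have "\<dots> = ext_deriv (\<lambda>q vs. Re (F q) * \<alpha> q vs - Im (F q) * \<beta> q vs) q vs"
      by (rule ext_deriv_cong_open[OF X(1) q]) (simp add: \<omega>F \<alpha>_def \<beta>_def D_def pullback_def)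
    also have "\<dots> = ext_deriv (\<lambda>q vs. Re (F q) * \<alpha> q vs) q vs - ext_deriv (\<lambda>q vs. Im (F q) * \<beta> q vs) q vs"
      by (intro ext_deriv_diff differentiable_mult dF d\<alpha> d\<beta>)
    also have "\<dots> = (\<Sum>i<length vs. (- 1) ^ i * Re (F' (vs ! i)) * \<alpha> q (delete_nth i vs))
        - (\<Sum>i<length vs. (- 1) ^ i * Im (F' (vs ! i)) * \<beta> q (delete_nth i vs))"
      unfolding ext_deriv_scale[OF dF(1) d\<alpha>] ext_deriv_scale[OF dF(2) d\<beta>]
      by (simp add: closed\<alpha> frechet_derivative_at[OF FRI(1), symmetric] frechet_derivative_at[OF FRI(2), symmetric])
    also have "\<dots> = Re (\<Sum>i<length vs. (- 1) ^ i * F' (vs ! i) * det_form (map (D q) (delete_nth i vs)))"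
    proof -
      have "Re ((- 1) ^ i * z) = (- 1) ^ i * Re z" for i z by (cases "even i") auto
      then show ?thesis
        by (simp add: \<alpha>_def \<beta>_def pullback_def sum_subtractf right_diff_distrib mult.assoc)
    qed
    finally show ?thesis by simp
  qed
  have main: "Re ((F' (blinfun_apply (J q) u) - \<i> * F' u) * det_form (D q u # map (D q) us)) = 0" for us
  proof -
    let ?vs = "blinfun_apply (J q) u # u # us"
    have DJ: "D q (blinfun_apply (J q) u) = \<i> *s D q u" using hol[OF q] by (simp add: D_def)
    have "det_form (map (D q) (delete_nth (Suc (Suc i)) ?vs)) = 0" for i
    proof -
      have "det_form (\<i> *s D q u # D q u # zs) = 0" for zs
        using det_form_eq_0[of 0 1 "D q u # D q u # zs"] by (simp add: det_form_scale_head)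
      then show ?thesis by (simp add: delete_nth_def DJ)
    qed
    then have "(\<Sum>i<length ?vs. (- 1) ^ i * F' (?vs ! i) * det_form (map (D q) (delete_nth i ?vs)))
       = F' (blinfun_apply (J q) u) * det_form (D q u # map (D q) us) - F' u * det_form (\<i> *s D q u # map (D q) us)"
      by (simp add: sum.lessThan_Suc_shift delete_nth_def DJ del: sum.lessThan_Suc)
    also have "\<dots> = (F' (blinfun_apply (J q) u) - \<i> * F' u) * det_form (D q u # map (D q) us)"
      by (simp add: det_form_scale_head algebra_simps)
    finally show ?thesis using sum0[of ?vs] by simp
  qed
  have "u \<noteq> 0"
    using neq linear_0[OF has_derivative_linear[OF FD]] by (auto simp: F'_def)
  then have "D q u \<noteq> 0" using bij lin by (metis bij_is_inj linear_injective_0)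
  then obtain zs where zs: "Re ((F' (blinfun_apply (J q) u) - \<i> * F' u) * det_form (D q u # zs)) \<noteq> 0"
    using Re_det_form_nondegenerate[of "D q u" "F' (blinfun_apply (J q) u) - \<i> * F' u"] card neq
    by (auto simp: F'_def)
  have "map (D q) (map (inv (D q)) zs) = zs" using bij by (simp add: o_def surj_f_inv_f bij_is_surj)
  then show False using main[of "map (inv (D q)) zs"] zs by metis
qed

lemma integrable_imp_flat_chart:
  fixes \<phi> :: "real ^ 'n \<Rightarrow> complex ^ 'm"
  assumes closed: "closed_form U \<omega>" and V: "V \<subseteq> U" and J: "adapted_acs V \<omega> J" and \<phi>: "chart_on V \<phi>" and p: "p \<in> V"
    and hol: "\<And>q v. q \<in> V \<Longrightarrow> fderiv \<phi> q (blinfun_apply (J q) v) = \<i> *s fderiv \<phi> q v"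
  obtains W and h :: "real ^ 'n \<Rightarrow> real ^ 'n" where "p \<in> W" "W \<subseteq> V" "chart_on W h" "h p = 0"
    "\<And>q. q \<in> W \<Longrightarrow> pullback (fderiv h q) (\<omega> p) = \<omega> q"
proof -
  obtain X F where X: "open X" "p \<in> X" "X \<subseteq> V" "smooth_on X F"
    and \<omega>F: "\<And>q vs. q \<in> X \<Longrightarrow> \<omega> q vs = Re (F q * det_form (map (fderiv \<phi> q) vs))"
    using complex_density[OF V J \<phi> p hol] by metis
  have chX: "chart_on X \<phi>" by (rule chart_on_subset[OF \<phi> X(1,3)])
  have XU: "X \<subseteq> U" using X(3) V by blast
  have F_hol: "fderiv F q (blinfun_apply (J q) u) = \<i> * fderiv F q u"
    if q: "q \<in> X" for q u
    using density_holomorphic[OF closed X(1) XU chX X(4) \<omega>F _ q] hol X(3) by blast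
  define c where "c = \<phi> p"
  let ?\<psi> = "inv_into X \<phi>"
  have ch: "open (\<phi> ` X)" "inj_on \<phi> X" "smooth_on X \<phi>" "smooth_on (\<phi> ` X) ?\<psi>"
    using chX by (auto simp: chart_on_def)
  obtain r where r: "r > 0" "ball c r \<subseteq> \<phi> ` X"
    using ch(1) X(2) openE unfolding c_def by (metis imageI)
  \<comment> \<open>The density in the chart, with the base point moved to the centre of the
    ball.\<close>
  define f where "f = (\<lambda>z. F (?\<psi> (c + z)))"
  have cz: "c + z \<in> \<phi> ` X" if "z \<in> ball 0 r" for z
  proof -
    have "c + z \<in> ball c r" using that by (simp add: dist_norm)
    then show ?thesis using r(2) by blast
  qed
  have smf: "smooth_on (ball 0 r) f"
    unfolding f_def
  proof (rule smooth_onI)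
    fix k
    have "Ck_on k (ball 0 r) (\<lambda>z. c + z)"
      by (intro Ck_on_add Ck_on_const Ck_on_bounded_linear bounded_linear_ident open_ball)
    then have "Ck_on k (ball 0 r) (\<lambda>z. ?\<psi> (c + z))"
      by (rule Ck_on_compose[OF open_ball smooth_onD[OF ch(4)]]) (use cz in blast)
    then show "Ck_on k (ball 0 r) (\<lambda>z. F (?\<psi> (c + z)))"
      by (rule Ck_on_compose[OF open_ball smooth_onD[OF X(4)]]) (use cz in \<open>auto intro: inv_into_into\<close>)
  qed
  have holf: "fderiv f z (\<i> *s v) = \<i> * fderiv f z v" if z: "z \<in> ball 0 r" for z v
  proof -
    define q where "q = ?\<psi> (c + z)"
    have q: "q \<in> X" "\<phi> q = c + z" using cz[OF z] by (auto simp: q_def inv_into_into f_inv_into_f)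
    obtain D' where D': "(?\<psi> has_derivative D') (at (\<phi> q))"
      "\<And>w. fderiv \<phi> q (D' w) = w" "\<And>v. D' (fderiv \<phi> q v) = v"
      using chart_derivative[OF chX q(1)] by metis
    have "((\<lambda>z. c + z) has_derivative (\<lambda>v. v)) (at z)" by (auto intro!: derivative_eq_intros)
    from has_derivative_compose[OF this, of ?\<psi> D'] D'(1)
    have "((\<lambda>z. ?\<psi> (c + z)) has_derivative D') (at z)" by (simp add: q(2))
    from has_derivative_compose[OF this, of F "fderiv F q"]
    have "(f has_derivative (\<lambda>v. fderiv F q (D' v))) (at z)"
      using smooth_on_has_derivative[OF X(4) q(1)] by (simp add: f_def q_def)
    then have fd: "fderiv f z = (\<lambda>v. fderiv F q (D' v))"
      using frechet_derivative_at by metis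
    have "\<i> *s v = fderiv \<phi> q (blinfun_apply (J q) (D' v))"
      using hol[of q] q(1) X(3) D'(2) by auto
    then have "D' (\<i> *s v) = blinfun_apply (J q) (D' v)" using D'(3) by metis
    then show ?thesis by (simp add: fd F_hol[OF q(1)])
  qed
  obtain w :: "complex ^ 'm \<Rightarrow> complex ^ 'm" where w: "smooth_on (ball 0 r) w" "w 0 = 0"
    "\<forall>z\<in>ball 0 r. \<forall>zs. det_form (map (fderiv w z) zs) = f z * det_form zs"
    using holomorphic_map_with_jacobian[OF smf holf] .
  define Y where "Y = X \<inter> \<phi> -` ball c r"
  have Y: "open Y" "p \<in> Y" "Y \<subseteq> X"
    unfolding Y_def using continuous_open_preimage[OF smooth_on_imp_continuous_on[OF ch(3)] X(1) open_ball] X(2) r(1)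
    by (auto simp: c_def)
  have Yb: "\<phi> q - c \<in> ball 0 r" if "q \<in> Y" for q
    using that by (auto simp: Y_def dist_norm norm_minus_commute)
  define \<xi> where "\<xi> = (\<lambda>q. w (\<phi> q - c))"
  define \<xi>' where "\<xi>' = (\<lambda>q v. fderiv w (\<phi> q - c) (fderiv \<phi> q v))"
  have \<xi>: "(\<xi> has_derivative \<xi>' q) (at q)" if q: "q \<in> Y" for q
  proof -
    have "(\<phi> has_derivative fderiv \<phi> q) (at q)"
      using q Y(3) by (intro smooth_on_has_derivative[OF ch(3)]) blast
    from has_derivative_diff[OF this has_derivative_const[of c]]
    have "((\<lambda>q. \<phi> q - c) has_derivative fderiv \<phi> q) (at q)" by simp
    from has_derivative_compose[OF this smooth_on_has_derivative[OF w(1) Yb[OF q]]]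
    show ?thesis unfolding \<xi>_def \<xi>'_def .
  qed
  \<comment> \<open>The Jacobian determinant of w absorbs the density F, so no factor remains in
    front of the determinant.\<close>
  have \<omega>\<xi>: "\<omega> q vs = Re (det_form (map (\<xi>' q) vs))" if q: "q \<in> Y" for q vs
  proof -
    have "det_form (map (\<xi>' q) vs) = f (\<phi> q - c) * det_form (map (fderiv \<phi> q) vs)"
      using w(3)[rule_format, OF Yb[OF q], of "map (fderiv \<phi> q) vs"] by (simp add: \<xi>'_def o_def)
    also have "f (\<phi> q - c) = F q" using q Y(3) ch(2) by (auto simp: f_def)
    finally show ?thesis using \<omega>F q Y(3) by auto
  qed
  define L where "L = \<xi>' p"
  have linL: "linear L" unfolding L_def using has_derivative_linear[OF \<xi>[OF Y(2)]] .
  obtain \<Psi> :: "real ^ 'n \<Rightarrow> complex ^ 'm" where \<Psi>: "complex_frame (\<omega> p) \<Psi>" using frames[of p] V p by blast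
  note \<Psi>D = complex_frameD(1,2)[OF \<Psi>]
  \<comment> \<open>A kernel vector of L would annihilate \<omega> p, which a frame shows to be
    nondegenerate.\<close>
  have "inj L"
  proof (rule linear_injective_0[OF linL, THEN iffD2], intro allI impI, rule ccontr)
    fix v assume "L v = 0" "v \<noteq> 0"
    then have "\<Psi> v \<noteq> 0" using \<Psi>D by (metis bij_is_inj linear_injective_0)
    then obtain zs where zs: "Re (1 * det_form (\<Psi> v # zs)) \<noteq> 0"
      using Re_det_form_nondegenerate[of "\<Psi> v" 1] card by (metis less_imp_le one_neq_zero)
    have "map \<Psi> (map (inv \<Psi>) zs) = zs" using \<Psi>D(2) by (simp add: o_def surj_f_inv_f bij_is_surj)
    then have "\<omega> p (v # map (inv \<Psi>) zs) \<noteq> 0"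
      using zs by (simp add: complex_frameD(3)[OF \<Psi>] del: map_map)
    moreover have "\<omega> p (v # us) = 0" for us
      using \<omega>\<xi>[OF Y(2), of "v # us"] \<open>L v = 0\<close> det_form_scale_head[of 0 0 "map (\<xi>' p) us"] by (simp add: L_def)
    ultimately show False by blast
  qed
  have DIM: "DIM(real ^ 'n) = DIM(complex ^ 'm)"
    using dim_image_eq[OF \<Psi>D(1), of UNIV] \<Psi>D(2) by (auto simp: bij_is_inj bij_is_surj)
  have bijL: "bij L" by (rule linear_inj_imp_bij[OF linL \<open>inj L\<close> DIM])
  note linv = linear_inv_of_bij[OF linL bijL]
  note blinv = bounded_linear_euclidean[OF linv]
  \<comment> \<open>Flatness compares \<omega> q with \<omega> p on the tangent space at p. Since
    \<omega> p is the pullback of the model by L, composing \<xi> with the inverse of L gives a map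
    into that space that pulls \<omega> p back to \<omega> q.\<close>
  define h where "h = (\<lambda>q. inv L (\<xi> q))"
  have hd: "(h has_derivative (\<lambda>v. inv L (\<xi>' q v))) (at q)" if "q \<in> Y" for q
    unfolding h_def by (rule bounded_linear.has_derivative[OF blinv \<xi>[OF that]])
  then have fdh: "fderiv h q = (\<lambda>v. inv L (\<xi>' q v))" if "q \<in> Y" for q
    using frechet_derivative_at that by metis
  have "smooth_on Y h"
    unfolding h_def \<xi>_def
  proof (rule smooth_onI)
    fix k
    have "Ck_on k Y (\<lambda>q. \<phi> q - c)"
      using ch(3) Y by (intro Ck_on_diff Ck_on_const) (auto simp: smooth_on_def intro: Ck_on_subset)
    then have "Ck_on k Y (\<lambda>q. w (\<phi> q - c))"
      by (rule Ck_on_compose[OF Y(1) smooth_onD[OF w(1)]]) (use Yb in auto)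
    then show "Ck_on k Y (\<lambda>q. inv L (w (\<phi> q - c)))"
      by (rule Ck_on_bounded_linear_compose[OF blinv Y(1)])
  qed
  moreover have "inj (fderiv h p)"
    unfolding fdh[OF Y(2)] L_def[symmetric] using \<open>inj L\<close> by (simp add: inj_def)
  ultimately obtain W where W: "open W" "p \<in> W" "W \<subseteq> Y" "chart_on W h"
    using smooth_local_inverse[OF Y(1,2)] by metis
  show thesis
  proof (rule that[OF W(2) _ W(4)])
    show "W \<subseteq> V" using W(3) Y(3) X(3) by blast
    show "h p = 0" using linear_0[OF linv] by (simp add: h_def \<xi>_def c_def w(2))
    fix q assume "q \<in> W"
    then have q: "q \<in> Y" using W(3) by blast
    have "L (inv L z) = z" for z using bijL by (simp add: surj_f_inv_f bij_is_surj)
    then have "map L (map (\<lambda>v. inv L (\<xi>' q v)) vs) = map (\<xi>' q) vs" for vs by (simp add: o_def)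
    then show "pullback (fderiv h q) (\<omega> p) = \<omega> q"
      by (simp add: fun_eq_iff pullback_def fdh[OF q] \<omega>\<xi>[OF q] \<omega>\<xi>[OF Y(2)] L_def[symmetric] del: map_map)
  qed
qed

end

text \<open>Flatness yields integrability of every adapted structure on every open subset, whereas
  the converse starts from one integrable structure near each point. In this form the two halves
  serve both the field of pairs and a global J.\<close>

lemma integrable_acs_iff_flat:
  fixes U :: "(real ^ 'm::finite bit0) set"
  assumes "complex_volume_form TYPE('m) U \<omega>" and closed: "closed_form U \<omega>"
  shows "flat_form U \<omega> \<Longrightarrow> open V \<Longrightarrow> V \<subseteq> U \<Longrightarrow> adapted_acs V \<omega> J \<Longrightarrow> integrable_acs V J"
    and "(\<And>p. p \<in> U \<Longrightarrow> \<exists>V J. p \<in> V \<and> V \<subseteq> U \<and> adapted_acs V \<omega> J \<and> integrable_acs V J) \<Longrightarrow> flat_form U \<omega>"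
proof -
  interpret complex_volume_form U \<omega> "TYPE('m)" by fact
  show "integrable_acs V J" if flat: "flat_form U \<omega>" and V: "open V" "V \<subseteq> U" "adapted_acs V \<omega> J"
  proof (rule integrable_acsI)
    fix p assume "p \<in> V"
    from flat_imp_holomorphic_chart[OF flat V this]
    show "\<exists>W (\<phi> :: real ^ 'm bit0 \<Rightarrow> complex ^ 'm). p \<in> W \<and> W \<subseteq> V \<and> chart_on W \<phi> \<and>
      (\<forall>q\<in>W. \<forall>v. fderiv \<phi> q (blinfun_apply (J q) v) = \<i> *s fderiv \<phi> q v)"
      by metis
  qed
  show "flat_form U \<omega>" if ex: "\<And>p. p \<in> U \<Longrightarrow> \<exists>V J. p \<in> V \<and> V \<subseteq> U \<and> adapted_acs V \<omega> J \<and> integrable_acs V J"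
    unfolding flat_form_def
  proof
    fix p assume "p \<in> U"
    then obtain V J where V: "p \<in> V" "V \<subseteq> U" "adapted_acs V \<omega> J" "integrable_acs V J" using ex by blast
    then obtain \<A> where \<A>: "complex_atlas V \<A>" "\<forall>(W, \<phi>)\<in>\<A>. \<forall>p\<in>W. \<forall>v.
        fderiv \<phi> p (blinfun_apply (J p) v) = \<i> *s fderiv \<phi> p v"
      unfolding integrable_acs_def by blast
    then obtain W \<phi> where W: "(W, \<phi>) \<in> \<A>" "p \<in> W" using V(1) unfolding complex_atlas_def by blast
    have WV: "W \<subseteq> V" "chart_on W \<phi>" using W(1) \<A>(1) unfolding complex_atlas_def by blast+
    have hol: "fderiv \<phi> q (blinfun_apply (J q) v) = \<i> *s fderiv \<phi> q v" if "q \<in> W" for q v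
      using \<A>(2) W(1) that by blast
    have "adapted_acs W \<omega> J" using V(3) WV(1) by (auto simp: adapted_acs_iff intro: smooth_on_subset)
    from integrable_imp_flat_chart[OF closed _ this WV(2) W(2) hol]
    show "\<exists>V (\<phi> :: real ^ 'm bit0 \<Rightarrow> real ^ 'm bit0). p \<in> V \<and> V \<subseteq> U \<and> chart_on V \<phi> \<and> \<phi> p = 0 \<and>
        (\<forall>q\<in>V. pullback (fderiv \<phi> q) (\<omega> p) = \<omega> q)"
      using WV(1) V(2) by (metis subset_trans)
  qed
qed

theorem theorem4p11:
  fixes U :: "(real ^ 'm::finite bit0) set"
    and \<omega> :: "real ^ 'm bit0 \<Rightarrow> (real ^ 'm bit0) list \<Rightarrow> real"
  assumes "CARD('m) > 2"
    and "open U"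
    and "smooth_form CARD('m) U \<omega>"
    and "closed_form U \<omega>"
    and "\<forall>p\<in>U. has_linear_type (\<omega> p) (re_complex_volume :: (real ^ 'm bit0) list \<Rightarrow> real)"
  shows
    "(\<exists>P. adapted_up_to_sign U \<omega> P \<and>
          (\<forall>P'. adapted_up_to_sign U \<omega> P' \<longrightarrow> (\<forall>p\<in>U. P' p = P p)) \<and>
          (flat_form U \<omega> \<longleftrightarrow> integrable_up_to_sign U P)) \<and>
     (odd CARD('m) \<or> (\<forall>C\<in>components U. simply_connected C) \<longrightarrow> (\<exists>J. adapted_acs U \<omega> J)) \<and>
     (\<forall>J J'. adapted_acs U \<omega> J \<longrightarrow> adapted_acs U \<omega> J' \<longrightarrow>
        (\<forall>C\<in>components U. (\<forall>p\<in>C. J' p = J p) \<or> (\<forall>p\<in>C. J' p = - J p))) \<and>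
     (\<forall>J. adapted_acs U \<omega> J \<longrightarrow> (flat_form U \<omega> \<longleftrightarrow> integrable_acs U J))"
proof -
  interpret complex_volume_form U \<omega> "TYPE('m)"
  proof
    show "\<exists>\<Psi> :: real ^ 'm bit0 \<Rightarrow> complex ^ 'm. complex_frame (\<omega> p) \<Psi>" if "p \<in> U" for p
      using complex_frame_exists assms(5) that by metis
  qed (fact assms)+
  have cvf: "complex_volume_form TYPE('m) U \<omega>" ..
  note integrableI = integrable_acs_iff_flat(1)[OF cvf assms(4)]
    and flatI = integrable_acs_iff_flat(2)[OF cvf assms(4)]
  have 1: "flat_form U \<omega> \<longleftrightarrow> integrable_up_to_sign U sign_pair"
  proof
    assume "flat_form U \<omega>"
    then show "integrable_up_to_sign U sign_pair"
      using integrableI represents_on_sign_pair_iff by (auto simp: integrable_up_to_sign_def)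
  next
    assume int: "integrable_up_to_sign U sign_pair"
    show "flat_form U \<omega>"
    proof (rule flatI)
      fix p assume "p \<in> U"
      then obtain V J where V: "p \<in> V" "V \<subseteq> U" "represents_on V J sign_pair"
        using adapted_up_to_sign_sign_pair unfolding adapted_up_to_sign_def acs_up_to_sign_def by blast
      then have "adapted_acs V \<omega> J" using represents_on_sign_pair_iff[OF V(2)] by simp
      moreover have "integrable_acs V J"
        using int[unfolded integrable_up_to_sign_def, rule_format, OF V(2,3)] .
      ultimately show "\<exists>V J. p \<in> V \<and> V \<subseteq> U \<and> adapted_acs V \<omega> J \<and> integrable_acs V J"
        using V(1,2) by blast
    qed
  qed
  have 2: "flat_form U \<omega> \<longleftrightarrow> integrable_acs U J" if J: "adapted_acs U \<omega> J" for J
  proof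
    show "integrable_acs U J" if "flat_form U \<omega>" by (rule integrableI[OF that open_U order_refl J])
    assume "integrable_acs U J"
    then show "flat_form U \<omega>" by (intro flatI exI[of _ U] exI[of _ J] conjI order_refl J)
  qed
  show ?thesis
  proof (intro conjI exI[of _ sign_pair] allI impI ballI)
    show "adapted_up_to_sign U \<omega> sign_pair" by (rule adapted_up_to_sign_sign_pair)
    show "P' p = sign_pair p" if "adapted_up_to_sign U \<omega> P'" "p \<in> U" for P' p
      by (rule adapted_up_to_sign_unique[OF that])
    show "\<exists>J. adapted_acs U \<omega> J" if "odd CARD('m) \<or> (\<forall>C\<in>components U. simply_connected C)"
      using that adapted_acs_if_odd adapted_acs_if_simply_connected by blast
    show "(\<forall>p\<in>C. J' p = J p) \<or> (\<forall>p\<in>C. J' p = - J p)"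
      if "adapted_acs U \<omega> J" "adapted_acs U \<omega> J'" "C \<in> components U" for J J' C
      by (rule adapted_acs_unique_on_components[OF that])
  qed (use 1 2 in blast)+
qed

end
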